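(* Let $E\subset\mathbb{R}^n$ be closed, let $S$ be a kernel as in the context (with parameters $m>0$, $\alpha,\beta\in(0,1]$, $K_1,K_2>0$), let $B\subset E$ be a closed ball in $E$ and let $\mu$ be a finite (non-negative) Borel measure with support in $B$. Let $\mathcal{D}_B(\omega)$, $\omega\in\Omega$, be a family of random dyadic lattices related to the ball $B$, as described in the context. Let $b\in L^\infty(\mu)$. Suppose $c_{acc}>0$, and for any $\omega\in\Omega$ let $T_\omega$ be the union of the maximal cubes $R\in\mathcal{D}_B(\omega)$ that satisfy $$\Big|\int_R b\,d\mu\Big|<c_{acc}\,\mu(R).$$ Assume that there exist a Borel set $H$, an exponent $s>0$ and constants $\delta_0\in(0,1)$ and $C_0,C_1>0$ so that the following conditions hold: (1) $\mu(T_\omega\cup H)\le\delta_0\,\mu(B)$ for all $\omega\in\Omega$. (2) If $B_r$ is a closed ball of radius $r$ in $E$ and $\mu(B_r)\ge C_0r^m$, then $B_r\subset H$. (3) $\sup_{\lambda>0}\lambda^s\mu\big(\{y\in B\setminus H:\mathcal{C}_\mu b(y)>\lambda\}\big)\le C_1\mu(B)$. Then there exists a set $G\subset B$ with $\mu(G)\ge\frac{1-\delta_0}{3}\mu(B)$ and a constant $C$ such that $$\|1_G\,\mathcal{C}_\mu f\|_{L^2(\mu)}\le C\|f\|_{L^2(\mu)}\quad\text{for all }f\in L^2(\mu),$$ where $C$ depends only on $n$, the kernel parameters $m,\alpha,\beta,K_1,K_2$, $\|b\|_{L^\infty(\mu)}$, $c_{acc}$, $s$, $\delta_0$, $C_0$,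 $C_1$ (and the parameters of the random dyadic family).
   Context: Setting. $E\subset\mathbb{R}^n$ is closed; $d(\cdot,\cdot)$ denotes Euclidean distance between points/sets. The kernel $S:(\mathbb{R}^n\setminus E)\times E\to\mathbb{C}$ is a measurable function satisfying, for fixed $\alpha,\beta\in(0,1]$, $m>0$, $K_1,K_2>0$, $$|S(x,y)|\le \frac{K_1}{|x-y|^{m+\alpha}}\quad\text{for all }(x,y)\in(\mathbb{R}^n\setminus E)\times E,$$ $$|S(x,y)-S(x,y')|\le K_2\frac{|y-y'|^\beta}{|x-y|^{m+\alpha+\beta}}\quad\text{for }x\in\mathbb{R}^n\setminus E,\ y,y'\in E,\ |y-y'|\le\tfrac{|x-y|}{2}.$$ $\sigma(A)=\int_A d(x,E)^{-n}\,dm_n(x)$ for Lebesgue measurable $A\subset\mathbb{R}^n\setminus E$ ($m_n$ is Lebesgue measure). For $y\in E$, $\Gamma(y)=\{x\in\mathbb{R}^n\setminus E:|x-y|<2d(x,E)\}$. For $f\in\bigcup_{p\in[1,\infty]}L^p(\mu)$: $T_\mu f(x)=\int_ES(x,z)f(z)\,d\mu(z)$, $x\in\mathbb{R}^n\setminus E$, and $$\mathcal{C}_\mu f(y)=\Big(\int_{\Gamma(y)}|T_\mu f(x)|^2d(x,E)^{2\alpha}\,d\sigma(x)\Big)^{1/2},\quad y\in E.$$ Balls in $E$: $B_E(y,r)=B(y,r)\cap E$ (open) and $\bar B_E(y,r)=\bar B(y,r)\cap E$ (closed), with $y\in E$, $r>0$. Random dyadic lattices related to $B$. Put $\delta=1/1000$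 and let $B$ have center $y_0\in E$ and radius $r_B$. Reference points: $\mathscr{X}_0\ni y_0$ is a maximal $1$-separated subset of $E$; for $k\ge0$, $\mathscr{X}_{k+1}\supset\mathscr{X}_k$ is a maximal $\delta^{k+1}$-separated subset of $E$; for $k\le 0$, $\mathscr{X}_{k-1}\subset\mathscr{X}_k$ is a maximal $\delta^{k-1}$-separated subset of $\mathscr{X}_k$ with $y_0\in\mathscr{X}_{k-1}$. Points of $\mathscr{X}_k$ are denoted $x^k_a$, with $a$ running over an index set. Let $\Omega=(\{0,\dots,L\}\times\{1,\dots,M\})^{\mathbb{Z}}$, where the integers $L,M$ depend only on the geometric doubling constant of $E$ (hence only on $n$), with the product probability under which the coordinates $\omega(k)$ are independent and uniformly distributed. With each $\omega\in\Omega$ are associated points $z^k_a(\omega)\in E$ and Borel sets (cubes) $Q^k_a(\omega)\subset E$; $\mathcal{D}_k(\omega)=\{Q^k_a(\omega)\}_a$ and $\mathcal{D}(\omega)=\bigcup_k\mathcal{D}_k(\omega)$. A cube is understood to carry its generation $k$ (cubes equal as sets but with different $k$ are regarded as different), and $\ell(Q^k_a(\omega))=\delta^k$. These are the random dyadic cubes of Auscher and Hytönen, with the following properties: (i) $B_E(z^k_a(\omega),\delta^k/6)\subset Q^k_a(\omega)\subset B_E(z^k_a(\omega),6\delta^k)$ and $B_E(x^k_a,\delta^k/8)\subset Q^k_a(\omega)\subset B_E(x^k_a,8\delta^k)$. (ii) For each $k$, the cubes of $\mathcal{D}_k(\omega)$ are pairwise disjoint and cover $E$. (iii) Any two cubes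 of $\mathcal{D}(\omega)$ are either disjoint or one is contained in the other. (iv) Let $k_0\in\mathbb{Z}$ be determined by $r_B<\delta^{k_0}/8\le\delta^{-1}r_B$, let $a_0$ be the index with $x^{k_0}_{a_0}=y_0$, and set $Q_B(\omega)=Q^{k_0}_{a_0}(\omega)$ (so that $B\subset Q_B(\omega)$) and $$\mathcal{D}_B(\omega)=\{Q^l_a(\omega)\in\mathcal{D}(\omega):l\ge k_0,\ Q^l_a(\omega)\subset Q_B(\omega)\}.$$ (v) Let $\gamma=\frac{\alpha}{2(m+\alpha)}$. For a positive integer $r$ and $\omega_0,\omega\in\Omega$, a cube $R\in\mathcal{D}(\omega_0)$ is called $\mathcal{D}_B(\omega)$-good if $\max(d(R,Q),d(R,E\setminus Q))\ge\ell(R)^\gamma\ell(Q)^{1-\gamma}$ for all $Q\in\mathcal{D}_B(\omega)$ with $\ell(Q)\ge\delta^{-r}\ell(R)$, and $\mathcal{D}_B(\omega)$-bad otherwise. There are constants $C=C(L,M)>0$ and $\eta\in(0,1]$ such that for all large enough $r$ (depending on $\gamma$), all $\omega_0\in\Omega$, all $k_1\ge k_0+r$ and all $R\in\mathcal{D}(\omega_0)$ with $\ell(R)\ge\delta^{k_1}$, $$\mathbb{P}\big(\{\omega\in\Omega_{k_0}^{k_1}:R\text{ is }\mathcal{D}_B(\omega)\text{-bad}\}\big)\le C\delta^{\gamma r\eta},$$ where $\Omega_{k_0}^{k_1}=\{\omega\in\Omega:\omega(j)=\omega_0(j)\text{ if }j<k_0\text{ or }j>k_1\}$ is equipped with the probability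 for which the coordinates $\omega(j)$, $k_0\le j\le k_1$, are independent and uniform. Maximality of a cube in $\mathcal{D}_B(\omega)$ is with respect to inclusion (and generation). *)

theory Defs
  imports "HOL-Probability.Probability"
begin

section \<open>Measure-theoretic notions\<close>

definition measure_support :: "'a::topological_space measure \<Rightarrow> 'a set" where
  "measure_support \<mu> = {x. \<forall>U. open U \<and> x \<in> U \<longrightarrow> 0 < emeasure \<mu> U}"

definition ennsqrt :: "ennreal \<Rightarrow> ennreal" where
  "ennsqrt t = (if t = \<top> then \<top> else ennreal (sqrt (enn2real t)))"

definition L2_norm :: "'a measure \<Rightarrow> ('a \<Rightarrow> ennreal) \<Rightarrow> ennreal" where
  "L2_norm \<mu> g = ennsqrt (\<integral>\<^sup>+ y. (g y)\<^sup>2 \<partial>\<mu>)"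

definition in_L2 :: "'a measure \<Rightarrow> ('a \<Rightarrow> complex) \<Rightarrow> bool" where
  "in_L2 \<mu> f \<longleftrightarrow> f \<in> borel_measurable \<mu> \<and> L2_norm \<mu> (\<lambda>y. ennreal (cmod (f y))) < \<top>"

text \<open>The norm takes values in \<^typ>\<open>ennreal\<close> rather than \<^typ>\<open>ereal\<close>, so that it
  is 0, and not \<open>-\<infinity>\<close>, for the zero measure.\<close>

definition Linf_norm :: "'a measure \<Rightarrow> ('a \<Rightarrow> complex) \<Rightarrow> ennreal" where
  "Linf_norm \<mu> f = esssup \<mu> (\<lambda>y. ennreal (cmod (f y)))"

text \<open>The infimum over the empty set is \<open>\<infinity>\<close>, unlike for \<^const>\<open>setdist\<close>. This matters in the
  definition of good cubes below, where a cube may be all of \<open>E\<close>.\<close>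

definition set_distance :: "'a::metric_space set \<Rightarrow> 'a set \<Rightarrow> ereal" where
  "set_distance A B = (INF x\<in>A. INF y\<in>B. ereal (dist x y))"

section \<open>The kernel and the conical square function\<close>

text \<open>Measurability of \<open>S\<close> refers to Lebesgue measurability in \<open>x\<close>, the variable that is
  integrated against Lebesgue measure, and to Borel measurability in \<open>y\<close>, the variable that
  is integrated against a Borel measure.\<close>

definition square_function_kernel ::
  "(real^'n) set \<Rightarrow> real \<Rightarrow> real \<Rightarrow> real \<Rightarrow> real \<Rightarrow> real \<Rightarrow> (real^'n \<Rightarrow> real^'n \<Rightarrow> complex) \<Rightarrow> bool"
where
  "square_function_kernel E m \<alpha> \<beta> K1 K2 S \<longleftrightarrow>
     (\<lambda>(x, y). S x y) \<in> borel_measurable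
        (restrict_space ((lebesgue :: (real^'n) measure) \<Otimes>\<^sub>M (borel :: (real^'n) measure)) ((- E) \<times> E)) \<and>
     (\<forall>x\<in>-E. \<forall>y\<in>E. cmod (S x y) \<le> K1 / norm (x - y) powr (m + \<alpha>)) \<and>
     (\<forall>x\<in>-E. \<forall>y\<in>E. \<forall>y'\<in>E. norm (y - y') \<le> norm (x - y) / 2 \<longrightarrow>
        cmod (S x y - S x y') \<le> K2 * norm (y - y') powr \<beta> / norm (x - y) powr (m + \<alpha> + \<beta>))"

definition sigma_measure :: "(real^'n) set \<Rightarrow> (real^'n) measure" where
  "sigma_measure E =
     density (restrict_space lebesgue (- E)) (\<lambda>x. ennreal (infdist x E powr (- real CARD('n))))"

definition cone :: "(real^'n) set \<Rightarrow> real^'n \<Rightarrow> (real^'n) set" where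
  "cone E y = {x \<in> - E. norm (x - y) < 2 * infdist x E}"

definition T_op ::
  "(real^'n) set \<Rightarrow> (real^'n \<Rightarrow> real^'n \<Rightarrow> complex) \<Rightarrow> (real^'n) measure \<Rightarrow>
   (real^'n \<Rightarrow> complex) \<Rightarrow> real^'n \<Rightarrow> complex"
where
  "T_op E S \<mu> f x = (LINT z:E|\<mu>. S x z * f z)"

definition C_op ::
  "(real^'n) set \<Rightarrow> real \<Rightarrow> (real^'n \<Rightarrow> real^'n \<Rightarrow> complex) \<Rightarrow> (real^'n) measure \<Rightarrow>
   (real^'n \<Rightarrow> complex) \<Rightarrow> real^'n \<Rightarrow> ennreal"
where
  "C_op E \<alpha> S \<mu> f y =
     ennsqrt (\<integral>\<^sup>+ x\<in>cone E y.
        ennreal ((cmod (T_op E S \<mu> f x))\<^sup>2 * infdist x E powr (2 * \<alpha>)) \<partial>sigma_measure E)"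

section \<open>Random dyadic lattices\<close>

definition ball_in :: "'a::metric_space set \<Rightarrow> 'a \<Rightarrow> real \<Rightarrow> 'a set" where
  "ball_in E y r = ball y r \<inter> E"

definition cball_in :: "'a::metric_space set \<Rightarrow> 'a \<Rightarrow> real \<Rightarrow> 'a set" where
  "cball_in E y r = cball y r \<inter> E"

definition separated :: "real \<Rightarrow> 'a::metric_space set \<Rightarrow> bool" where
  "separated r X \<longleftrightarrow> (\<forall>x\<in>X. \<forall>y\<in>X. x \<noteq> y \<longrightarrow> r \<le> dist x y)"

definition maximal_separated_in :: "real \<Rightarrow> 'a::metric_space set \<Rightarrow> 'a set \<Rightarrow> bool" where
  "maximal_separated_in r A X \<longleftrightarrow>
     X \<subseteq> A \<and> separated r X \<and> (\<forall>Y. X \<subseteq> Y \<and> Y \<subseteq> A \<and> separated r Y \<longrightarrow> Y = X)"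

definition dyadic_ratio :: real ("\<delta>\<^sub>D") where
  "\<delta>\<^sub>D = 1 / 1000"

type_synonym parameter = "int \<Rightarrow> nat \<times> nat"

definition alphabet :: "nat \<Rightarrow> nat \<Rightarrow> (nat \<times> nat) set" where
  "alphabet L M = {0..L} \<times> {1..M}"

definition parameter_space :: "nat \<Rightarrow> nat \<Rightarrow> parameter set" where
  "parameter_space L M = {\<omega>. \<forall>k. \<omega> k \<in> alphabet L M}"

text \<open>The law of the parameter that agrees with \<open>\<omega>0\<close> outside \<open>{k0..k1}\<close> and has independent
  uniformly distributed coordinates in \<open>{k0..k1}\<close>. Its support is \<open>\<Omega>\<^bsub>k0\<^esub>\<^bsup>k1\<^esup>\<close>.\<close>

definition resampled ::
  "nat \<Rightarrow> nat \<Rightarrow> int \<Rightarrow> int \<Rightarrow> parameter \<Rightarrow> parameter pmf"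
where
  "resampled L M k0 k1 \<omega>0 =
     map_pmf (\<lambda>\<tau> j. if j \<in> {k0..k1} then \<tau> j else \<omega>0 j)
       (Pi_pmf {k0..k1} undefined (\<lambda>_. pmf_of_set (alphabet L M)))"

text \<open>A cube is a pair of its generation and its underlying set. The cubes of generation \<open>k\<close>
  are indexed by the reference points in \<open>X k\<close>: the cube \<open>Q \<omega> k x\<close> is the one with reference
  point \<open>x\<close>.\<close>

type_synonym 'a cube = "int \<times> 'a set"

definition side_length :: "'a cube \<Rightarrow> real" where
  "side_length R = \<delta>\<^sub>D powi fst R"

definition lattice ::
  "(int \<Rightarrow> 'a set) \<Rightarrow> (parameter \<Rightarrow> int \<Rightarrow> 'a \<Rightarrow> 'a set) \<Rightarrow> parameter \<Rightarrow> 'a cube set"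
where
  "lattice X Q \<omega> = {(k, Q \<omega> k x) | k x. x \<in> X k}"

definition lattice_of_ball ::
  "(int \<Rightarrow> 'a set) \<Rightarrow> (parameter \<Rightarrow> int \<Rightarrow> 'a \<Rightarrow> 'a set) \<Rightarrow> int \<Rightarrow> 'a \<Rightarrow> parameter \<Rightarrow> 'a cube set"
where
  "lattice_of_ball X Q k0 y0 \<omega> = {(l, R) \<in> lattice X Q \<omega>. l \<ge> k0 \<and> R \<subseteq> Q \<omega> k0 y0}"

definition good_cube ::
  "'a::metric_space set \<Rightarrow> real \<Rightarrow> nat \<Rightarrow> 'a cube set \<Rightarrow> 'a cube \<Rightarrow> bool"
where
  "good_cube E \<gamma> r D R \<longleftrightarrow>
     (\<forall>Q\<in>D. side_length Q \<ge> \<delta>\<^sub>D powi (- int r) * side_length R \<longrightarrow>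
        max (set_distance (snd R) (snd Q)) (set_distance (snd R) (E - snd Q))
          \<ge> ereal (side_length R powr \<gamma> * side_length Q powr (1 - \<gamma>)))"

locale random_dyadic_family =
  fixes E :: "'a::metric_space set" and y0 :: 'a and rB :: real and k0 :: int
    and \<gamma> :: real and L M :: nat and Cbad \<eta> :: real and r0 :: nat
    and X :: "int \<Rightarrow> 'a set"
    and z :: "parameter \<Rightarrow> int \<Rightarrow> 'a \<Rightarrow> 'a"
    and Q :: "parameter \<Rightarrow> int \<Rightarrow> 'a \<Rightarrow> 'a set"
  assumes k0: "rB < \<delta>\<^sub>D powi k0 / 8" "\<delta>\<^sub>D powi k0 / 8 \<le> rB / \<delta>\<^sub>D"
    and X_0: "y0 \<in> X 0" "maximal_separated_in 1 E (X 0)"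
    and X_finer: "k \<ge> 0 \<Longrightarrow> X k \<subseteq> X (k + 1)"
      "k \<ge> 0 \<Longrightarrow> maximal_separated_in (\<delta>\<^sub>D powi (k + 1)) E (X (k + 1))"
    and X_coarser: "k \<le> 0 \<Longrightarrow> maximal_separated_in (\<delta>\<^sub>D powi (k - 1)) (X k) (X (k - 1))"
      "k \<le> 0 \<Longrightarrow> y0 \<in> X (k - 1)"
    and z_in: "\<lbrakk>\<omega> \<in> parameter_space L M; x \<in> X k\<rbrakk> \<Longrightarrow> z \<omega> k x \<in> E"
    and Q_borel: "\<lbrakk>\<omega> \<in> parameter_space L M; x \<in> X k\<rbrakk> \<Longrightarrow> Q \<omega> k x \<in> sets borel"
    and Q_subset: "\<lbrakk>\<omega> \<in> parameter_space L M; x \<in> X k\<rbrakk> \<Longrightarrow> Q \<omega> k x \<subseteq> E"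
    and ball_z: "\<lbrakk>\<omega> \<in> parameter_space L M; x \<in> X k\<rbrakk> \<Longrightarrow>
      ball_in E (z \<omega> k x) (\<delta>\<^sub>D powi k / 6) \<subseteq> Q \<omega> k x \<and>
      Q \<omega> k x \<subseteq> ball_in E (z \<omega> k x) (6 * \<delta>\<^sub>D powi k)"
    and ball_x: "\<lbrakk>\<omega> \<in> parameter_space L M; x \<in> X k\<rbrakk> \<Longrightarrow>
      ball_in E x (\<delta>\<^sub>D powi k / 8) \<subseteq> Q \<omega> k x \<and>
      Q \<omega> k x \<subseteq> ball_in E x (8 * \<delta>\<^sub>D powi k)"
    and disjoint: "\<omega> \<in> parameter_space L M \<Longrightarrow> disjoint_family_on (Q \<omega> k) (X k)"
    and cover: "\<omega> \<in> parameter_space L M \<Longrightarrow> (\<Union>x\<in>X k. Q \<omega> k x) = E"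
    and nested: "\<lbrakk>\<omega> \<in> parameter_space L M; R \<in> lattice X Q \<omega>; R' \<in> lattice X Q \<omega>\<rbrakk> \<Longrightarrow>
      snd R \<inter> snd R' = {} \<or> snd R \<subseteq> snd R' \<or> snd R' \<subseteq> snd R"
    and bad_prob: "\<lbrakk>r \<ge> 1; r \<ge> r0; \<omega>0 \<in> parameter_space L M; k1 \<ge> k0 + int r;
        R \<in> lattice X Q \<omega>0; side_length R \<ge> \<delta>\<^sub>D powi k1\<rbrakk> \<Longrightarrow>
      measure_pmf.prob (resampled L M k0 k1 \<omega>0)
        {\<omega>. \<not> good_cube E \<gamma> r (lattice_of_ball X Q k0 y0 \<omega>) R}
        \<le> Cbad * \<delta>\<^sub>D powr (\<gamma> * real r * \<eta>)"

definition maximal_cubes :: "'a cube set \<Rightarrow> 'a cube set" where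
  "maximal_cubes F =
     {R \<in> F. \<forall>R'\<in>F. snd R \<subseteq> snd R' \<and> fst R' \<le> fst R \<longrightarrow> R' = R}"

definition nonaccretive_cubes ::
  "'a measure \<Rightarrow> ('a \<Rightarrow> complex) \<Rightarrow> real \<Rightarrow> 'a cube set \<Rightarrow> 'a cube set"
where
  "nonaccretive_cubes \<mu> b c D =
     {R \<in> D. cmod (LINT y:snd R|\<mu>. b y) < c * measure \<mu> (snd R)}"

end

theory Submission
  imports Defs
begin

text \<open>
  The proof compares the operator with averages over dyadic cubes, and it uses \<open>b\<close> only through
  a bound for the action of the operator on the constant 1.

  Fix a lattice, let \<open>y\<close> lie in the ball and outside \<open>H\<close>, let \<open>Q\<close> be the cube of side \<open>t\<close> that
  contains \<open>y\<close>, and let \<open>x\<close> be a point of the cone over \<open>y\<close> at height comparable to \<open>t\<close>. Write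
  \<open>A f\<close> for the average of \<open>f\<close> over \<open>Q\<close>. In \<open>T f(x) - A f * T 1(x)\<close> the function \<open>f - A f\<close> splits
  into martingale differences \<open>D\<close>. Differences of cubes smaller than \<open>Q\<close> have mean zero and meet
  the smoothness of the kernel. Differences \<open>D\<close> of larger cubes enter as \<open>D - D(y)\<close>, which vanishes
  on a cube around \<open>y\<close>, and they meet the decay of the kernel, provided that \<open>y\<close> is far from the
  boundary of that cube. In both cases there is a gain that is geometric in the difference of the
  generations, while at points outside \<open>H\<close> the measure has growth of order \<open>m\<close>, so that Schur's
  test applies. The error of the comparison is therefore bounded by a \<^emph>\<open>majorant\<close>
  (\<open>pointwise_estimate\<close>), and the majorants of all generations are jointly bounded on \<open>L\<^sup>2\<close>
  (\<open>majorant_energy\<close>).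

  Apply this comparison to \<open>b\<close> first. If \<open>y\<close> lies in no cube where \<open>b\<close> fails to be accretive, then
  \<open>A b\<close> is bounded below, so \<open>T 1(x)\<close> is controlled by \<open>T b(x)\<close> and the majorant of \<open>b\<close>. Now apply
  it to \<open>f\<close>. The resulting bound for \<open>T f(x)\<close> consists of the majorant of \<open>f\<close> and of \<open>A f\<close>
  multiplied by quantities that come from \<open>b\<close> (\<open>slab_estimate\<close>). The sums over all generations
  of the squares of these quantities are bounded by constants, except on a set of small measure:
  for \<open>T b\<close> this is the weak type hypothesis, and for the majorant of \<open>b\<close> it is Chebyshev's inequality. Such points are
  simply discarded. Since \<open>A f\<close> is bounded by the dyadic maximal function, Doob's inequality
  finishes the estimate (\<open>good_part_estimate\<close>).

  What remains is the part of the square function where \<open>y\<close> is close to the boundary of a much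
  larger cube. Here the lattice is random. The set of points that are kept for the lattice \<open>\<omega>\<close>
  has measure at least \<open>2/3 (1 - \<delta>0) \<mu>(B)\<close>; let \<open>G\<close> be the set of the points that are kept with
  probability at least \<open>\<kappa> = (1 - \<delta>0)/6\<close>. Averaging over \<open>\<omega>\<close> bounds \<open>\<kappa>\<close> times the integral over \<open>G\<close>
  of the truncated square function by the good part, plus the bad probability times the same
  integral, which is absorbed (\<open>good_set\<close>). The set \<open>G\<close> depends on the truncation, because only
  finitely many generations of the lattice are random. The indicators of
  these sets have a weak limit that inherits the estimates, and the set where this limit is at
  least \<open>\<kappa>\<close> serves for all truncations (\<open>weak_limit_of_sets\<close>, \<open>big_piece\<close>).
\<close>

section \<open>Extended nonnegative numbers and supports\<close>

lemma power2_add_le_ennreal: "(a + b)\<^sup>2 \<le> 2 * a\<^sup>2 + 2 * (b::ennreal)\<^sup>2"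
proof (cases "a = \<top> \<or> b = \<top>")
  case True then show ?thesis by (auto simp: power2_eq_square ennreal_mult_eq_top_iff)
next
  case False
  then obtain x y where "a = ennreal x" "b = ennreal y" "x \<ge> 0" "y \<ge> 0"
    by (metis ennreal_cases)
  then show ?thesis
    using sum_squares_bound[of x y]
    by (simp flip: ennreal_plus ennreal_numeral ennreal_mult add: ennreal_power power2_sum)
qed

text \<open>The weights \<open>c\<close> are split as \<open>sqrt c * sqrt c\<close>, so that only the sum of the weights
  is lost and not their number.\<close>

lemma Cauchy_Schwarz_sum_ennreal:
  fixes a :: "'a \<Rightarrow> ennreal" and c :: "'a \<Rightarrow> real"
  assumes "finite J" and c: "\<And>j. j \<in> J \<Longrightarrow> 0 \<le> c j"
  shows "(\<Sum>j\<in>J. ennreal (c j) * a j)\<^sup>2 \<le> (\<Sum>j\<in>J. ennreal (c j)) * (\<Sum>j\<in>J. ennreal (c j) * (a j)\<^sup>2)"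
proof -
  have sq: "ennreal (sqrt (c j)) * ennreal (sqrt (c j)) = ennreal (c j)" if "j \<in> J" for j
    using c[OF that] by (simp flip: ennreal_mult)
  have "(\<integral>\<^sup>+ j. ennreal (sqrt (c j)) * (ennreal (sqrt (c j)) * a j) \<partial>count_space J)\<^sup>2 \<le>
      (\<integral>\<^sup>+ j. (ennreal (sqrt (c j)))\<^sup>2 \<partial>count_space J) *
      (\<integral>\<^sup>+ j. (ennreal (sqrt (c j)) * a j)\<^sup>2 \<partial>count_space J)"
    by (intro Cauchy_Schwarz_nn_integral) auto
  then show ?thesis
    using sq unfolding nn_integral_count_space_finite[OF assms(1)]
    by (simp add: mult.assoc[symmetric] power_mult_distrib power2_eq_square[of "ennreal (sqrt _)"] cong: sum.cong)
qed

lemma ennsqrt_le_iff: "l \<ge> 0 \<Longrightarrow> ennsqrt u \<le> ennreal l \<longleftrightarrow> u \<le> ennreal (l\<^sup>2)"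
  unfolding ennsqrt_def
  by (cases u) (auto simp: real_sqrt_le_iff' real_le_lsqrt real_sqrt_le_iff top_unique sqrt_le_D real_sqrt_ge_0_iff)

lemma ennsqrt_power2: "(ennsqrt u)\<^sup>2 = u"
  unfolding ennsqrt_def by (cases u) (auto simp: ennreal_power power_eq_top_ennreal)

lemma ennsqrt_mono: "u \<le> v \<Longrightarrow> ennsqrt u \<le> ennsqrt v"
  unfolding ennsqrt_def by (cases u; cases v) (auto simp: top_unique)

lemma ennsqrt_mult: "a \<ge> 0 \<Longrightarrow> ennsqrt (ennreal (a\<^sup>2) * u) \<le> ennreal a * ennsqrt u"
  unfolding ennsqrt_def
  by (cases u; cases "a = 0")
    (auto simp: ennreal_mult[symmetric] real_sqrt_mult ennreal_mult_eq_top_iff ennreal_mult_top)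

text \<open>The complement of the support is a union of open null sets; by second countability
  countably many of them suffice.\<close>

lemma AE_in_measure_support:
  fixes \<mu> :: "'a::{second_countable_topology} measure"
  assumes "sets \<mu> = sets borel"
  shows "AE x in \<mu>. x \<in> measure_support \<mu>"
proof -
  define \<U> where "\<U> = {U. open U \<and> emeasure \<mu> U = 0}"
  obtain \<V> where V: "\<V> \<subseteq> \<U>" "countable \<V>" "\<Union>\<V> = \<Union>\<U>"
    using Lindelof[of \<U>] unfolding \<U>_def by auto
  have "(\<Union>U\<in>\<V>. U) \<in> null_sets \<mu>"
    using V assms unfolding \<U>_def by (intro null_sets_UN') (auto simp: null_sets_def)
  moreover have "{x \<in> space \<mu>. x \<notin> measure_support \<mu>} \<subseteq> (\<Union>U\<in>\<V>. U)"
    using V(3) unfolding \<U>_def measure_support_def by (auto simp: zero_less_iff_neq_zero)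
  ultimately show ?thesis by (intro AE_I'[of "\<Union>U\<in>\<V>. U"]) auto
qed

section \<open>Averages over nested finite partitions\<close>

definition square_integrable :: "'a measure \<Rightarrow> ('a \<Rightarrow> 'b::euclidean_space) \<Rightarrow> bool" where
  "square_integrable M f \<longleftrightarrow> f \<in> borel_measurable M \<and> integrable M (\<lambda>y. (norm (f y))\<^sup>2)"

lemma square_integrable_borel: "square_integrable M f \<Longrightarrow> f \<in> borel_measurable M"
  unfolding square_integrable_def by blast

lemma (in finite_measure) integrable_of_square_integrable:
  fixes f :: "'a \<Rightarrow> 'b::euclidean_space"
  assumes "square_integrable M f" shows "integrable M f"
proof -
  have "integrable M (\<lambda>y. norm (f y))"
    using assms unfolding square_integrable_def
    by (intro square_integrable_imp_integrable[of "\<lambda>y. norm (f y)"] borel_measurable_norm) auto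
  then show ?thesis
    using assms unfolding square_integrable_def by (simp add: integrable_norm_iff)
qed

text \<open>The cells at level \<open>i\<close> are the sets \<open>P i y\<close>. There are finitely many of each level, so the
  conditional expectations are finite sums and everything that is constant on cells is bounded.\<close>

locale nested_partitions = finite_measure M for M :: "'a measure" +
  fixes P :: "nat \<Rightarrow> 'a \<Rightarrow> 'a set"
  assumes space_UNIV: "space M = UNIV"
    and cell_mem: "y \<in> P i y"
    and cell_eq: "z \<in> P i y \<Longrightarrow> P i z = P i y"
    and cell_sets: "P i y \<in> sets M"
    and finite_cells: "finite (range (P i))"
    and cell_Suc: "P (Suc i) y \<subseteq> P i y"
begin

text \<open>On a null cell the average is 0, by the convention for division. The integral over a null
  cell is 0 as well, so \<open>avg\<close> is a version of the conditional expectation.\<close>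

definition avg :: "nat \<Rightarrow> ('a \<Rightarrow> 'b::euclidean_space) \<Rightarrow> 'a \<Rightarrow> 'b" where
  "avg i f y = (LINT z:P i y|M. f z) /\<^sub>R measure M (P i y)"

definition cell_const :: "nat \<Rightarrow> ('a \<Rightarrow> 'b) \<Rightarrow> bool" where
  "cell_const i g \<longleftrightarrow> (\<forall>y. \<forall>z\<in>P i y. g z = g y)"

lemma cell_mono: "i \<le> j \<Longrightarrow> P j y \<subseteq> P i y"
  by (induction j rule: dec_induct) (use cell_Suc in auto)

lemma cell_const_avg: "cell_const i (avg i f)"
  unfolding cell_const_def avg_def using cell_eq by metis

lemma cell_const_mono: "cell_const i g \<Longrightarrow> i \<le> j \<Longrightarrow> cell_const j g"
  unfolding cell_const_def using cell_mono by blast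

text \<open>A function that is constant on cells factors through the cells. This yields its
  measurability and boundedness.\<close>

lemma cell_const_obtain:
  assumes "cell_const i g"
  obtains h where "\<And>y. g y = h (P i y)"
proof
  fix y
  have "(SOME z. z \<in> P i y) \<in> P i y"
    using cell_mem someI by metis
  then show "g y = (\<lambda>Q. g (SOME z. z \<in> Q)) (P i y)"
    using assms unfolding cell_const_def by simp
qed

lemma cell_measurable: "P i \<in> M \<rightarrow>\<^sub>M count_space UNIV"
proof (rule measurableI)
  fix A
  have "P i -` A \<inter> space M = \<Union>(range (P i) \<inter> A)"
    using space_UNIV cell_mem cell_eq by auto
  also have "\<dots> \<in> sets M"
    using finite_cells[of i] cell_sets by (intro sets.finite_Union) auto
  finally show "P i -` A \<inter> space M \<in> sets M" .
qed auto

lemma cell_const_measurable: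
  assumes "cell_const i g" and "\<And>y. g y \<in> space N"
  shows "g \<in> M \<rightarrow>\<^sub>M N"
proof -
  obtain h where h: "\<And>y. g y = h (P i y)"
    using cell_const_obtain[OF assms(1)] by blast
  obtain h' where h': "\<And>y. g y = h' (P i y)" "h' \<in> UNIV \<rightarrow> space N"
  proof
    fix y0 :: 'a
    show "g y = (\<lambda>Q. if Q \<in> range (P i) then h Q else g y0) (P i y)" for y
      using h by auto
    show "(\<lambda>Q. if Q \<in> range (P i) then h Q else g y0) \<in> UNIV \<rightarrow> space N"
      using assms(2) h by (auto; metis)
  qed
  have "(\<lambda>y. h' (P i y)) \<in> M \<rightarrow>\<^sub>M N"
    using measurable_compose[OF cell_measurable, of h' N i] h'(2) by auto
  then show ?thesis
    using h'(1) by (simp add: fun_eq_iff[symmetric] cong: measurable_cong)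
qed

lemma cell_const_borel:
  fixes g :: "'a \<Rightarrow> 'b::topological_space"
  shows "cell_const i g \<Longrightarrow> g \<in> borel_measurable M"
  by (rule cell_const_measurable) auto

lemma cell_const_bounded:
  fixes g :: "'a \<Rightarrow> 'b::real_normed_vector"
  assumes "cell_const i g"
  obtains C where "\<And>y. norm (g y) \<le> C"
proof -
  obtain h where h: "\<And>y. g y = h (P i y)"
    using cell_const_obtain[OF assms] by blast
  have "norm (g y) \<le> Max ((\<lambda>Q. norm (h Q)) ` range (P i))" for y
    using finite_cells[of i] h by (intro Max_ge) auto
  then show ?thesis using that by blast
qed

lemma cell_const_times_integrable:
  fixes g f :: "'a \<Rightarrow> 'b::euclidean_space"
  assumes "cell_const i g" "integrable M f"
  shows "integrable M (\<lambda>y. g y \<bullet> f y)"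
proof -
  obtain C where C: "\<And>y. norm (g y) \<le> C"
    using cell_const_bounded[OF assms(1)] by blast
  have g: "g \<in> borel_measurable M" and f: "f \<in> borel_measurable M"
    using cell_const_borel[OF assms(1)] assms(2) by auto
  show ?thesis
  proof (rule Bochner_Integration.integrable_bound)
    show "integrable M (\<lambda>y. C * norm (f y))" using assms(2) by simp
    show "(\<lambda>y. g y \<bullet> f y) \<in> borel_measurable M" using g f by simp
    have "\<bar>g y \<bullet> f y\<bar> \<le> norm (C * norm (f y))" for y
      using Cauchy_Schwarz_ineq2[of "g y" "f y"] C[of y]
      by (smt (verit) mult_right_mono norm_ge_zero real_norm_def)
    then show "AE y in M. norm (g y \<bullet> f y) \<le> norm (C * norm (f y))" by simp
  qed
qed

lemma cell_const_integrable:
  fixes g :: "'a \<Rightarrow> 'b::euclidean_space"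
  assumes "cell_const i g"
  shows "integrable M g"
proof -
  obtain C where C: "\<And>y. norm (g y) \<le> C"
    using cell_const_bounded[OF assms] by blast
  then show ?thesis
    using cell_const_borel[OF assms] by (intro integrable_const_bound[of _ C]) auto
qed

lemma integral_partition:
  fixes f :: "'a \<Rightarrow> 'b::euclidean_space"
  assumes "integrable M f"
  shows "(LINT y|M. f y) = (\<Sum>Q\<in>range (P i). LINT y:Q|M. f y)"
proof -
  have "f y = (\<Sum>Q\<in>range (P i). indicator Q y *\<^sub>R f y)" for y
  proof -
    have "(\<Sum>Q\<in>range (P i). indicator Q y *\<^sub>R f y) =
        (\<Sum>Q\<in>range (P i). if P i y = Q then f y else 0)"
      using cell_mem cell_eq by (intro sum.cong) (auto simp: indicator_def)
    also have "\<dots> = f y" using finite_cells[of i] by (subst sum.delta') auto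
    finally show ?thesis by simp
  qed
  then have "(LINT y|M. f y) = (LINT y|M. (\<Sum>Q\<in>range (P i). indicator Q y *\<^sub>R f y))"
    by simp
  also have "\<dots> = (\<Sum>Q\<in>range (P i). LINT y:Q|M. f y)"
    unfolding set_lebesgue_integral_def using assms cell_sets
    by (intro Bochner_Integration.integral_sum integrable_mult_indicator) auto
  finally show ?thesis .
qed

lemma integral_cell_avg_same:
  fixes f :: "'a \<Rightarrow> 'b::euclidean_space"
  assumes "integrable M f"
  shows "(LINT z:P i y|M. avg i f z) = (LINT z:P i y|M. f z)"
proof -
  have "(LINT z:P i y|M. avg i f z) = (LINT z:P i y|M. avg i f y)"
    using cell_const_avg[of i f] cell_sets unfolding cell_const_def
    by (intro set_lebesgue_integral_cong) auto
  also have "\<dots> = measure M (P i y) *\<^sub>R avg i f y"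
    using cell_sets[of i y] unfolding set_lebesgue_integral_def
    by (simp add: emeasure_eq_measure)
  also have "\<dots> = (LINT z:P i y|M. f z)"
  proof (cases "measure M (P i y) = 0")
    case True
    then have "P i y \<in> null_sets M"
      using cell_sets[of i y] by (auto simp: null_sets_def emeasure_eq_measure)
    then have "(LINT z:P i y|M. f z) = 0"
      using AE_not_in[of "P i y" M] unfolding set_lebesgue_integral_def
      by (intro integral_eq_zero_AE) (auto elim!: eventually_mono simp: indicator_def)
    then show ?thesis using True by simp
  next
    case False
    then show ?thesis by (simp add: avg_def)
  qed
  finally show ?thesis .
qed

text \<open>The averages are the conditional expectation: they have the same integral against every
  function that is constant on cells.\<close>

lemma integral_inner_avg:
  fixes f g :: "'a \<Rightarrow> 'b::euclidean_space"
  assumes "cell_const i g" "integrable M f"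
  shows "(LINT y|M. g y \<bullet> avg i f y) = (LINT y|M. g y \<bullet> f y)"
proof -
  have *: "(LINT z:Q|M. g z \<bullet> u z) = g y \<bullet> (LINT z:Q|M. u z)"
    if "Q = P i y" "integrable M u" for Q y and u :: "'a \<Rightarrow> 'b"
  proof -
    have "(LINT z:Q|M. g z \<bullet> u z) = (LINT z:Q|M. g y \<bullet> u z)"
      using assms(1) cell_sets that(1) unfolding cell_const_def
      by (intro set_lebesgue_integral_cong) auto
    also have "\<dots> = (LINT z|M. g y \<bullet> (indicator Q z *\<^sub>R u z))"
      unfolding set_lebesgue_integral_def by (simp add: inner_scaleR_right)
    also have "\<dots> = g y \<bullet> (LINT z:Q|M. u z)"
      unfolding set_lebesgue_integral_def using that cell_sets
      by (intro integral_inner_right integrable_mult_indicator) auto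
    finally show ?thesis .
  qed
  have a: "integrable M (avg i f)"
    by (rule cell_const_integrable[OF cell_const_avg])
  have "(LINT y|M. g y \<bullet> avg i f y) = (\<Sum>Q\<in>range (P i). LINT y:Q|M. g y \<bullet> avg i f y)"
    by (rule integral_partition[OF cell_const_times_integrable[OF assms(1) a]])
  also have "\<dots> = (\<Sum>Q\<in>range (P i). LINT y:Q|M. g y \<bullet> f y)"
  proof (rule sum.cong[OF refl])
    fix Q assume "Q \<in> range (P i)"
    then obtain y where y: "Q = P i y" by auto
    show "(LINT y:Q|M. g y \<bullet> avg i f y) = (LINT y:Q|M. g y \<bullet> f y)"
      unfolding *[OF y a] *[OF y assms(2)]
      using integral_cell_avg_same[OF assms(2), of i y] y by simp
  qed
  also have "\<dots> = (LINT y|M. g y \<bullet> f y)"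
    by (rule integral_partition[OF cell_const_times_integrable[OF assms], symmetric])
  finally show ?thesis .
qed

text \<open>The test functions that are constant on \<open>P j y\<close>, with values in the basis, reduce this to
  \<open>integral_inner_avg\<close> one coordinate at a time.\<close>

lemma integral_cell_avg:
  fixes f :: "'a \<Rightarrow> 'b::euclidean_space"
  assumes "integrable M f" "j \<le> i"
  shows "(LINT z:P j y|M. avg i f z) = (LINT z:P j y|M. f z)"
proof (rule euclidean_eqI)
  fix b :: 'b assume "b \<in> Basis"
  define g where "g z = (if z \<in> P j y then b else 0)" for z
  have "cell_const j g"
    unfolding cell_const_def g_def
  proof (intro allI ballI)
    fix x z assume "z \<in> P j x"
    then have "P j z = P j x" by (rule cell_eq)
    then have "z \<in> P j y \<longleftrightarrow> x \<in> P j y"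
      using cell_mem[of x j] cell_mem[of z j] cell_eq[of x j y] cell_eq[of z j y] by auto
    then show "(if z \<in> P j y then b else 0) = (if x \<in> P j y then b else 0)" by simp
  qed
  then have g: "cell_const i g" using assms(2) by (rule cell_const_mono)
  have *: "(LINT z:P j y|M. u z) \<bullet> b = (LINT z|M. g z \<bullet> u z)"
    if "integrable M u" for u :: "'a \<Rightarrow> 'b"
  proof -
    have "(LINT z:P j y|M. u z) \<bullet> b = (LINT z|M. (indicator (P j y) z *\<^sub>R u z) \<bullet> b)"
      unfolding set_lebesgue_integral_def using that cell_sets
      by (intro integral_inner_left[symmetric] integrable_mult_indicator) auto
    also have "\<dots> = (LINT z|M. g z \<bullet> u z)"
      by (intro Bochner_Integration.integral_cong) (auto simp: g_def inner_commute)
    finally show ?thesis .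
  qed
  show "(LINT z:P j y|M. avg i f z) \<bullet> b = (LINT z:P j y|M. f z) \<bullet> b"
    unfolding *[OF assms(1)] *[OF cell_const_integrable[OF cell_const_avg]]
    by (rule integral_inner_avg[OF g assms(1)])
qed

lemma avg_avg:
  fixes f :: "'a \<Rightarrow> 'b::euclidean_space"
  assumes "integrable M f" "j \<le> i"
  shows "avg j (avg i f) = avg j f"
  unfolding avg_def[of j "avg i f"] avg_def[of j f] integral_cell_avg[OF assms] ..

lemma cell_const_square_integrable:
  fixes g :: "'a \<Rightarrow> 'b::euclidean_space"
  assumes "cell_const i g" shows "square_integrable M g"
  unfolding square_integrable_def power2_norm_eq_inner
  using cell_const_borel[OF assms] cell_const_times_integrable[OF assms cell_const_integrable[OF assms]]
  by simp

text \<open>The cross term is the integral of \<open>avg i f \<bullet> f\<close>, which by \<open>integral_inner_avg\<close> equals the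
  energy of \<open>avg i f\<close>.\<close>

lemma pythagoras_avg:
  fixes f :: "'a \<Rightarrow> 'b::euclidean_space"
  assumes "square_integrable M f"
  shows "(LINT y|M. (norm (f y - avg i f y))\<^sup>2) =
      (LINT y|M. (norm (f y))\<^sup>2) - (LINT y|M. (norm (avg i f y))\<^sup>2)"
    and "square_integrable M (\<lambda>y. f y - avg i f y)"
proof -
  note f = integrable_of_square_integrable[OF assms]
  note a = cell_const_avg[of i f]
  have e: "(norm (f y - avg i f y))\<^sup>2 =
      (norm (f y))\<^sup>2 - 2 * (avg i f y \<bullet> f y) + avg i f y \<bullet> avg i f y" for y
    by (simp add: power2_norm_eq_inner inner_diff_left inner_diff_right inner_commute)
  have i: "integrable M (\<lambda>y. (norm (f y))\<^sup>2)" "integrable M (\<lambda>y. avg i f y \<bullet> f y)"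
      "integrable M (\<lambda>y. avg i f y \<bullet> avg i f y)"
    using assms f cell_const_times_integrable[OF a] cell_const_integrable[OF a]
    unfolding square_integrable_def by auto
  show "(LINT y|M. (norm (f y - avg i f y))\<^sup>2) =
      (LINT y|M. (norm (f y))\<^sup>2) - (LINT y|M. (norm (avg i f y))\<^sup>2)"
    unfolding e using i integral_inner_avg[OF a f]
    by (simp add: power2_norm_eq_inner)
  show "square_integrable M (\<lambda>y. f y - avg i f y)"
    unfolding square_integrable_def e
    using i assms cell_const_borel[OF a] unfolding square_integrable_def by auto
qed

text \<open>This is the cancellation that is used against the smoothness of the kernel: a kernel that
  is frozen on each cell does not see functions with mean zero on the cells.\<close>

lemma integral_cell_const_mult_eq_0:
  fixes h g :: "'a \<Rightarrow> complex"
  assumes h: "cell_const j h" and g: "integrable M g" and z: "\<And>y. (LINT z:P j y|M. g z) = 0"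
  shows "integrable M (\<lambda>z. h z * g z)" "(LINT z|M. h z * g z) = 0"
proof -
  obtain C where C: "\<And>y. norm (h y) \<le> C" using cell_const_bounded[OF h] by blast
  show i: "integrable M (\<lambda>z. h z * g z)"
  proof (rule Bochner_Integration.integrable_bound)
    show "integrable M (\<lambda>z. C * norm (g z))" using g by simp
    show "(\<lambda>z. h z * g z) \<in> borel_measurable M"
      using cell_const_borel[OF h] g by (intro borel_measurable_times) auto
    have "norm (h z * g z) \<le> C * norm (g z)" for z
      using C[of z] by (simp add: norm_mult mult_right_mono)
    then show "AE z in M. norm (h z * g z) \<le> norm (C * norm (g z))"
      by (intro AE_I2) (metis abs_ge_self order_trans real_norm_def)
  qed
  have "(LINT z:P j y|M. h z * g z) = 0" for y
  proof -
    have "(LINT z:P j y|M. h z * g z) = (LINT z:P j y|M. h y * g z)"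
      using h cell_sets unfolding cell_const_def by (intro set_lebesgue_integral_cong) auto
    also have "\<dots> = h y * (LINT z:P j y|M. g z)" by (rule set_integral_mult_right)
    finally show ?thesis using z by simp
  qed
  then show "(LINT z|M. h z * g z) = 0"
    unfolding integral_partition[OF i, of j] by (intro sum.neutral) auto
qed

lemma norm_avg_le:
  fixes f :: "'a \<Rightarrow> 'b::euclidean_space"
  assumes "integrable M f"
  shows "norm (avg i f y) \<le> avg i (\<lambda>z. norm (f z)) y"
proof -
  have "norm (LINT z:P i y|M. f z) \<le> (LINT z|M. norm (indicator (P i y) z *\<^sub>R f z))"
    unfolding set_lebesgue_integral_def by (rule integral_norm_bound)
  also have "\<dots> = (LINT z:P i y|M. norm (f z))"
    unfolding set_lebesgue_integral_def by simp
  finally show ?thesis unfolding avg_def by (simp add: divide_right_mono field_simps)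
qed

lemma square_integrable_norm:
  "square_integrable M (f :: 'a \<Rightarrow> 'b::euclidean_space) \<Longrightarrow> square_integrable M (\<lambda>z. norm (f z))"
  unfolding square_integrable_def by (auto intro: borel_measurable_norm)

text \<open>The martingale differences of \<open>f\<close> up to level \<open>n\<close>. The last one, for \<open>j = n\<close>, is the whole
  remainder \<open>f - avg n f\<close>, so that the finite decomposition of \<open>f\<close> is exact.\<close>

definition mdiff :: "nat \<Rightarrow> nat \<Rightarrow> ('a \<Rightarrow> 'b::euclidean_space) \<Rightarrow> 'a \<Rightarrow> 'b" where
  "mdiff n j f y = (if j < n then avg (Suc j) f y else f y) - avg j f y"

lemma avg_plus_mdiff:
  assumes "i \<le> n"
  shows "f y = avg i f y + (\<Sum>j=i..n. mdiff n j f y)"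
  using assms
proof (induction i rule: inc_induct)
  case base
  then show ?case by (simp add: mdiff_def)
next
  case (step k)
  then show ?case
    by (simp add: sum.atLeast_Suc_atMost[of k n] mdiff_def)
qed

lemma avg_eq_sum_mdiff:
  assumes "i \<le> n"
  shows "avg i f y = avg 0 f y + (\<Sum>j<i. mdiff n j f y)"
  using assms by (induction i) (auto simp: mdiff_def)

lemma mdiff_square_integrable:
  fixes f :: "'a \<Rightarrow> 'b::euclidean_space"
  assumes "square_integrable M f"
  shows "square_integrable M (mdiff n j f)"
proof (cases "j < n")
  case True
  have "cell_const (Suc j) (mdiff n j f)"
    using True cell_const_avg[of "Suc j" f] cell_const_mono[OF cell_const_avg[of j f], of "Suc j"]
    unfolding cell_const_def mdiff_def by auto
  then show ?thesis by (rule cell_const_square_integrable)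
next
  case False
  then have "mdiff n j f = (\<lambda>y. f y - avg j f y)"
    unfolding mdiff_def by auto
  then show ?thesis using pythagoras_avg(2)[OF assms] by simp
qed

lemma cell_const_mdiff:
  assumes "j < n" shows "cell_const (Suc j) (mdiff n j f)"
  using assms cell_const_avg[of "Suc j" f] cell_const_mono[OF cell_const_avg[of j f], of "Suc j"]
  unfolding cell_const_def mdiff_def by auto

lemma integral_cell_mdiff:
  fixes f :: "'a \<Rightarrow> 'b::euclidean_space"
  assumes "square_integrable M f"
  shows "(LINT z:P j y|M. mdiff n j f z) = 0"
proof -
  note f = integrable_of_square_integrable[OF assms]
  have a: "set_integrable M (P j y) (avg i f)" "set_integrable M (P j y) f" for i
    unfolding set_integrable_def
    using cell_const_integrable[OF cell_const_avg[of i f]] cell_sets f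
    by (auto intro!: integrable_mult_indicator)
  show ?thesis
    using integral_cell_avg[OF f, of j j y] integral_cell_avg[OF f, of j "Suc j" y]
    unfolding mdiff_def by (cases "j < n") (auto simp: set_integral_diff a)
qed

text \<open>By the tower property, each difference is the error of averaging \<open>avg (Suc j) f\<close>, so the
  energies telescope.\<close>

lemma sum_mdiff_energy:
  fixes f :: "'a \<Rightarrow> 'b::euclidean_space"
  assumes f: "square_integrable M f"
  shows "(\<Sum>j\<le>n. LINT y|M. (norm (mdiff n j f y))\<^sup>2) \<le> (LINT y|M. (norm (f y))\<^sup>2)"
proof -
  define e where "e i = (LINT y|M. (norm (avg i f y))\<^sup>2)" for i
  have "(LINT y|M. (norm (mdiff n j f y))\<^sup>2) = e (Suc j) - e j" if "j < n" for j
    using that pythagoras_avg(1)[OF cell_const_square_integrable[OF cell_const_avg[of "Suc j" f]], of j]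
      avg_avg[OF integrable_of_square_integrable[OF f], of j "Suc j"]
    by (simp add: mdiff_def e_def)
  then have "(\<Sum>j<n. LINT y|M. (norm (mdiff n j f y))\<^sup>2) = (\<Sum>j<n. e (Suc j) - e j)"
    by (intro sum.cong) auto
  also have "\<dots> = e n - e 0" by (rule sum_lessThan_telescope)
  finally have "(\<Sum>j\<le>n. LINT y|M. (norm (mdiff n j f y))\<^sup>2) =
      (LINT y|M. (norm (f y))\<^sup>2) - e 0"
    using pythagoras_avg(1)[OF f, of n]
    by (simp add: lessThan_Suc_atMost[symmetric] mdiff_def e_def)
  then show ?thesis unfolding e_def by simp
qed

lemma avg_energy:
  fixes f :: "'a \<Rightarrow> 'b::euclidean_space"
  assumes f: "square_integrable M f"
  shows "(LINT y|M. (norm (avg i f y))\<^sup>2) \<le> (LINT y|M. (norm (f y))\<^sup>2)"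
proof -
  have "0 \<le> (LINT y|M. (norm (f y - avg i f y))\<^sup>2)" by simp
  then show ?thesis using pythagoras_avg(1)[OF f, of i] by simp
qed

fun avg_max :: "nat \<Rightarrow> ('a \<Rightarrow> real) \<Rightarrow> 'a \<Rightarrow> real" where
  "avg_max 0 f y = avg 0 f y"
| "avg_max (Suc n) f y = max (avg_max n f y) (avg (Suc n) f y)"

lemma avg_le_avg_max: "i \<le> n \<Longrightarrow> avg i f y \<le> avg_max n f y"
  by (induction n) (auto simp: le_Suc_eq max_def)

lemma cell_const_avg_max: "cell_const n (avg_max n f)"
proof (induction n)
  case 0
  show ?case using cell_const_avg[of 0 f] unfolding cell_const_def by simp
next
  case (Suc n)
  have "cell_const (Suc n) (avg_max n f)" by (rule cell_const_mono[OF Suc]) simp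
  then show ?case
    using cell_const_avg[of "Suc n" f] unfolding cell_const_def avg_max.simps by metis
qed

text \<open>The pathwise form of Doob's inequality. Summation by parts moves the differences to the
  running maximum, which moves only when it equals the current average; the products that
  remain on the right have mean zero, which gives \<open>doob_avg_max\<close>.\<close>

lemma avg_max_pathwise:
  "(avg_max n f y)\<^sup>2 \<le> 4 * (avg n f y)\<^sup>2 -
     4 * (\<Sum>i<n. avg_max i f y * (avg (Suc i) f y - avg i f y))"
proof -
  have "2 * (\<Sum>i<n. avg_max i f y * (avg (Suc i) f y - avg i f y)) \<le>
      2 * avg_max n f y * avg n f y - (avg_max n f y)\<^sup>2"
  proof (induction n)
    case 0
    show ?case by (simp add: power2_eq_square)
  next
    case (Suc n)
    \<comment> \<open>Either the maximum is unchanged, or it becomes \<open>?v\<close> and the claim is \<open>0 \<le> (?a - ?v)\<^sup>2\<close>.\<close>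
    let ?a = "avg_max n f y" and ?v = "avg (Suc n) f y"
    have "2 * ?a * ?v - ?a\<^sup>2 \<le> 2 * max ?a ?v * ?v - (max ?a ?v)\<^sup>2"
      using zero_le_power2[of "?a - ?v"] by (auto simp: max_def power2_eq_square algebra_simps)
    then show ?case using Suc by (simp add: algebra_simps)
  qed
  moreover have "0 \<le> (avg_max n f y - 2 * avg n f y)\<^sup>2" by simp
  ultimately show ?thesis by (simp add: power2_eq_square algebra_simps)
qed

lemma doob_avg_max:
  assumes f: "square_integrable M f"
  shows "(LINT y|M. (avg_max n f y)\<^sup>2) \<le> 4 * (LINT y|M. (f y)\<^sup>2)"
proof -
  note fi = integrable_of_square_integrable[OF f]
  have z: "(LINT y|M. avg_max i f y * (avg (Suc i) f y - avg i f y)) = 0"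
    and zi: "integrable M (\<lambda>y. avg_max i f y * (avg (Suc i) f y - avg i f y))" for i
  proof -
    note c = cell_const_avg_max[of i f]
    have i: "integrable M (\<lambda>y. avg_max i f y * avg k f y)" for k
      using cell_const_times_integrable[OF c cell_const_integrable[OF cell_const_avg]] by simp
    show "integrable M (\<lambda>y. avg_max i f y * (avg (Suc i) f y - avg i f y))"
      unfolding right_diff_distrib using i by simp
    show "(LINT y|M. avg_max i f y * (avg (Suc i) f y - avg i f y)) = 0"
      unfolding right_diff_distrib
      using i integral_inner_avg[OF c fi] integral_inner_avg[OF cell_const_mono[OF c, of "Suc i"] fi]
      by simp
  qed
  have s: "integrable M (\<lambda>y. (avg n f y)\<^sup>2)" "integrable M (\<lambda>y. (avg_max n f y)\<^sup>2)"
    using cell_const_square_integrable[OF cell_const_avg[of n f]]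
      cell_const_square_integrable[OF cell_const_avg_max[of n f]]
    unfolding square_integrable_def by auto
  have "(LINT y|M. (avg_max n f y)\<^sup>2) \<le> (LINT y|M. 4 * (avg n f y)\<^sup>2 -
      4 * (\<Sum>i<n. avg_max i f y * (avg (Suc i) f y - avg i f y)))"
    using s zi by (intro integral_mono avg_max_pathwise) auto
  also have "\<dots> = 4 * (LINT y|M. (avg n f y)\<^sup>2)"
    using s zi z by (simp add: Bochner_Integration.integral_sum)
  also have "\<dots> \<le> 4 * (LINT y|M. (f y)\<^sup>2)"
    using avg_energy[OF f, of n] by simp
  finally show ?thesis .
qed

end

section \<open>Weak limits of sets\<close>

text \<open>A weak limit of the indicators of the sets \<open>G n\<close>, obtained as a strong limit. Let \<open>C N\<close> be the
  set of all functions with values in the unit interval that have integral at least \<open>a\<close> and satisfy the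
  estimates up to index \<open>N\<close>. These sets are convex, decrease with \<open>N\<close>, and contain \<open>indicator (G N)\<close>.
  Almost minimal elements of the sets \<open>C N\<close> for the \<open>L\<^sup>2\<close> norm form a Cauchy sequence by the
  parallelogram law, and Fatou's lemma passes the estimates to the limit.\<close>

lemma weak_limit_of_sets:
  fixes G :: "nat \<Rightarrow> 'a set" and h :: "'i \<Rightarrow> nat \<Rightarrow> 'a \<Rightarrow> ennreal" and K :: "'i \<Rightarrow> ennreal"
  assumes "finite_measure M"
    and G: "\<And>n. G n \<in> sets M" "\<And>n. a \<le> measure M (G n)"
    and h: "\<And>i n. i \<in> I \<Longrightarrow> h i n \<in> borel_measurable M" "\<And>i n x. i \<in> I \<Longrightarrow> h i n x \<le> h i (Suc n) x"
    and K: "\<And>i n. i \<in> I \<Longrightarrow> (\<integral>\<^sup>+ x\<in>G n. h i n x \<partial>M) \<le> K i"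
  obtains q :: "'a \<Rightarrow> real" where "q \<in> borel_measurable M" "\<And>x. 0 \<le> q x" "\<And>x. q x \<le> 1"
    "a \<le> (LINT x|M. q x)"
    "\<And>i. i \<in> I \<Longrightarrow> (\<integral>\<^sup>+ x. ennreal (q x) * (SUP n. h i n x) \<partial>M) \<le> K i"
proof -
  interpret finite_measure M by fact
  define C where "C N = {u \<in> borel_measurable M. (\<forall>x. 0 \<le> u x \<and> u x \<le> (1::real)) \<and> a \<le> (LINT x|M. u x) \<and>
    (\<forall>i\<in>I. \<forall>j\<le>N. (\<integral>\<^sup>+ x. ennreal (u x) * h i j x \<partial>M) \<le> K i)}" for N
  have hmono: "h i j x \<le> h i k x" if "i \<in> I" "j \<le> k" for i j k x
    using that(2) by (induction k rule: dec_induct) (auto intro: order_trans h(2)[OF that(1)])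
  have G_C: "indicator (G N) \<in> C N" for N
  proof -
    have "(\<integral>\<^sup>+ x. ennreal (indicator (G N) x) * h i j x \<partial>M) \<le> K i" if "i \<in> I" "j \<le> N" for i j
    proof -
      have "(\<integral>\<^sup>+ x. ennreal (indicator (G N) x) * h i j x \<partial>M) \<le> (\<integral>\<^sup>+ x\<in>G N. h i N x \<partial>M)"
        using hmono[OF that] by (intro nn_integral_mono) (auto simp: indicator_def)
      also have "\<dots> \<le> K i" by (rule K[OF that(1)])
      finally show ?thesis .
    qed
    then show ?thesis using G[of N] unfolding C_def by (auto simp: indicator_def)
  qed
  have C_anti: "C N' \<subseteq> C N" if "N \<le> N'" for N N' using that unfolding C_def by auto
  have int: "integrable M u" "integrable M (\<lambda>x. (u x)\<^sup>2)" if "u \<in> C N" for u N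
  proof -
    have u: "u \<in> borel_measurable M" "0 \<le> u x" "u x \<le> 1" for x using that unfolding C_def by auto
    then have "(u x)\<^sup>2 \<le> 1" for x by (intro power_le_one)
    then show "integrable M u" "integrable M (\<lambda>x. (u x)\<^sup>2)"
      using u by (auto intro!: integrable_const_bound[of _ 1])
  qed
  \<comment> \<open>Midpoints are all of the convexity that the parallelogram law needs.\<close>
  have conv: "(\<lambda>x. (u x + v x) / 2) \<in> C N" if u: "u \<in> C N" and v: "v \<in> C N" for u v N
  proof -
    have [measurable]: "u \<in> borel_measurable M" "v \<in> borel_measurable M" using u v unfolding C_def by auto
    have "(\<integral>\<^sup>+ x. ennreal ((u x + v x) / 2) * h i j x \<partial>M) \<le> K i" if "i \<in> I" "j \<le> N" for i j
    proof -
      note [measurable] = h(1)[OF that(1)]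
      have pos: "0 \<le> u x" "0 \<le> v x" for x using u v unfolding C_def by auto
      have e: "ennreal ((u x + v x) / 2) = ennreal (1/2) * ennreal (u x) + ennreal (1/2) * ennreal (v x)" for x
      proof -
        have "(u x + v x) / 2 = 1/2 * u x + 1/2 * v x" by simp
        then have "ennreal ((u x + v x) / 2) = ennreal (1/2 * u x + 1/2 * v x)" by (rule arg_cong)
        also have "\<dots> = ennreal (1/2 * u x) + ennreal (1/2 * v x)" using pos[of x] by (intro ennreal_plus) auto
        finally show ?thesis using pos[of x] by (simp only: ennreal_mult)
      qed
      have "(\<integral>\<^sup>+ x. ennreal ((u x + v x) / 2) * h i j x \<partial>M) =
          (\<integral>\<^sup>+ x. ennreal (1/2) * (ennreal (u x) * h i j x) + ennreal (1/2) * (ennreal (v x) * h i j x) \<partial>M)"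
        unfolding e by (simp only: distrib_right mult.assoc)
      also have "\<dots> = ennreal (1/2) * (\<integral>\<^sup>+ x. ennreal (u x) * h i j x \<partial>M) +
          ennreal (1/2) * (\<integral>\<^sup>+ x. ennreal (v x) * h i j x \<partial>M)"
        by (subst nn_integral_add) (auto simp: nn_integral_cmult)
      also have "\<dots> \<le> ennreal (1/2) * K i + ennreal (1/2) * K i"
        using u v that unfolding C_def by (intro add_mono mult_left_mono) auto
      also have "\<dots> = (ennreal (1/2) + ennreal (1/2)) * K i" by (simp only: distrib_right)
      also have "ennreal (1/2) + ennreal (1/2) = ennreal 1"
        by (subst ennreal_plus[symmetric]) auto
      finally show ?thesis by simp
    qed
    moreover have "a \<le> (LINT x|M. (u x + v x) / 2)"
    proof -
      have "a \<le> (LINT x|M. u x)" "a \<le> (LINT x|M. v x)" using u v unfolding C_def by auto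
      then show ?thesis using int(1)[OF u] int(1)[OF v] by simp
    qed
    moreover have "0 \<le> (u x + v x) / 2 \<and> (u x + v x) / 2 \<le> 1" for x
    proof -
      have "0 \<le> u x" "u x \<le> 1" "0 \<le> v x" "v x \<le> 1" using u v unfolding C_def by auto
      then show ?thesis by auto
    qed
    ultimately show ?thesis unfolding C_def by auto
  qed
  define e where "e u = (LINT x|M. (u x)\<^sup>2)" for u :: "'a \<Rightarrow> real"
  have e_pos: "0 \<le> e u" for u unfolding e_def by simp
  define d where "d N = Inf (e ` C N)" for N
  have bdd: "bdd_below (e ` C N)" for N using e_pos by (auto intro!: bdd_belowI[of _ 0])
  have d_le: "d N \<le> e u" if "u \<in> C N" for u N
    unfolding d_def using that bdd by (intro cInf_lower) auto
  have d_mono: "d N \<le> d N'" if "N \<le> N'" for N N'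
    unfolding d_def using C_anti[OF that] G_C bdd by (intro cInf_superset_mono) auto
  have d_bound: "d N \<le> measure M (space M)" for N
  proof -
    have "e (indicator (G N)) = measure M (G N)"
    proof -
      have "(\<lambda>x. (indicator (G N) x :: real)\<^sup>2) = indicator (G N)" by (auto simp: indicator_def)
      then show ?thesis unfolding e_def using G(1)[of N] sets.sets_into_space[OF G(1), of N]
        by (simp add: Int_absorb2 Int_absorb1)
    qed
    then show ?thesis using d_le[OF G_C, of N] bounded_measure[of "G N"] by linarith
  qed
  have "convergent d"
    using incseq_convergent[of d "measure M (space M)"] d_mono d_bound
    unfolding incseq_def convergent_def by metis
  have "\<exists>u. u \<in> C N \<and> e u < d N + 1 / real (Suc N)" for N
  proof -
    have "\<exists>x\<in>e ` C N. x < d N + 1 / real (Suc N)"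
      using G_C[of N] unfolding d_def by (intro cInf_lessD) (auto simp: d_def)
    then show ?thesis by auto
  qed
  then obtain u where u: "\<And>N. u N \<in> C N" "\<And>N. e (u N) < d N + 1 / real (Suc N)" by metis
  have close: "(LINT x|M. (u N x - u N' x)\<^sup>2) \<le> 2 * (d N' - d N) + 4 / real (Suc N)" if "N \<le> N'" for N N'
  proof -
    have uN: "u N \<in> C N" "u N' \<in> C N" using u C_anti[OF that] by auto
    have par: "(u N x - u N' x)\<^sup>2 = 2 * (u N x)\<^sup>2 + 2 * (u N' x)\<^sup>2 - 4 * ((u N x + u N' x) / 2)\<^sup>2" for x
      by (simp add: power2_eq_square algebra_simps)
    have "(LINT x|M. (u N x - u N' x)\<^sup>2) = 2 * e (u N) + 2 * e (u N') - 4 * e (\<lambda>x. (u N x + u N' x) / 2)"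
      unfolding par e_def using int(2)[OF uN(1)] int(2)[OF uN(2)] int(2)[OF conv[OF uN]]
      by (simp del: power_divide)
    also have "\<dots> \<le> 2 * (d N + 1 / real (Suc N)) + 2 * (d N' + 1 / real (Suc N')) - 4 * d N"
    proof -
      have "2 * a + 2 * b - 4 * c \<le> 2 * (x + s) + 2 * (y + t) - 4 * x"
        if "a < x + s" "b < y + t" "x \<le> c" for a b c x y s t :: real
      proof -
        have "2 * a \<le> 2 * (x + s)" "2 * b \<le> 2 * (y + t)" "4 * x \<le> 4 * c" using that by simp_all
        then show ?thesis by (intro diff_mono add_mono)
      qed
      from this[OF u(2)[of N] u(2)[of N'] d_le[OF conv[OF uN]]] show ?thesis .
    qed
    also have "1 / real (Suc N') \<le> 1 / real (Suc N)" using that by (simp add: frac_le)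
    finally show ?thesis by simp
  qed
  have u_int: "integrable M (u N)" for N using int(1)[OF u(1)] .
  have L1: "\<exists>N. \<forall>i\<ge>N. \<forall>j\<ge>N. (LINT x|M. norm (u i x - u j x)) < \<epsilon>" if \<epsilon>: "\<epsilon> > 0" for \<epsilon>
  proof -
    define m where "m = measure M (space M)"
    have m: "m \<ge> 0" unfolding m_def by simp
    \<comment> \<open>\<open>L\<^sup>2\<close> distances bound \<open>L\<^sup>1\<close> distances through \<open>|v| \<le> \<kappa> + v\<^sup>2 / \<kappa>\<close>.\<close>
    define \<kappa> where "\<kappa> = \<epsilon> / (2 * (m + 1))"
    have \<kappa>: "\<kappa> > 0" unfolding \<kappa>_def using \<epsilon> m by simp
    have "\<kappa> * m < \<epsilon> / 2" unfolding \<kappa>_def using \<epsilon> m by (simp add: field_simps)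
    obtain N1 where N1: "\<And>i j. i \<ge> N1 \<Longrightarrow> j \<ge> N1 \<Longrightarrow> \<bar>d i - d j\<bar> < \<kappa> * \<epsilon> / 8"
      using \<open>convergent d\<close> \<epsilon> \<kappa> unfolding Cauchy_convergent_iff[symmetric] Cauchy_def dist_real_def
      by (metis mult_pos_pos zero_less_divide_iff zero_less_numeral)
    obtain N2 :: nat where N2: "4 / (\<kappa> * \<epsilon> / 4) < real N2" using reals_Archimedean2 by blast
    have key: "(LINT x|M. norm (u i x - u j x)) < \<epsilon>" if ij: "i \<ge> max N1 N2" "i \<le> j" for i j
    proof -
      have "norm (u i x - u j x) \<le> \<kappa> + (u i x - u j x)\<^sup>2 / \<kappa>" for x
      proof (cases "\<bar>u i x - u j x\<bar> \<le> \<kappa>")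
        case True then show ?thesis using \<kappa> by (simp add: add_increasing2)
      next
        case False
        then have "\<kappa> * \<bar>u i x - u j x\<bar> \<le> \<bar>u i x - u j x\<bar> * \<bar>u i x - u j x\<bar>"
          by (intro mult_right_mono) auto
        then have "\<bar>u i x - u j x\<bar> \<le> (u i x - u j x)\<^sup>2 / \<kappa>"
          using \<kappa> by (simp add: field_simps power2_eq_square)
        then show ?thesis using \<kappa> by simp
      qed
      moreover have sqi: "integrable M (\<lambda>x. (u i x - u j x)\<^sup>2)"
      proof (rule integrable_const_bound[of _ 1])
        have "u i x \<le> 1 \<and> 0 \<le> u i x \<and> u j x \<le> 1 \<and> 0 \<le> u j x" for x using u(1)[of i] u(1)[of j] unfolding C_def by auto
        then have "\<bar>u i x - u j x\<bar> \<le> 1" for x by (smt (verit))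
        then show "AE x in M. norm ((u i x - u j x)\<^sup>2) \<le> 1" by (simp add: power_le_one_iff abs_square_le_1)
        show "(\<lambda>x. (u i x - u j x)\<^sup>2) \<in> borel_measurable M" using u_int by measurable
      qed
      ultimately have "(LINT x|M. norm (u i x - u j x)) \<le> (LINT x|M. \<kappa> + (u i x - u j x)\<^sup>2 / \<kappa>)"
        using u_int by (intro integral_mono) auto
      also have "\<dots> = \<kappa> * m + (LINT x|M. (u i x - u j x)\<^sup>2) / \<kappa>"
        using sqi by (simp add: m_def mult.commute)
      also have "(LINT x|M. (u i x - u j x)\<^sup>2) < \<kappa> * \<epsilon> / 2"
      proof -
        have "real N2 \<le> real (Suc i)" using ij by simp
        then have "4 / (\<kappa> * \<epsilon> / 4) < real (Suc i)" using N2 by linarith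
        then have "4 / real (Suc i) < \<kappa> * \<epsilon> / 4"
          using \<kappa> \<epsilon> by (simp add: field_simps)
        moreover have "d j - d i < \<kappa> * \<epsilon> / 8"
        proof -
          have "N1 \<le> i" "N1 \<le> j" using ij by auto
          have "d j - d i = - (d i - d j)" by simp
          also have "\<dots> \<le> \<bar>d i - d j\<bar>" by (rule abs_ge_minus_self)
          also have "\<dots> < \<kappa> * \<epsilon> / 8" by (rule N1) fact+
          finally show ?thesis .
        qed
        moreover have "x < \<kappa> * \<epsilon> / 2" if "s < \<kappa> * \<epsilon> / 4" "y < \<kappa> * \<epsilon> / 8" "x \<le> 2 * y + s" for x y s
          using that by linarith
        ultimately show ?thesis using close[OF ij(2)] by blast
      qed
      finally show ?thesis using \<open>\<kappa> * m < \<epsilon> / 2\<close> \<kappa> by (simp add: divide_strict_right_mono field_simps)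
    qed
    have "(LINT x|M. norm (u i x - u j x)) < \<epsilon>" if "i \<ge> max N1 N2" "j \<ge> max N1 N2" for i j
      using key[of i j] key[of j i] that by (cases "i \<le> j") (auto simp: abs_minus_commute)
    then show ?thesis by blast
  qed
  obtain r where r: "strict_mono r" "AE x in M. Cauchy (\<lambda>i. u (r i) x)"
    using cauchy_L1_AE_cauchy_subseq[OF u_int L1] by blast
  define q where "q x = (if Cauchy (\<lambda>i. u (r i) x) then lim (\<lambda>i. u (r i) x) else 0)" for x
  have [measurable]: "u N \<in> borel_measurable M" for N using u_int by auto
  have u01: "0 \<le> u N x" "u N x \<le> 1" for N x using u(1)[of N] unfolding C_def by auto
  have tend: "AE x in M. (\<lambda>i. u (r i) x) \<longlonglongrightarrow> q x"
    using r(2) unfolding q_def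
    by (auto elim!: eventually_mono simp: Cauchy_convergent_iff convergent_LIMSEQ_iff)
  show thesis
  proof
    show qm [measurable]: "q \<in> borel_measurable M" unfolding q_def[abs_def] by measurable
    show q_nonneg: "0 \<le> q x" for x
      unfolding q_def using u01
      by (auto simp: Cauchy_convergent_iff convergent_LIMSEQ_iff intro!: LIMSEQ_le_const)
    show "q x \<le> 1" for x
      unfolding q_def using u01
      by (auto simp: Cauchy_convergent_iff convergent_LIMSEQ_iff intro!: LIMSEQ_le_const2)
    have "(\<lambda>i. LINT x|M. u (r i) x) \<longlonglongrightarrow> (LINT x|M. q x)"
      using tend u01 by (intro integral_dominated_convergence[where w = "\<lambda>_. 1"]) auto
    moreover have "a \<le> (LINT x|M. u (r i) x)" for i using u(1)[of "r i"] unfolding C_def by auto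
    ultimately show "a \<le> (LINT x|M. q x)" by (intro LIMSEQ_le_const) auto
    fix i assume i: "i \<in> I"
    note [measurable] = h(1)[OF i]
    have j: "(\<integral>\<^sup>+ x. ennreal (q x) * h i j x \<partial>M) \<le> K i" for j
    proof -
      have "(\<integral>\<^sup>+ x. ennreal (q x) * h i j x \<partial>M) \<le> (\<integral>\<^sup>+ x. liminf (\<lambda>k. ennreal (u (r k) x) * h i j x) \<partial>M)"
      proof (rule nn_integral_mono_AE, use tend in eventually_elim)
        case (elim x)
        show ?case
        \<comment> \<open>At a zero of \<open>q\<close> the product with an infinite value of \<open>h\<close> is not continuous, but there
          the inequality is trivial.\<close>
        proof (cases "q x = 0")
          case False
          then have q0: "\<not> q x \<le> 0" using q_nonneg[of x] by linarith
          have "(\<lambda>k. ennreal (u (r k) x) * h i j x) \<longlonglongrightarrow> ennreal (q x) * h i j x"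
            using elim False by (intro tendsto_mult_ennreal tendsto_ennrealI tendsto_const) (auto simp: ennreal_eq_0_iff q0)
          then show ?thesis by (simp add: lim_imp_Liminf[OF trivial_limit_sequentially])
        qed simp
      qed
      also have "\<dots> \<le> liminf (\<lambda>k. \<integral>\<^sup>+ x. ennreal (u (r k) x) * h i j x \<partial>M)"
        by (rule nn_integral_liminf) measurable
      also have "\<dots> \<le> K i"
      proof (rule Liminf_le)
        show "\<forall>\<^sub>F k in sequentially. (\<integral>\<^sup>+ x. ennreal (u (r k) x) * h i j x \<partial>M) \<le> K i"
          using eventually_ge_at_top[of j]
        proof eventually_elim
          case (elim k)
          have "j \<le> r k" using elim seq_suble[OF r(1), of k] by linarith
          then show ?case using u(1)[of "r k"] i unfolding C_def by auto
        qed
      qed simp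
      finally show ?thesis .
    qed
    have "(\<integral>\<^sup>+ x. ennreal (q x) * (SUP n. h i n x) \<partial>M) = (\<integral>\<^sup>+ x. (SUP n. ennreal (q x) * h i n x) \<partial>M)"
      by (simp add: SUP_mult_left_ennreal)
    also have "\<dots> = (SUP n. \<integral>\<^sup>+ x. ennreal (q x) * h i n x \<partial>M)"
      using h(2)[OF i] by (intro nn_integral_monotone_convergence_SUP) (auto simp: incseq_Suc_iff le_fun_def intro!: mult_left_mono)
    also have "\<dots> \<le> K i" using j by (intro SUP_least)
    finally show "(\<integral>\<^sup>+ x. ennreal (q x) * (SUP n. h i n x) \<partial>M) \<le> K i" .
  qed
qed

section \<open>Poisson type kernels and the bounds for the given kernel\<close>

text \<open>A kernel of Poisson type at scale \<open>t\<close>. Its integral against a measure with growth of order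
  \<open>m\<close> is bounded independently of \<open>t\<close>.\<close>

definition poisson_kernel :: "real \<Rightarrow> real \<Rightarrow> real \<Rightarrow> 'a::metric_space \<Rightarrow> 'a \<Rightarrow> real" where
  "poisson_kernel m a t y z = t powr a / (t + dist y z) powr (m + a)"

lemma poisson_kernel_nonneg: "0 \<le> poisson_kernel m a t y z"
  unfolding poisson_kernel_def by simp

lemma poisson_kernel_measurable [measurable]:
  "(\<lambda>(y, z). poisson_kernel m a t y z) \<in>
     borel_measurable (borel \<Otimes>\<^sub>M (borel :: 'a::{metric_space, second_countable_topology} measure))"
  unfolding poisson_kernel_def split_beta by measurable

lemma poisson_kernel_section_measurable [measurable]:
  "(\<lambda>z. poisson_kernel m a t y z) \<in>
     borel_measurable (borel :: 'a::{metric_space, second_countable_topology} measure)"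
  unfolding poisson_kernel_def by measurable

lemma poisson_kernel_split:
  assumes "t > 0"
  shows "poisson_kernel m (a + b) t y z = (t / (t + dist y z)) powr b * poisson_kernel m a t y z"
proof -
  have "t + dist y z > 0" using assms by (simp add: add_pos_nonneg)
  then show ?thesis using assms
    unfolding poisson_kernel_def by (simp add: powr_add powr_divide field_simps)
qed

text \<open>The space is cut into the annuli where \<open>t + dist y z\<close> is about \<open>2^i t\<close>. Such an annulus lies in
  a ball of radius \<open>2^(i+1) t\<close>, which costs the factor \<open>2^m\<close>, and contributes \<open>2^(-a i)\<close>.\<close>

lemma nn_integral_poisson_kernel_le:
  fixes \<nu> :: "'a::{metric_space, second_countable_topology} measure"
  assumes s [measurable_cong]: "sets \<nu> = sets borel"
    and growth: "\<And>r. r > 0 \<Longrightarrow> emeasure \<nu> (cball y r) \<le> ennreal (A * r powr m)"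
    and "A \<ge> 0" "m \<ge> 0" "a > 0" "t > 0"
  shows "(\<integral>\<^sup>+ z. ennreal (poisson_kernel m a t y z) \<partial>\<nu>) \<le> ennreal (A * 2 powr m / (1 - 2 powr (- a)))"
proof -
  define q where "q = 2 powr (- a)"
  have q: "0 < q" "q < 1" using \<open>a > 0\<close> powr_less_mono[of "-a" 0 2] by (auto simp: q_def)
  define c where "c i = t powr a / (2 ^ i * t) powr (m + a)" for i :: nat
  have le: "ennreal (poisson_kernel m a t y z) \<le>
      (\<Sum>i. ennreal (c i) * indicator (cball y (2 ^ Suc i * t)) z)" for z
  proof -
    define u where "u = (t + dist y z) / t"
    have u: "u \<ge> 1" using \<open>t > 0\<close> by (simp add: u_def)
    define i where "i = nat \<lfloor>log 2 u\<rfloor>"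
    have "log 2 u \<ge> 0" using u by simp
    then have "real i \<le> log 2 u" "log 2 u < real i + 1" unfolding i_def by linarith+
    then have "2 powr real i \<le> u" "u < 2 powr (real i + 1)"
      using u by (simp_all add: le_log_iff log_less_iff)
    then have i: "2 ^ i * t \<le> t + dist y z" "t + dist y z < 2 ^ Suc i * t"
      using \<open>t > 0\<close> by (auto simp: u_def powr_realpow powr_add field_simps)
    have "poisson_kernel m a t y z \<le> c i"
    proof -
      have "0 < 2 ^ i * t" "0 < t + dist y z" using \<open>t > 0\<close> by (auto simp: add_pos_nonneg)
      then show ?thesis
        unfolding poisson_kernel_def c_def using assms(4,5) i(1)
        by (intro divide_left_mono powr_mono2 mult_pos_pos) auto
    qed
    then have "ennreal (poisson_kernel m a t y z) \<le>
        ennreal (c i) * indicator (cball y (2 ^ Suc i * t)) z"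
      using i(2) \<open>t > 0\<close> by (auto simp: indicator_def intro!: ennreal_leI)
    also have "\<dots> = (\<Sum>i\<in>{i}. ennreal (c i) * indicator (cball y (2 ^ Suc i * t)) z)"
      by (simp only: sum.insert sum.empty finite.emptyI empty_iff not_False_eq_True add_0_right)
    also have "\<dots> \<le> (\<Sum>i. ennreal (c i) * indicator (cball y (2 ^ Suc i * t)) z)"
      by (intro sum_le_suminf) auto
    finally show ?thesis .
  qed
  have "(\<integral>\<^sup>+ z. ennreal (poisson_kernel m a t y z) \<partial>\<nu>) \<le>
      (\<integral>\<^sup>+ z. (\<Sum>i. ennreal (c i) * indicator (cball y (2 ^ Suc i * t)) z) \<partial>\<nu>)"
    by (intro nn_integral_mono le)
  also have "\<dots> = (\<Sum>i. ennreal (c i) * emeasure \<nu> (cball y (2 ^ Suc i * t)))"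
    by (subst nn_integral_suminf) (measurable, auto simp: s intro!: suminf_cong nn_integral_cmult_indicator)
  also have "\<dots> \<le> (\<Sum>i. ennreal (A * 2 powr m * q ^ i))"
  proof (rule suminf_le)
    fix i :: nat
    have "ennreal (c i) * emeasure \<nu> (cball y (2 ^ Suc i * t)) \<le>
        ennreal (c i) * ennreal (A * (2 ^ Suc i * t) powr m)"
      using growth[of "2 ^ Suc i * t"] \<open>t > 0\<close> by (intro mult_left_mono) auto
    also have "\<dots> = ennreal (c i * (A * (2 ^ Suc i * t) powr m))"
      using \<open>A \<ge> 0\<close> by (subst ennreal_mult) (auto simp: c_def)
    also have "c i * (A * (2 ^ Suc i * t) powr m) = A * 2 powr m * q ^ i"
    proof -
      have "q ^ i = 2 powr (- a * real i)"
        unfolding q_def by (simp add: powr_realpow[symmetric] powr_powr)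
      moreover have "(2::real) ^ i = 2 powr real i" by (simp add: powr_realpow)
      ultimately show ?thesis using \<open>t > 0\<close> unfolding c_def
        by (simp add: powr_mult powr_powr powr_add powr_minus field_simps)
    qed
    finally show "ennreal (c i) * emeasure \<nu> (cball y (2 ^ Suc i * t)) \<le> ennreal (A * 2 powr m * q ^ i)" .
  qed auto
  also have "\<dots> = ennreal (A * 2 powr m * (1 / (1 - q)))"
    using q \<open>A \<ge> 0\<close> by (intro suminf_ennreal_eq sums_mult geometric_sums) auto
  finally show ?thesis by (simp add: q_def)
qed

lemma schur_test:
  fixes w :: "'a \<Rightarrow> 'a \<Rightarrow> real"
  assumes "sigma_finite_measure \<mu>"
    and w [measurable]: "(\<lambda>(y, z). w y z) \<in> borel_measurable (\<mu> \<Otimes>\<^sub>M \<mu>)"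
    and w0: "\<And>y z. 0 \<le> w y z"
    and F [measurable]: "F \<in> sets \<mu>"
    and A: "\<And>y. y \<in> F \<Longrightarrow> (\<integral>\<^sup>+ z. ennreal (w y z) \<partial>\<mu>) \<le> A"
    and B: "\<And>z. (\<integral>\<^sup>+ y\<in>F. ennreal (w y z) \<partial>\<mu>) \<le> B"
    and g [measurable]: "g \<in> borel_measurable \<mu>"
  shows "(\<integral>\<^sup>+ y\<in>F. (\<integral>\<^sup>+ z. ennreal (w y z) * g z \<partial>\<mu>)\<^sup>2 \<partial>\<mu>) \<le> A * B * (\<integral>\<^sup>+ z. (g z)\<^sup>2 \<partial>\<mu>)"
proof -
  interpret sigma_finite_measure \<mu> by fact
  interpret pair_sigma_finite \<mu> \<mu> ..
  have cs: "(\<integral>\<^sup>+ z. ennreal (w y z) * g z \<partial>\<mu>)\<^sup>2 \<le> A * (\<integral>\<^sup>+ z. ennreal (w y z) * (g z)\<^sup>2 \<partial>\<mu>)"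
    if "y \<in> F" for y
  proof -
    have y: "y \<in> space \<mu>" using that sets.sets_into_space[OF F] by auto
    have [measurable]: "(\<lambda>z. w y z) \<in> borel_measurable \<mu>"
      using measurable_compose_Pair1[OF y w] by simp
    have sq: "ennreal (sqrt (w y z)) * ennreal (sqrt (w y z)) = ennreal (w y z)" for z
      using w0 by (simp flip: ennreal_mult)
    have "(\<integral>\<^sup>+ z. ennreal (w y z) * g z \<partial>\<mu>)\<^sup>2 =
        (\<integral>\<^sup>+ z. ennreal (sqrt (w y z)) * (ennreal (sqrt (w y z)) * g z) \<partial>\<mu>)\<^sup>2"
      by (simp only: mult.assoc[symmetric] sq)
    also have "\<dots> \<le> (\<integral>\<^sup>+ z. (ennreal (sqrt (w y z)))\<^sup>2 \<partial>\<mu>) * (\<integral>\<^sup>+ z. (ennreal (sqrt (w y z)) * g z)\<^sup>2 \<partial>\<mu>)"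
      by (intro Cauchy_Schwarz_nn_integral) measurable
    also have "\<dots> = (\<integral>\<^sup>+ z. ennreal (w y z) \<partial>\<mu>) * (\<integral>\<^sup>+ z. ennreal (w y z) * (g z)\<^sup>2 \<partial>\<mu>)"
      by (simp only: power_mult_distrib) (simp only: power2_eq_square sq)
    also have "\<dots> \<le> A * (\<integral>\<^sup>+ z. ennreal (w y z) * (g z)\<^sup>2 \<partial>\<mu>)"
      by (intro mult_right_mono A that) auto
    finally show ?thesis .
  qed
  have "(\<integral>\<^sup>+ y\<in>F. (\<integral>\<^sup>+ z. ennreal (w y z) * g z \<partial>\<mu>)\<^sup>2 \<partial>\<mu>) \<le>
      (\<integral>\<^sup>+ y. A * (\<integral>\<^sup>+ z. ennreal (w y z) * (g z)\<^sup>2 * indicator F y \<partial>\<mu>) \<partial>\<mu>)"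
    using cs by (intro nn_integral_mono) (auto simp: indicator_def)
  also have "\<dots> = A * (\<integral>\<^sup>+ y. \<integral>\<^sup>+ z. ennreal (w y z) * (g z)\<^sup>2 * indicator F y \<partial>\<mu> \<partial>\<mu>)"
    by (intro nn_integral_cmult) measurable
  also have "(\<integral>\<^sup>+ y. \<integral>\<^sup>+ z. ennreal (w y z) * (g z)\<^sup>2 * indicator F y \<partial>\<mu> \<partial>\<mu>) =
      (\<integral>\<^sup>+ z. \<integral>\<^sup>+ y. ennreal (w y z) * (g z)\<^sup>2 * indicator F y \<partial>\<mu> \<partial>\<mu>)"
    by (rule Fubini'[symmetric]) measurable
  also have "\<dots> \<le> (\<integral>\<^sup>+ z. B * (g z)\<^sup>2 \<partial>\<mu>)"
  proof (rule nn_integral_mono)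
    fix z assume z: "z \<in> space \<mu>"
    have [measurable]: "(\<lambda>y. w y z) \<in> borel_measurable \<mu>"
      using measurable_compose[OF measurable_Pair2'[OF z] w] by simp
    have "(\<integral>\<^sup>+ y. ennreal (w y z) * (g z)\<^sup>2 * indicator F y \<partial>\<mu>) =
        (\<integral>\<^sup>+ y\<in>F. ennreal (w y z) \<partial>\<mu>) * (g z)\<^sup>2"
      by (subst nn_integral_multc[symmetric]) (auto simp: mult_ac)
    also have "\<dots> \<le> B * (g z)\<^sup>2" by (intro mult_right_mono B) auto
    finally show "(\<integral>\<^sup>+ y. ennreal (w y z) * (g z)\<^sup>2 * indicator F y \<partial>\<mu>) \<le> B * (g z)\<^sup>2" .
  qed
  also have "(\<integral>\<^sup>+ z. B * (g z)\<^sup>2 \<partial>\<mu>) = B * (\<integral>\<^sup>+ z. (g z)\<^sup>2 \<partial>\<mu>)"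
    by (intro nn_integral_cmult) measurable
  finally show ?thesis by (simp add: mult.assoc mult_left_mono)
qed

lemma cone_dist_le:
  assumes "x \<in> cone E y" "z \<in> E"
  shows "infdist x E \<le> dist x z" "dist y z \<le> 3 * dist x z"
proof -
  show i: "infdist x E \<le> dist x z" using assms(2) by (rule infdist_le)
  have "dist y z \<le> dist x y + dist x z" by (metis dist_triangle3 dist_commute)
  then show "dist y z \<le> 3 * dist x z"
    using assms(1) i unfolding cone_def by (simp add: dist_norm)
qed

text \<open>A point of the cone over \<open>y\<close> at height about \<open>t\<close> sees \<open>z\<close> from a distance of at least
  \<open>(t + dist y z) / 4\<close>.\<close>

lemma cone_kernel_factor_le:
  assumes "x \<in> cone E y" "z \<in> E" "t > 0" "t \<le> infdist x E" "infdist x E \<le> 1000 * t"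
    and "m > 0" "\<alpha> > 0"
  shows "infdist x E powr \<alpha> / dist x z powr (m + \<alpha>) \<le>
      1000 powr \<alpha> * 4 powr (m + \<alpha>) * poisson_kernel m \<alpha> t y z"
proof -
  note c = cone_dist_le[OF assms(1,2)]
  have p: "dist x z > 0" using c(1) assms by linarith
  have l: "t + dist y z \<le> 4 * dist x z" using c assms by linarith
  have "infdist x E powr \<alpha> / dist x z powr (m + \<alpha>) \<le> (1000 * t) powr \<alpha> / dist x z powr (m + \<alpha>)"
    using assms p by (intro divide_right_mono powr_mono2) (auto simp: infdist_nonneg)
  also have "\<dots> = 1000 powr \<alpha> * 4 powr (m + \<alpha>) * (t powr \<alpha> / (4 * dist x z) powr (m + \<alpha>))"
    using p \<open>t > 0\<close> by (simp add: powr_mult)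
  also have "\<dots> \<le> 1000 powr \<alpha> * 4 powr (m + \<alpha>) * poisson_kernel m \<alpha> t y z"
  proof -
    have "0 < t + dist y z" "0 < 4 * dist x z" using \<open>t > 0\<close> p by (auto simp: add_pos_nonneg)
    then show ?thesis
      unfolding poisson_kernel_def using l assms(6,7)
      by (intro mult_left_mono divide_left_mono powr_mono2 mult_pos_pos) auto
  qed
  finally show ?thesis .
qed

lemma kernel_size_bound:
  assumes S: "square_function_kernel E m \<alpha> \<beta> K1 K2 S"
    and "x \<in> cone E y" "z \<in> E" "t > 0" "t \<le> infdist x E" "infdist x E \<le> 1000 * t"
    and "m > 0" "\<alpha> > 0" "K1 > 0"
  shows "cmod (S x z) * infdist x E powr \<alpha> \<le>
      K1 * 1000 powr \<alpha> * 4 powr (m + \<alpha>) * poisson_kernel m \<alpha> t y z"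
proof -
  have "cmod (S x z) \<le> K1 / dist x z powr (m + \<alpha>)"
    using S assms(2,3) unfolding square_function_kernel_def cone_def dist_norm by auto
  then have "cmod (S x z) * infdist x E powr \<alpha> \<le> K1 / dist x z powr (m + \<alpha>) * infdist x E powr \<alpha>"
    by (intro mult_right_mono) auto
  also have "\<dots> = K1 * (infdist x E powr \<alpha> / dist x z powr (m + \<alpha>))" by simp
  also have "\<dots> \<le> K1 * (1000 powr \<alpha> * 4 powr (m + \<alpha>) * poisson_kernel m \<alpha> t y z)"
    using assms by (intro mult_left_mono cone_kernel_factor_le) auto
  finally show ?thesis by (simp add: mult_ac)
qed

text \<open>The constants are adapted to cubes of side \<open>u\<close>, whose diameter is at most \<open>16 u\<close>: when \<open>u\<close> is
  at most \<open>t / 1000\<close>, two points of such a cube are close enough for the smoothness condition.\<close>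

lemma kernel_smoothness_bound:
  assumes S: "square_function_kernel E m \<alpha> \<beta> K1 K2 S"
    and "x \<in> cone E y" "z \<in> E" "z' \<in> E" "t > 0" "t \<le> infdist x E" "infdist x E \<le> 1000 * t"
    and "m > 0" "\<alpha> > 0" "\<beta> > 0" "K2 > 0" and u: "dist z z' \<le> 16 * u" "1000 * u \<le> t"
  shows "cmod (S x z - S x z') * infdist x E powr \<alpha> \<le>
      K2 * 16 powr \<beta> * 1000 powr \<alpha> * 4 powr (m + \<alpha>) * (u / t) powr \<beta> * poisson_kernel m \<alpha> t y z"
proof -
  note c = cone_dist_le[OF assms(2,3)]
  have d: "t \<le> dist x z" and p: "dist x z > 0" using c(1) assms by linarith+
  have u0: "u \<ge> 0" using u(1) zero_le_dist[of z z'] by linarith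
  have "dist z z' \<le> dist x z / 2" using u d \<open>t > 0\<close> by linarith
  then have "cmod (S x z - S x z') \<le> K2 * dist z z' powr \<beta> / dist x z powr (m + \<alpha> + \<beta>)"
    using S assms(2-4) unfolding square_function_kernel_def cone_def dist_norm by auto
  also have "\<dots> \<le> K2 * (16 * u) powr \<beta> / (t powr \<beta> * dist x z powr (m + \<alpha>))"
    using assms p d
    by (intro frac_le mult_left_mono powr_mono2)
      (auto simp: powr_add mult.commute intro!: mult_mono powr_mono2)
  also have "\<dots> = K2 * 16 powr \<beta> * (u / t) powr \<beta> * (1 / dist x z powr (m + \<alpha>))"
    using u0 \<open>t > 0\<close> by (simp add: powr_mult powr_divide)
  finally have "cmod (S x z - S x z') * infdist x E powr \<alpha> \<le>
      K2 * 16 powr \<beta> * (u / t) powr \<beta> * (1 / dist x z powr (m + \<alpha>)) * infdist x E powr \<alpha>"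
    by (intro mult_right_mono) auto
  also have "\<dots> = K2 * 16 powr \<beta> * (u / t) powr \<beta> * (infdist x E powr \<alpha> / dist x z powr (m + \<alpha>))" by simp
  also have "\<dots> \<le> K2 * 16 powr \<beta> * (u / t) powr \<beta> *
      (1000 powr \<alpha> * 4 powr (m + \<alpha>) * poisson_kernel m \<alpha> t y z)"
    using assms by (intro mult_left_mono cone_kernel_factor_le) auto
  finally show ?thesis by (simp add: mult_ac)
qed

section \<open>The square function on slabs of the cones\<close>

text \<open>The growth condition at points outside \<open>H\<close> holds for balls of all radii, since a ball that
  violates it would be contained in \<open>H\<close> together with its center.\<close>

locale kernel_measure =
  fixes E :: "(real^'n) set" and m \<alpha> \<beta> K1 K2 C0 rB :: real and S :: "real^'n \<Rightarrow> real^'n \<Rightarrow> complex"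
    and y0 :: "real^'n" and \<mu> :: "(real^'n) measure" and H :: "(real^'n) set"
  assumes closed_E: "closed E" and y0: "y0 \<in> E" and rB: "rB > 0"
    and kernel: "square_function_kernel E m \<alpha> \<beta> K1 K2 S"
    and m: "m > 0" and \<alpha>: "\<alpha> > 0" and \<beta>: "\<beta> > 0" and K1: "K1 > 0" and K2: "K2 > 0" and C0: "C0 > 0"
    and finite_\<mu>: "finite_measure \<mu>" and sets_\<mu>: "sets \<mu> = sets borel"
    and AE_ball: "AE z in \<mu>. z \<in> cball_in E y0 rB"
    and H: "H \<in> sets borel"
    and growth: "\<And>y r. y \<in> E - H \<Longrightarrow> r > 0 \<Longrightarrow> measure \<mu> (cball y r) \<le> C0 * r powr m"
begin

abbreviation "B \<equiv> cball_in E y0 rB"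
abbreviation "\<sigma> \<equiv> sigma_measure E"
abbreviation "T \<equiv> T_op E S \<mu>"

abbreviation (input) energy :: "(real^'n \<Rightarrow> complex) \<Rightarrow> ennreal" where
  "energy f \<equiv> \<integral>\<^sup>+ z. (ennreal (cmod (f z)))\<^sup>2 \<partial>\<mu>"

text \<open>The square of the conical square function, restricted to the points of the cone whose distance
  to \<open>E\<close> lies in \<open>I\<close>. Squares are additive in \<open>I\<close>, and no square root is taken before the end.\<close>

definition sq :: "real set \<Rightarrow> (real^'n \<Rightarrow> complex) \<Rightarrow> real^'n \<Rightarrow> ennreal" where
  "sq I f y = (\<integral>\<^sup>+ x. (ennreal (cmod (T f x) * infdist x E powr \<alpha>))\<^sup>2 *
     indicator {x \<in> cone E y. infdist x E \<in> I} x \<partial>\<sigma>)"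

sublocale finite_measure \<mu> by (rule finite_\<mu>)

lemma sets_\<mu>' [measurable_cong]: "sets \<mu> = sets borel" by (rule sets_\<mu>)

lemma space_\<mu>: "space \<mu> = UNIV"
  using sets_eq_imp_space_eq[OF sets_\<mu>] by simp

lemma borel_E [measurable]: "E \<in> sets borel" using closed_E by simp

lemma lebesgue_E [measurable]: "E \<in> sets lebesgue" using borel_E by (simp add: sets_completionI_sets)

lemma B_borel [measurable]: "B \<in> sets borel"
  unfolding cball_in_def by measurable

lemma H_borel [measurable]: "H \<in> sets borel" by (rule H)

lemma B_subset: "B \<subseteq> E" unfolding cball_in_def by auto

lemma infdist_pos: "x \<in> - E \<Longrightarrow> infdist x E > 0"
  using closed_E y0 by (metis ComplD empty_iff in_closed_iff_infdist_zero infdist_nonneg less_eq_real_def)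

lemma cone_infdist_pos: "x \<in> cone E y \<Longrightarrow> infdist x E > 0"
  using infdist_pos unfolding cone_def by auto

lemma sets_\<sigma> [measurable_cong]: "sets \<sigma> = sets (restrict_space lebesgue (- E))"
  unfolding sigma_measure_def by simp

lemma space_\<sigma>: "space \<sigma> = - E"
  unfolding sigma_measure_def by (simp add: space_restrict_space)

lemma measurable_\<sigma>_lebesgue [measurable]: "(\<lambda>x. x) \<in> \<sigma> \<rightarrow>\<^sub>M lebesgue"
proof -
  have "(\<lambda>x. x) \<in> restrict_space lebesgue (- E) \<rightarrow>\<^sub>M lebesgue"
    by (rule measurable_restrict_space1) simp
  then show ?thesis using measurable_cong_sets[OF sets_\<sigma> refl] by blast
qed

lemma measurable_\<sigma>_borel [measurable]: "(\<lambda>x. x) \<in> \<sigma> \<rightarrow>\<^sub>M borel"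
proof -
  have "(\<lambda>x. x) \<in> lebesgue \<rightarrow>\<^sub>M (borel :: (real^'n) measure)" by (rule measurable_completion) simp
  from measurable_compose[OF measurable_\<sigma>_lebesgue this] show ?thesis .
qed

lemma infdist_borel [measurable]: "(\<lambda>x. infdist x E) \<in> borel_measurable borel"
  by (intro borel_measurable_continuous_onI continuous_intros)

lemma infdist_\<sigma> [measurable]: "(\<lambda>x. infdist x E) \<in> borel_measurable \<sigma>"
  using measurable_compose[OF measurable_\<sigma>_borel infdist_borel] .

text \<open>The density of \<open>\<sigma>\<close> is at most \<open>t\<close> to the power \<open>-n\<close> on the set, and the ball has volume
  proportional to \<open>R^n\<close>.\<close>

lemma emeasure_\<sigma>_le:
  assumes t: "t > 0" and A: "A \<subseteq> - E" "A \<in> sets lebesgue" "A \<subseteq> cball y R"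
    and d: "\<And>x. x \<in> A \<Longrightarrow> t \<le> infdist x E" and "R \<ge> 0"
  shows "emeasure \<sigma> A \<le> ennreal (unit_ball_vol (real CARD('n)) * (R / t) ^ CARD('n))"
proof -
  have A': "A \<in> sets (restrict_space lebesgue (- E))"
    using A lebesgue_E by (subst sets_restrict_space_iff) auto
  have "emeasure \<sigma> A = (\<integral>\<^sup>+ x. ennreal (infdist x E powr - real CARD('n)) * indicator A x
      \<partial>restrict_space lebesgue (- E))"
    unfolding sigma_measure_def
    by (rule emeasure_density)
      (use A' measurable_cong_sets[OF sets_\<sigma> refl] in measurable)
  also have "\<dots> \<le> (\<integral>\<^sup>+ x. ennreal (t powr - real CARD('n)) * indicator A x
      \<partial>restrict_space lebesgue (- E))"
    using d t by (intro nn_integral_mono) (auto simp: indicator_def intro!: ennreal_leI powr_mono2')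
  also have "\<dots> = ennreal (t powr - real CARD('n)) * emeasure (restrict_space lebesgue (- E)) A"
    using A' by (rule nn_integral_cmult_indicator)
  also have "emeasure (restrict_space lebesgue (- E)) A = emeasure lebesgue A"
    using A lebesgue_E by (intro emeasure_restrict_space) auto
  also have "emeasure lebesgue A \<le> emeasure lebesgue (cball y R)"
    using A by (intro emeasure_mono) auto
  also have "emeasure lebesgue (cball y R) = ennreal (unit_ball_vol (real CARD('n)) * R ^ CARD('n))"
    using emeasure_cball[OF \<open>R \<ge> 0\<close>, of y] by (simp add: emeasure_completion)
  finally have "emeasure \<sigma> A \<le> ennreal (t powr - real CARD('n)) *
      ennreal (unit_ball_vol (real CARD('n)) * R ^ CARD('n))"
    by (simp add: mult_left_mono)
  also have "\<dots> = ennreal (unit_ball_vol (real CARD('n)) * (R / t) ^ CARD('n))"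
    using t \<open>R \<ge> 0\<close>
    by (simp flip: ennreal_mult add: powr_minus powr_realpow power_divide field_simps)
  finally show ?thesis .
qed

lemma sigma_finite_\<sigma>: "sigma_finite_measure \<sigma>"
proof
  define A where "A k = {x \<in> - E. 1 / real (Suc k) \<le> infdist x E} \<inter> cball 0 (real k)" for k :: nat
  have bor: "A k \<in> sets borel" for k
  proof -
    have "A k = {x \<in> space borel. 1 / real (Suc k) \<le> infdist x E} \<inter> - E \<inter> cball 0 (real k)"
      unfolding A_def by auto
    also have "\<dots> \<in> sets borel" by measurable
    finally show ?thesis .
  qed
  have s: "A k \<in> sets \<sigma>" for k
  proof -
    have "A k \<subseteq> - E" unfolding A_def by auto
    moreover have "A k \<in> sets lebesgue" using bor[of k] by (simp add: sets_completionI_sets)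
    ultimately show ?thesis
      unfolding sets_\<sigma> using lebesgue_E by (subst sets_restrict_space_iff) simp_all
  qed
  show "\<exists>F. countable F \<and> F \<subseteq> sets \<sigma> \<and> \<Union>F = space \<sigma> \<and> (\<forall>a\<in>F. emeasure \<sigma> a \<noteq> \<infinity>)"
  proof (intro exI conjI ballI)
    show "countable (range A)" by simp
    show "range A \<subseteq> sets \<sigma>" using s by auto
    show "\<Union>(range A) = space \<sigma>"
    proof
      show "\<Union>(range A) \<subseteq> space \<sigma>" unfolding A_def space_\<sigma> by auto
      show "space \<sigma> \<subseteq> \<Union>(range A)"
      proof
        fix x assume "x \<in> space \<sigma>"
        then have x: "x \<in> - E" by (simp add: space_\<sigma>)
        obtain k1 :: nat where k1: "1 / real (Suc k1) < infdist x E"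
          using reals_Archimedean[OF infdist_pos[OF x]] by (auto simp: inverse_eq_divide)
        obtain k2 :: nat where k2: "norm x \<le> real k2" using real_arch_simple by blast
        have "1 / real (Suc (max k1 k2)) \<le> 1 / real (Suc k1)" by (intro divide_left_mono) auto
        then have "x \<in> A (max k1 k2)" using x k1 k2 unfolding A_def by auto
        then show "x \<in> \<Union>(range A)" by blast
      qed
    qed
    fix a assume "a \<in> range A"
    then obtain k where a: "a = A k" by auto
    have "emeasure \<sigma> (A k) \<le> ennreal (unit_ball_vol (real CARD('n)) * (real k / (1 / real (Suc k))) ^ CARD('n))"
      using bor[of k] by (intro emeasure_\<sigma>_le[where y = 0]) (auto simp: A_def sets_completionI_sets)
    also have "\<dots> < \<infinity>" by simp
    finally show "emeasure \<sigma> a \<noteq> \<infinity>" unfolding a by simp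
  qed
qed

sublocale \<sigma>: sigma_finite_measure \<sigma> by (rule sigma_finite_\<sigma>)

text \<open>A bound for the \<open>\<sigma>\<close>-measure of the part of a cone at heights between \<open>t\<close> and \<open>1000 t\<close>; this
  part lies in a ball of radius \<open>2000 t\<close>.\<close>

definition cone_mass :: real where "cone_mass = unit_ball_vol (real CARD('n)) * 2000 ^ CARD('n)"

lemma cone_mass_nonneg: "cone_mass \<ge> 0" unfolding cone_mass_def by simp

lemma emeasure_\<sigma>_slab:
  assumes "t > 0"
  shows "emeasure \<sigma> {x \<in> cone E y. infdist x E \<in> {t..<1000*t}} \<le> ennreal cone_mass"
proof -
  let ?A = "{x \<in> cone E y. infdist x E \<in> {t..<1000*t}}"
  have "?A = {x \<in> space borel. norm (x - y) < 2 * infdist x E \<and> infdist x E \<in> {t..<1000*t}} \<inter> - E"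
    unfolding cone_def by auto
  also have "\<dots> \<in> sets borel" by measurable
  finally have "?A \<in> sets lebesgue" by (rule sets_completionI_sets[of _ lborel, simplified])
  then have "emeasure \<sigma> ?A \<le> ennreal (unit_ball_vol (real CARD('n)) * ((2000 * t) / t) ^ CARD('n))"
    using assms by (intro emeasure_\<sigma>_le[where y = y]) (auto simp: cone_def dist_norm norm_minus_commute)
  then show ?thesis using assms by (simp add: cone_mass_def)
qed

lemma kernel_measurable:
  "(\<lambda>(x, z). indicator E z *\<^sub>R S x z) \<in> borel_measurable (\<sigma> \<Otimes>\<^sub>M \<mu>)"
proof -
  have S: "(\<lambda>p. indicator ((- E) \<times> E) p *\<^sub>R S (fst p) (snd p)) \<in>
      borel_measurable (lebesgue \<Otimes>\<^sub>M (borel :: (real^'n) measure))"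
    using kernel unfolding square_function_kernel_def
    by (subst (asm) borel_measurable_restrict_space_iff) (auto simp: split_beta)
  have id: "(\<lambda>p. (fst p, snd p)) \<in> \<sigma> \<Otimes>\<^sub>M \<mu> \<rightarrow>\<^sub>M lebesgue \<Otimes>\<^sub>M (borel :: (real^'n) measure)"
    by (intro measurable_Pair measurable_compose[OF measurable_fst measurable_\<sigma>_lebesgue]
      measurable_compose[OF measurable_snd]) (simp add: measurable_ident_sets[OF sets_\<mu>])
  have "(\<lambda>p. indicator ((- E) \<times> E) p *\<^sub>R S (fst p) (snd p)) \<in> borel_measurable (\<sigma> \<Otimes>\<^sub>M \<mu>)"
    using measurable_compose[OF id S] by simp
  then show ?thesis
    by (rule measurable_cong[THEN iffD1, rotated])
      (auto simp: space_pair_measure space_\<sigma> indicator_def)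
qed

lemma kernel_section_measurable:
  assumes "x \<in> - E"
  shows "(\<lambda>z. indicator E z *\<^sub>R S x z) \<in> borel_measurable \<mu>"
  using measurable_compose_Pair1[OF _ kernel_measurable, of x] assms space_\<sigma> by simp

lemma T_eq: "T f x = (LINT z|\<mu>. indicator E z *\<^sub>R S x z * f z)"
  unfolding T_op_def set_lebesgue_integral_def by simp

lemma T_measurable:
  assumes [measurable]: "f \<in> borel_measurable \<mu>"
  shows "T f \<in> borel_measurable \<sigma>"
proof -
  note kernel_measurable[measurable]
  have "(\<lambda>x. LINT z|\<mu>. indicator E z *\<^sub>R S x z * f z) \<in> borel_measurable \<sigma>"
    by (intro borel_measurable_lebesgue_integral) (simp only: split_beta', intro borel_measurable_times,
      (use kernel_measurable in \<open>simp add: split_beta'\<close>), measurable)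
  then show ?thesis using T_eq[of f] by presburger
qed

lemma cone_measurable:
  assumes [measurable]: "I \<in> sets borel"
  shows "Measurable.pred (borel \<Otimes>\<^sub>M \<sigma>) (\<lambda>(y, x). x \<in> cone E y \<and> infdist x E \<in> I)"
proof -
  have "Measurable.pred (borel \<Otimes>\<^sub>M \<sigma>) (\<lambda>(y, x). norm (x - y) < 2 * infdist x E \<and> infdist x E \<in> I)"
    unfolding split_beta
    using measurable_compose[OF measurable_snd measurable_\<sigma>_borel] by measurable
  then show ?thesis
    by (rule measurable_cong[THEN iffD1, rotated])
      (auto simp: space_pair_measure space_\<sigma> cone_def)
qed

lemma slice_sets [measurable]:
  assumes "I \<in> sets borel"
  shows "{x \<in> cone E y. infdist x E \<in> I} \<in> sets \<sigma>"
proof -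
  have "Measurable.pred \<sigma> (\<lambda>x. x \<in> cone E y \<and> infdist x E \<in> I)"
    using measurable_compose_Pair1[OF _ cone_measurable[OF assms], of y] by simp
  then have "{x \<in> space \<sigma>. x \<in> cone E y \<and> infdist x E \<in> I} \<in> sets \<sigma>" by measurable
  then show ?thesis by (simp add: space_\<sigma> cone_def cong: conj_cong)
qed

lemma sq_measurable [measurable]:
  assumes [measurable]: "f \<in> borel_measurable \<mu>" "I \<in> sets borel"
  shows "sq I f \<in> borel_measurable \<mu>"
proof -
  note [measurable] = T_measurable[OF assms(1)] cone_measurable[OF assms(2)]
  have 1: "Measurable.pred (\<mu> \<Otimes>\<^sub>M \<sigma>) (\<lambda>p. snd p \<in> cone E (fst p) \<and> infdist (snd p) E \<in> I)"
    using cone_measurable[OF assms(2)] by (simp add: split_beta)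
  have "(\<lambda>y. \<integral>\<^sup>+ x. (ennreal (cmod (T f x) * infdist x E powr \<alpha>))\<^sup>2 *
     indicator {x \<in> cone E y. infdist x E \<in> I} x \<partial>\<sigma>) \<in> borel_measurable \<mu>"
    unfolding indicator_def using 1
    by (intro \<sigma>.borel_measurable_nn_integral) (simp add: split_beta)
  then show ?thesis unfolding sq_def[abs_def] .
qed

lemma C_op_eq: "C_op E \<alpha> S \<mu> f y = ennsqrt (sq UNIV f y)"
proof -
  have "ennreal ((cmod (T f x))\<^sup>2 * infdist x E powr (2 * \<alpha>)) =
      (ennreal (cmod (T f x) * infdist x E powr \<alpha>))\<^sup>2" for x
    by (simp add: ennreal_power power_mult_distrib power2_eq_square[of "_ powr _"] powr_add[symmetric])
  then show ?thesis unfolding C_op_def sq_def by (simp only: UNIV_I simp_thms Collect_mem_eq)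
qed

lemma sq_mono_set: "I \<subseteq> I' \<Longrightarrow> sq I f y \<le> sq I' f y"
  unfolding sq_def by (intro nn_integral_mono mult_left_mono) (auto simp: indicator_def)

lemma sq_Un:
  assumes [measurable]: "f \<in> borel_measurable \<mu>" "I \<in> sets borel" "I' \<in> sets borel" and "I \<inter> I' = {}"
  shows "sq (I \<union> I') f y = sq I f y + sq I' f y"
proof -
  note [measurable] = T_measurable[OF assms(1)] slice_sets
  show ?thesis unfolding sq_def
    using assms(4)
    by (subst nn_integral_add[symmetric])
      (measurable, auto simp: indicator_def intro!: nn_integral_cong)
qed

lemma sq_UN:
  fixes I :: "nat \<Rightarrow> real set"
  assumes [measurable]: "f \<in> borel_measurable \<mu>" "\<And>i. I i \<in> sets borel" and d: "disjoint_family I"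
  shows "sq (\<Union>i. I i) f y = (\<Sum>i. sq (I i) f y)"
proof -
  note [measurable] = T_measurable[OF assms(1)] slice_sets
  have "(\<Sum>i. sq (I i) f y) = (\<integral>\<^sup>+ x. (\<Sum>i. (ennreal (cmod (T f x) * infdist x E powr \<alpha>))\<^sup>2 *
     indicator {x \<in> cone E y. infdist x E \<in> I i} x) \<partial>\<sigma>)"
    unfolding sq_def by (rule nn_integral_suminf[symmetric]) measurable
  also have "\<dots> = (\<integral>\<^sup>+ x. (ennreal (cmod (T f x) * infdist x E powr \<alpha>))\<^sup>2 *
     (\<Sum>i. indicator {x \<in> cone E y. infdist x E \<in> I i} x) \<partial>\<sigma>)"
    by simp
  also have "\<dots> = sq (\<Union>i. I i) f y"
  proof -
    have "disjoint_family (\<lambda>i. {x \<in> cone E y. infdist x E \<in> I i})"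
      using d unfolding disjoint_family_on_def by auto
    then have "(\<Sum>i. indicator {x \<in> cone E y. infdist x E \<in> I i} x) =
        (indicator (\<Union>i. {x \<in> cone E y. infdist x E \<in> I i}) x :: ennreal)" for x
      by (rule suminf_indicator)
    moreover have "(\<Union>i. {x \<in> cone E y. infdist x E \<in> I i}) = {x \<in> cone E y. infdist x E \<in> (\<Union>i. I i)}"
      by auto
    ultimately show ?thesis unfolding sq_def by simp
  qed
  finally show ?thesis by simp
qed

text \<open>Pointwise domination on a slab of the cone becomes domination of square functions. All
  estimates for the operator are used in this form.\<close>

lemma sq_slab_comparison:
  assumes t: "t > 0" and b: "b \<in> borel_measurable \<mu>"
    and le: "\<And>x. x \<in> cone E y \<Longrightarrow> t \<le> infdist x E \<Longrightarrow> infdist x E < 1000 * t \<Longrightarrow>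
      ennreal (cmod (T f x) * infdist x E powr \<alpha>) \<le>
        p * ennreal (cmod (T b x) * infdist x E powr \<alpha>) + q"
  shows "sq {t..<1000*t} f y \<le> 2 * p\<^sup>2 * sq {t..<1000*t} b y + 2 * q\<^sup>2 * ennreal cone_mass"
proof -
  note [measurable] = T_measurable[OF b] slice_sets
  let ?A = "{x \<in> cone E y. infdist x E \<in> {t..<1000*t}}"
  let ?u = "\<lambda>f x. ennreal (cmod (T f x) * infdist x E powr \<alpha>)"
  have A [measurable]: "?A \<in> sets \<sigma>" by (rule slice_sets) simp
  have "sq {t..<1000*t} f y \<le> (\<integral>\<^sup>+ x. (2 * p\<^sup>2) * ((?u b x)\<^sup>2 * indicator ?A x) +
      (2 * q\<^sup>2) * indicator ?A x \<partial>\<sigma>)"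
    unfolding sq_def
  proof (rule nn_integral_mono)
    fix x
    have "(?u f x)\<^sup>2 \<le> 2 * p\<^sup>2 * (?u b x)\<^sup>2 + 2 * q\<^sup>2" if "x \<in> ?A"
    proof -
      have "(?u f x)\<^sup>2 \<le> (p * ?u b x + q)\<^sup>2" using that le[of x] by (intro power_mono) auto
      also have "\<dots> \<le> 2 * (p * ?u b x)\<^sup>2 + 2 * q\<^sup>2" by (rule power2_add_le_ennreal)
      finally show ?thesis by (simp only: power_mult_distrib mult.assoc)
    qed
    then show "(?u f x)\<^sup>2 * indicator ?A x \<le>
        (2 * p\<^sup>2) * ((?u b x)\<^sup>2 * indicator ?A x) + (2 * q\<^sup>2) * indicator ?A x"
      by (cases "x \<in> ?A") auto
  qed
  also have "\<dots> = 2 * p\<^sup>2 * sq {t..<1000*t} b y + 2 * q\<^sup>2 * emeasure \<sigma> ?A"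
  proof -
    have 1: "(\<lambda>x. (?u b x)\<^sup>2 * indicator ?A x) \<in> borel_measurable \<sigma>" by measurable
    have 2: "(\<lambda>x. indicator ?A x :: ennreal) \<in> borel_measurable \<sigma>" by measurable
    have 3: "(\<lambda>x. 2 * p\<^sup>2 * ((?u b x)\<^sup>2 * indicator ?A x)) \<in> borel_measurable \<sigma>"
      using 1 by (rule borel_measurable_times_ennreal[OF borel_measurable_const])
    have 4: "(\<lambda>x. 2 * q\<^sup>2 * indicator ?A x) \<in> borel_measurable \<sigma>"
      using 2 by (rule borel_measurable_times_ennreal[OF borel_measurable_const])
    show ?thesis
      unfolding sq_def nn_integral_add[OF 3 4] nn_integral_cmult[OF 1]
        nn_integral_cmult_indicator[OF A] ..
  qed
  also have "\<dots> \<le> 2 * p\<^sup>2 * sq {t..<1000*t} b y + 2 * q\<^sup>2 * ennreal cone_mass"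
    by (intro add_left_mono mult_left_mono emeasure_\<sigma>_slab t) auto
  finally show ?thesis .
qed

lemma kernel_times_integrable:
  assumes x: "x \<in> - E" and g: "integrable \<mu> g"
  shows "integrable \<mu> (\<lambda>z. indicator E z *\<^sub>R S x z * g z)"
proof (rule Bochner_Integration.integrable_bound)
  let ?C = "K1 / infdist x E powr (m + \<alpha>)"
  show "integrable \<mu> (\<lambda>z. ?C * norm (g z))" using g by simp
  show "(\<lambda>z. indicator E z *\<^sub>R S x z * g z) \<in> borel_measurable \<mu>"
    using kernel_section_measurable[OF x] g by (intro borel_measurable_times) auto
  have "cmod (indicator E z *\<^sub>R S x z * g z) \<le> ?C * norm (g z)" for z
  proof (cases "z \<in> E")
    case True
    have "cmod (S x z) \<le> K1 / dist x z powr (m + \<alpha>)"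
      using kernel x True unfolding square_function_kernel_def dist_norm by auto
    also have "\<dots> \<le> ?C"
      using infdist_pos[OF x] infdist_le[OF True, of x] K1 m \<alpha>
      by (intro divide_left_mono powr_mono2 mult_pos_pos) auto
    finally have "cmod (S x z) * cmod (g z) \<le> ?C * cmod (g z)" by (rule mult_right_mono) simp
    then show ?thesis using True by (simp add: norm_mult)
  next
    case False
    then show ?thesis using K1 by simp
  qed
  then show "AE z in \<mu>. norm (indicator E z *\<^sub>R S x z * g z) \<le> norm (?C * norm (g z))"
    by (intro AE_I2) (metis abs_ge_self order_trans real_norm_def)
qed

lemma T_diff:
  "x \<in> - E \<Longrightarrow> integrable \<mu> f \<Longrightarrow> integrable \<mu> g \<Longrightarrow> T (\<lambda>z. f z - g z) x = T f x - T g x"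
  unfolding T_eq by (simp only: right_diff_distrib) (intro Bochner_Integration.integral_diff kernel_times_integrable)

lemma T_sum:
  "x \<in> - E \<Longrightarrow> (\<And>j. j \<in> J \<Longrightarrow> integrable \<mu> (f j)) \<Longrightarrow> T (\<lambda>z. \<Sum>j\<in>J. f j z) x = (\<Sum>j\<in>J. T (f j) x)"
  unfolding T_eq by (simp only: sum_distrib_left) (intro Bochner_Integration.integral_sum kernel_times_integrable)

lemma T_const: "T (\<lambda>z. c) x = c * T (\<lambda>z. 1) x"
  unfolding T_eq by (simp only: integral_mult_left_zero mult_1_right) (rule mult.commute)

lemma T_cong_AE:
  assumes "x \<in> - E" "integrable \<mu> f" "integrable \<mu> g" "AE z in \<mu>. f z = g z"
  shows "T f x = T g x"
  unfolding T_eq using assms(4) kernel_times_integrable[OF assms(1,2)] kernel_times_integrable[OF assms(1,3)]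
  by (intro integral_cong_AE) auto

text \<open>The complement of \<open>E\<close> is null, so that bounds on \<open>E\<close> suffice.\<close>

lemma T_norm_le:
  assumes x: "x \<in> - E" and g: "integrable \<mu> g"
    and k: "AE z in \<mu>. z \<in> E \<longrightarrow> cmod (S x z * g z) * d \<le> u z * cmod (g z)" and "d \<ge> 0"
  shows "ennreal (cmod (T g x) * d) \<le> (\<integral>\<^sup>+ z. ennreal (u z * cmod (g z)) \<partial>\<mu>)"
proof -
  have "ennreal (cmod (T g x) * d) = ennreal (cmod (T g x)) * ennreal d"
    using \<open>d \<ge> 0\<close> by (simp add: ennreal_mult)
  also have "\<dots> \<le> (\<integral>\<^sup>+ z. ennreal (cmod (indicator E z *\<^sub>R S x z * g z)) \<partial>\<mu>) * ennreal d"
    unfolding T_eq by (intro mult_right_mono integral_norm_bound_ennreal kernel_times_integrable x g) auto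
  also have "\<dots> = (\<integral>\<^sup>+ z. ennreal (cmod (indicator E z *\<^sub>R S x z * g z) * d) \<partial>\<mu>)"
  proof -
    have "(\<lambda>z. indicator E z *\<^sub>R S x z * g z) \<in> borel_measurable \<mu>"
      using kernel_section_measurable[OF x] g by (intro borel_measurable_times) auto
    then have "(\<lambda>z. ennreal (cmod (indicator E z *\<^sub>R S x z * g z))) \<in> borel_measurable \<mu>"
      by measurable
    then show ?thesis
      using \<open>d \<ge> 0\<close> by (simp only: nn_integral_multc[symmetric] ennreal_mult norm_ge_zero)
  qed
  also have "\<dots> \<le> (\<integral>\<^sup>+ z. ennreal (u z * cmod (g z)) \<partial>\<mu>)"
    using k AE_ball
    by (intro nn_integral_mono_AE) (elim AE_mp, intro AE_I2, auto simp: cball_in_def intro!: ennreal_leI)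
  finally show ?thesis .
qed

section \<open>Large heights and exhaustion by slabs\<close>

text \<open>A bound without any cancellation. It serves for the heights above the size of the ball, and it shows that
  truncated square functions have finite energy, so that they can be absorbed.\<close>

lemma sq_slab_crude:
  assumes t: "t > 0" and f: "integrable \<mu> f"
  shows "sq {t..<1000*t} f y \<le>
    ennreal (2 * cone_mass * (K1 * t powr - m)\<^sup>2) * (\<integral>\<^sup>+ z. ennreal (cmod (f z)) \<partial>\<mu>)\<^sup>2"
proof -
  let ?q = "ennreal (K1 * t powr - m) * (\<integral>\<^sup>+ z. ennreal (cmod (f z)) \<partial>\<mu>)"
  have "sq {t..<1000*t} f y \<le> 2 * 0\<^sup>2 * sq {t..<1000*t} (\<lambda>_. 0) y + 2 * ?q\<^sup>2 * ennreal cone_mass"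
  proof (rule sq_slab_comparison[OF t])
    fix x assume x: "x \<in> cone E y" "t \<le> infdist x E" "infdist x E < 1000 * t"
    let ?d = "infdist x E powr \<alpha>"
    have xE: "x \<in> - E" and d: "infdist x E > 0" using x(1) cone_infdist_pos unfolding cone_def by auto
    have "ennreal (cmod (T f x) * ?d) \<le> (\<integral>\<^sup>+ z. ennreal ((K1 * t powr - m) * cmod (f z)) \<partial>\<mu>)"
    proof (rule T_norm_le[OF xE f], intro AE_I2 impI)
      fix z assume z: "z \<in> E"
      have dz: "infdist x E \<le> dist x z" using z by (rule infdist_le)
      have "cmod (S x z) \<le> K1 / dist x z powr (m + \<alpha>)"
        using kernel xE z unfolding square_function_kernel_def dist_norm by auto
      also have "\<dots> \<le> K1 / infdist x E powr (m + \<alpha>)"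
        using dz d K1 m \<alpha> by (intro divide_left_mono powr_mono2 mult_pos_pos) auto
      finally have "cmod (S x z) * ?d \<le> K1 / infdist x E powr (m + \<alpha>) * ?d" by (rule mult_right_mono) simp
      also have "\<dots> = K1 * infdist x E powr - m"
        using d by (simp add: powr_add powr_minus field_simps)
      also have "\<dots> \<le> K1 * t powr - m"
        using K1 m t x(2) by (intro mult_left_mono powr_mono2') auto
      finally have "cmod (S x z) * ?d * cmod (f z) \<le> (K1 * t powr - m) * cmod (f z)" by (rule mult_right_mono) simp
      then show "cmod (S x z * f z) * ?d \<le> (K1 * t powr - m) * cmod (f z)" by (simp add: norm_mult mult_ac)
    qed simp
    also have "\<dots> = ?q"
      using K1 f by (simp add: ennreal_mult nn_integral_cmult)
    finally show "ennreal (cmod (T f x) * ?d) \<le> 0 * ennreal (cmod (T (\<lambda>_. 0) x) * ?d) + ?q" by simp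
  qed simp
  also have "\<dots> = ennreal (2 * cone_mass * (K1 * t powr - m)\<^sup>2) * (\<integral>\<^sup>+ z. ennreal (cmod (f z)) \<partial>\<mu>)\<^sup>2"
    using K1 cone_mass_nonneg by (simp add: ennreal_mult power_mult_distrib ennreal_power[symmetric] mult_ac)
  finally show ?thesis .
qed

lemma geometric_slabs:
  fixes t :: real
  assumes "t > 0"
  shows "(\<Union>k. {1000 ^ k * t..<1000 * (1000 ^ k * t)}) = {t..}"
    and "disjoint_family (\<lambda>k. {1000 ^ k * t..<1000 * (1000 ^ k * t)})"
proof -
  have e: "1000 * (1000 ^ k * t) = 1000 ^ Suc k * t" for k by simp
  have mono: "1000 ^ j * t \<le> 1000 ^ k * t" if "j \<le> k" for j k
    using assms that by (intro mult_right_mono power_increasing) auto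
  show "(\<Union>k. {1000 ^ k * t..<1000 * (1000 ^ k * t)}) = {t..}"
  proof
    show "(\<Union>k. {1000 ^ k * t..<1000 * (1000 ^ k * t)}) \<subseteq> {t..}" using mono[of 0] by (auto intro: order_trans[rotated])
    show "{t..} \<subseteq> (\<Union>k. {1000 ^ k * t..<1000 * (1000 ^ k * t)})"
    proof
      fix u assume u: "u \<in> {t..}"
      obtain n where "u / t < 1000 ^ n" using real_arch_pow[of 1000] by auto
      then have n: "u < 1000 ^ n * t" using assms by (simp add: field_simps)
      define j where "j = (LEAST n. u < 1000 ^ n * t)"
      have j: "u < 1000 ^ j * t" unfolding j_def using n by (rule LeastI)
      then obtain k where k: "j = Suc k" using u by (cases j) auto
      have "\<not> u < 1000 ^ k * t" using not_less_Least[of k "\<lambda>n. u < 1000 ^ n * t"] k unfolding j_def by auto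
      then show "u \<in> (\<Union>k. {1000 ^ k * t..<1000 * (1000 ^ k * t)})" using j k by (auto simp: not_less)
    qed
  qed
  show "disjoint_family (\<lambda>k. {1000 ^ k * t..<1000 * (1000 ^ k * t)})"
    unfolding disjoint_family_on_def
  proof (intro ballI impI)
    fix j k :: nat assume "j \<noteq> k"
    then consider "Suc j \<le> k" | "Suc k \<le> j" by linarith
    then show "{1000 ^ j * t..<1000 * (1000 ^ j * t)} \<inter> {1000 ^ k * t..<1000 * (1000 ^ k * t)} = {}"
      unfolding e by cases (use mono in fastforce)+
  qed
qed

lemma sq_large_scales:
  assumes t: "t > 0" and f: "integrable \<mu> f"
  shows "sq {t..} f y \<le>
    ennreal (2 * cone_mass * (K1 * t powr - m)\<^sup>2 / (1 - 1000 powr (- 2 * m))) * (\<integral>\<^sup>+ z. ennreal (cmod (f z)) \<partial>\<mu>)\<^sup>2"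
proof -
  let ?I = "(\<integral>\<^sup>+ z. ennreal (cmod (f z)) \<partial>\<mu>)\<^sup>2"
  define q where "q = 1000 powr (- 2 * m)"
  have q: "0 < q" "q < 1" unfolding q_def using m powr_less_mono[of "- 2 * m" 0 1000] by auto
  have "sq {t..} f y = (\<Sum>k. sq {1000 ^ k * t..<1000 * (1000 ^ k * t)} f y)"
    unfolding geometric_slabs(1)[OF t, symmetric]
    using f by (intro sq_UN geometric_slabs(2)[OF t]) auto
  also have "\<dots> \<le> (\<Sum>k. ennreal (2 * cone_mass * (K1 * t powr - m)\<^sup>2 * q ^ k) * ?I)"
  proof (rule suminf_le)
    fix k
    have "(K1 * (1000 ^ k * t) powr - m)\<^sup>2 = (K1 * t powr - m)\<^sup>2 * ((1000 ^ k) powr - m)\<^sup>2"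
      using t by (simp add: powr_mult power_mult_distrib)
    also have "((1000 ^ k) powr - m)\<^sup>2 = q ^ k"
      unfolding q_def by (simp add: powr_realpow[symmetric] powr_powr powr_power mult_ac)
    finally have e: "2 * cone_mass * (K1 * (1000 ^ k * t) powr - m)\<^sup>2 = 2 * cone_mass * (K1 * t powr - m)\<^sup>2 * q ^ k"
      by (simp only: mult.assoc)
    have "1000 ^ k * t > 0" using t by simp
    from sq_slab_crude[OF this f, of y]
    show "sq {1000 ^ k * t..<1000 * (1000 ^ k * t)} f y \<le> ennreal (2 * cone_mass * (K1 * t powr - m)\<^sup>2 * q ^ k) * ?I"
      unfolding e .
  qed auto
  also have "\<dots> = (\<Sum>k. ennreal (2 * cone_mass * (K1 * t powr - m)\<^sup>2 * q ^ k)) * ?I" by simp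
  also have "(\<Sum>k. ennreal (2 * cone_mass * (K1 * t powr - m)\<^sup>2 * q ^ k)) = ennreal (2 * cone_mass * (K1 * t powr - m)\<^sup>2 * (1 / (1 - q)))"
    using q cone_mass_nonneg by (intro suminf_ennreal_eq sums_mult geometric_sums) auto
  finally show ?thesis unfolding q_def by simp
qed

lemma L1_le_L2:
  assumes "f \<in> borel_measurable \<mu>"
  shows "(\<integral>\<^sup>+ z. ennreal (cmod (f z)) \<partial>\<mu>)\<^sup>2 \<le> emeasure \<mu> B * energy f"
proof -
  have [measurable]: "f \<in> borel_measurable \<mu>" by fact
  have Bm [measurable]: "B \<in> sets \<mu>" by measurable
  have "(\<integral>\<^sup>+ z. ennreal (cmod (f z)) \<partial>\<mu>)\<^sup>2 = (\<integral>\<^sup>+ z. indicator B z * ennreal (cmod (f z)) \<partial>\<mu>)\<^sup>2"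
    using AE_ball by (intro arg_cong[where f = "\<lambda>x. x\<^sup>2"] nn_integral_cong_AE) (auto elim!: eventually_mono)
  also have "\<dots> \<le> (\<integral>\<^sup>+ z. (indicator B z)\<^sup>2 \<partial>\<mu>) * energy f"
    by (intro Cauchy_Schwarz_nn_integral) measurable
  also have "(\<integral>\<^sup>+ z. (indicator B z)\<^sup>2 \<partial>\<mu>) = (\<integral>\<^sup>+ z. indicator B z \<partial>\<mu>)"
    by (intro nn_integral_cong) (simp add: indicator_def)
  also have "\<dots> = emeasure \<mu> B" by simp
  finally show ?thesis .
qed

definition K_large :: real where "K_large = 2 * cone_mass * K1\<^sup>2 * C0\<^sup>2 / (1 - 1000 powr (- 2 * m))"

lemma K_large_nonneg: "K_large \<ge> 0"
  unfolding K_large_def using cone_mass_nonneg m powr_mono[of "- 2 * m" 0 1000] by (intro divide_nonneg_nonneg) auto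

text \<open>The crude bound decays like \<open>t\<close> to the power \<open>-2m\<close> and costs two factors \<open>\<mu>(B)\<close>, one from
  the passage from \<open>L\<^sup>1\<close> to \<open>L\<^sup>2\<close> and one from the integration over \<open>B\<close>. If some point of \<open>B\<close> lies
  outside \<open>H\<close>, then \<open>\<mu>(B)\<close> is at most a multiple of \<open>t^m\<close> by growth at that point.\<close>

lemma large_scales_energy:
  assumes t: "t > 0" "2 * rB \<le> t" and f: "f \<in> borel_measurable \<mu>" "integrable \<mu> f"
  shows "(\<integral>\<^sup>+ y\<in>B - H. sq {t..} f y \<partial>\<mu>) \<le> ennreal K_large * energy f"
proof (cases "B - H = {}")
  case True then show ?thesis unfolding True by simp
next
  case False
  let ?I = "energy f"
  define D where "D = 1 - 1000 powr (- 2 * m)"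
  have D: "D > 0" unfolding D_def using m powr_less_mono[of "- 2 * m" 0 1000] by simp
  have Bm [measurable]: "B \<in> sets \<mu>" by measurable
  obtain y where y: "y \<in> B - H" using False by blast
  have "B \<subseteq> cball y t"
    using y t(2) dist_triangle3[of y _ y0] unfolding cball_in_def by (auto simp: dist_commute) (smt (verit))
  then have "measure \<mu> B \<le> measure \<mu> (cball y t)" by (intro finite_measure_mono) (auto simp: sets_\<mu>)
  also have "\<dots> \<le> C0 * t powr m" using y t B_subset by (intro growth) auto
  finally have B: "measure \<mu> B \<le> C0 * t powr m" .
  define e where "e = measure \<mu> B"
  have e: "emeasure \<mu> B = ennreal e" "e \<ge> 0" unfolding e_def by (auto simp: emeasure_eq_measure)
  define c where "c = 2 * cone_mass * (K1 * t powr - m)\<^sup>2 / D"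
  have c: "c \<ge> 0" unfolding c_def using cone_mass_nonneg D by simp
  have "(\<integral>\<^sup>+ y\<in>B - H. sq {t..} f y \<partial>\<mu>) \<le> (\<integral>\<^sup>+ y. ennreal c * (ennreal e * ?I) * indicator B y \<partial>\<mu>)"
  proof (rule nn_integral_mono)
    fix y
    have "sq {t..} f y \<le> ennreal c * (\<integral>\<^sup>+ z. ennreal (cmod (f z)) \<partial>\<mu>)\<^sup>2"
      unfolding c_def D_def by (rule sq_large_scales[OF t(1) f(2)])
    also have "\<dots> \<le> ennreal c * (ennreal e * ?I)"
      using L1_le_L2[OF f(1)] e(1) by (intro mult_left_mono) auto
    finally show "sq {t..} f y * indicator (B - H) y \<le> ennreal c * (ennreal e * ?I) * indicator B y"
      by (auto simp: indicator_def)
  qed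
  also have "\<dots> = ennreal c * (ennreal e * ?I) * ennreal e"
    using e(1) by (subst nn_integral_cmult_indicator) auto
  also have "\<dots> = ennreal (c * (e * e)) * ?I"
    using c e(2) by (simp add: ennreal_mult mult_ac)
  also have "c * (e * e) \<le> K_large"
  proof -
    have "e * e \<le> (C0 * t powr m) * (C0 * t powr m)" using B e(2) C0 unfolding e_def by (intro mult_mono) auto
    then have "c * (e * e) \<le> c * ((C0 * t powr m) * (C0 * t powr m))"
      using c by (intro mult_left_mono) auto
    also have "\<dots> = 2 * cone_mass * K1\<^sup>2 * C0\<^sup>2 / D * (t powr - m * t powr m)\<^sup>2"
      unfolding c_def by (simp add: power2_eq_square)
    also have "t powr - m * t powr m = 1" using t by (simp add: powr_add[symmetric])
    finally show ?thesis unfolding K_large_def D_def by simp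
  qed
  finally show ?thesis by (simp add: mult_right_mono ennreal_leI)
qed

lemma sq_SUP:
  assumes f: "f \<in> borel_measurable \<mu>" and t: "t > 0"
  shows "sq UNIV f y = (SUP n. sq {t / 1000 ^ n..} f y)" and "sq {t / 1000 ^ n..} f y \<le> sq {t / 1000 ^ Suc n..} f y"
proof -
  note [measurable] = T_measurable[OF f] slice_sets
  have le: "t / 1000 ^ Suc n \<le> t / 1000 ^ n" for n using t by (simp add: field_simps)
  then show "sq {t / 1000 ^ n..} f y \<le> sq {t / 1000 ^ Suc n..} f y" by (intro sq_mono_set) auto
  let ?u = "\<lambda>n x. (ennreal (cmod (T f x) * infdist x E powr \<alpha>))\<^sup>2 *
      indicator {x \<in> cone E y. infdist x E \<in> {t / 1000 ^ n..}} x"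
  have sup: "(SUP n. ?u n x) = (ennreal (cmod (T f x) * infdist x E powr \<alpha>))\<^sup>2 *
      indicator {x \<in> cone E y. infdist x E \<in> UNIV} x" for x
  proof (cases "x \<in> cone E y")
    case True
    let ?a = "(ennreal (cmod (T f x) * infdist x E powr \<alpha>))\<^sup>2"
    have d: "infdist x E > 0" using cone_infdist_pos[OF True] .
    obtain n where "t / infdist x E < 1000 ^ n" using real_arch_pow[of 1000] by auto
    then have n: "t / 1000 ^ n \<le> infdist x E" using d by (simp add: field_simps)
    show ?thesis
    proof (rule antisym)
      show "(SUP n. ?u n x) \<le> ?a * indicator {x \<in> cone E y. infdist x E \<in> UNIV} x"
        using True by (intro SUP_least) (auto simp: indicator_def)
      have "?a * indicator {x \<in> cone E y. infdist x E \<in> UNIV} x = ?u n x" using True n by simp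
      also have "\<dots> \<le> (SUP n. ?u n x)" by (rule SUP_upper) simp
      finally show "?a * indicator {x \<in> cone E y. infdist x E \<in> UNIV} x \<le> (SUP n. ?u n x)" .
    qed
  qed simp
  have "(SUP n. sq {t / 1000 ^ n..} f y) = (\<integral>\<^sup>+ x. (SUP n. ?u n x) \<partial>\<sigma>)"
    unfolding sq_def
  proof (rule nn_integral_monotone_convergence_SUP[symmetric])
    show "incseq ?u"
      using le by (intro incseq_SucI) (auto simp: le_fun_def indicator_def intro: order_trans)
    show "?u n \<in> borel_measurable \<sigma>" for n by measurable
  qed
  then show "sq UNIV f y = (SUP n. sq {t / 1000 ^ n..} f y)" unfolding sup sq_def by simp
qed

lemma sum_slabs:
  assumes f: "f \<in> borel_measurable \<mu>" and t: "t > 0"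
  shows "(\<Sum>i=1..n. sq {t / 1000 ^ i..<1000 * (t / 1000 ^ i)} f y) = sq {t / 1000 ^ n..<t} f y"
proof (induction n)
  case 0
  show ?case by (simp add: sq_def)
next
  case (Suc n)
  have e: "1000 * (t / 1000 ^ Suc n) = t / 1000 ^ n" by simp
  have le: "t / 1000 ^ Suc n \<le> t / 1000 ^ n" "t / 1000 ^ n \<le> t"
    using t by (auto simp: field_simps intro: one_le_power)
  have "sq {t / 1000 ^ Suc n..<t} f y = sq ({t / 1000 ^ n..<t} \<union> {t / 1000 ^ Suc n..<t / 1000 ^ n}) f y"
    using le by (intro arg_cong[where f = "\<lambda>I. sq I f y"]) auto
  also have "\<dots> = sq {t / 1000 ^ n..<t} f y + sq {t / 1000 ^ Suc n..<t / 1000 ^ n} f y"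
    using f by (intro sq_Un) auto
  finally have 1: "sq {t / 1000 ^ Suc n..<t} f y =
      sq {t / 1000 ^ n..<t} f y + sq {t / 1000 ^ Suc n..<t / 1000 ^ n} f y" .
  have "(\<Sum>i=1..Suc n. sq {t / 1000 ^ i..<1000 * (t / 1000 ^ i)} f y) =
      (\<Sum>i=1..n. sq {t / 1000 ^ i..<1000 * (t / 1000 ^ i)} f y) +
      sq {t / 1000 ^ Suc n..<1000 * (t / 1000 ^ Suc n)} f y"
    by (rule sum.cl_ivl_Suc[THEN trans]) simp
  then show ?case unfolding Suc e 1 .
qed

section \<open>Comparison with averages over one lattice\<close>

text \<open>The exponent of decay \<open>\<alpha>\<close> of the kernel is split into halves: one half keeps the kernel
  integrable, and the other half pays for being far from the boundary of a large cube.\<close>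

abbreviation (input) "poisson \<equiv> poisson_kernel m (\<alpha> / 2)"

definition poisson_mass :: real where "poisson_mass = C0 * 2 powr m / (1 - 2 powr (- (\<alpha> / 2)))"

lemma poisson_mass_nonneg: "poisson_mass \<ge> 0"
  unfolding poisson_mass_def using C0 \<alpha> powr_mono[of "- (\<alpha> / 2)" 0 2] by simp

lemma poisson_integral_le:
  assumes "y \<in> E - H" "t > 0"
  shows "(\<integral>\<^sup>+ z. ennreal (poisson t y z) \<partial>\<mu>) \<le> ennreal poisson_mass"
  unfolding poisson_mass_def using assms m \<alpha> C0 growth[OF assms(1)]
  by (intro nn_integral_poisson_kernel_le sets_\<mu>)
    (auto simp: emeasure_eq_measure intro!: ennreal_leI)

text \<open>Here \<open>z\<close> may lie in \<open>H\<close>, where there is no growth condition. But any ball around \<open>z\<close> that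
  meets the set of integration lies in the ball of twice the radius around a point of that set.\<close>

lemma poisson_integral_adjoint_le:
  assumes "t > 0"
  shows "(\<integral>\<^sup>+ y\<in>B - H. ennreal (poisson t y z) \<partial>\<mu>) \<le> ennreal (poisson_mass * 2 powr m)"
proof -
  let ?\<nu> = "density \<mu> (indicator (B - H))"
  have BH: "B - H \<in> sets \<mu>" by measurable
  have ind: "(indicator (B - H) :: _ \<Rightarrow> ennreal) \<in> borel_measurable \<mu>" using BH by measurable
  have "(\<integral>\<^sup>+ y\<in>B - H. ennreal (poisson t y z) \<partial>\<mu>) = (\<integral>\<^sup>+ y. ennreal (poisson t z y) \<partial>?\<nu>)"
    using BH ind by (subst nn_integral_density)
      (auto simp: sets_\<mu> poisson_kernel_def dist_commute mult.commute cong: measurable_cong_sets)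
  also have "\<dots> \<le> ennreal ((C0 * 2 powr m) * 2 powr m / (1 - 2 powr (- (\<alpha> / 2))))"
  proof (intro nn_integral_poisson_kernel_le)
    fix r :: real assume r: "r > 0"
    have e: "emeasure ?\<nu> (cball z r) = emeasure \<mu> ((B - H) \<inter> cball z r)"
    proof -
      have "emeasure ?\<nu> (cball z r) = (\<integral>\<^sup>+ y. indicator (B - H) y * indicator (cball z r) y \<partial>\<mu>)"
        using BH ind by (intro emeasure_density) (auto simp: sets_\<mu>)
      also have "\<dots> = (\<integral>\<^sup>+ y. indicator ((B - H) \<inter> cball z r) y \<partial>\<mu>)"
        by (simp only: indicator_inter_arith)
      also have "\<dots> = emeasure \<mu> ((B - H) \<inter> cball z r)"
        using BH by (intro nn_integral_indicator) (auto simp: sets_\<mu>)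
      finally show ?thesis .
    qed
    show "emeasure ?\<nu> (cball z r) \<le> ennreal (C0 * 2 powr m * r powr m)"
    proof (cases "(B - H) \<inter> cball z r = {}")
      case True then show ?thesis unfolding e by simp
    next
      case False
      then obtain y' where "y' \<in> (B - H) \<inter> cball z r" by blast
      then have y': "y' \<in> B - H" "dist z y' \<le> r" by auto
      have "(B - H) \<inter> cball z r \<subseteq> cball y' (2 * r)"
        using y'(2) by (auto simp: dist_commute) (smt (verit) dist_triangle3 dist_commute)
      then have "emeasure \<mu> ((B - H) \<inter> cball z r) \<le> emeasure \<mu> (cball y' (2 * r))"
        by (intro emeasure_mono) (auto simp: sets_\<mu>)
      also have "\<dots> \<le> ennreal (C0 * (2 * r) powr m)"
        using growth[of y' "2 * r"] y' r B_subset by (auto simp: emeasure_eq_measure intro!: ennreal_leI)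
      finally show ?thesis unfolding e using r by (simp add: powr_mult mult.assoc)
    qed
  qed (use m \<alpha> C0 assms in \<open>auto simp: sets_\<mu>\<close>)
  finally show ?thesis by (simp add: poisson_mass_def mult_ac)
qed

definition K_size :: real where "K_size = K1 * 1000 powr \<alpha> * 4 powr (m + \<alpha>)"
definition K_smooth :: real where "K_smooth = K2 * 16 powr \<beta> * 1000 powr \<alpha> * 4 powr (m + \<alpha>)"

lemma K_size_pos: "K_size > 0" and K_smooth_pos: "K_smooth > 0"
  unfolding K_size_def K_smooth_def using K1 K2 by auto

lemma poisson_split: "t > 0 \<Longrightarrow>
  poisson_kernel m \<alpha> t y z = (t / (t + dist y z)) powr (\<alpha> / 2) * poisson t y z"
  using poisson_kernel_split[of t m "\<alpha> / 2" "\<alpha> / 2"] by simp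

lemma poisson_split_le: "t > 0 \<Longrightarrow> poisson_kernel m \<alpha> t y z \<le> poisson t y z"
  unfolding poisson_split using \<alpha> poisson_kernel_nonneg[of m "\<alpha> / 2" t y z]
  by (intro mult_left_le_one_le powr_le1) (auto simp: field_simps add_pos_nonneg)

end

text \<open>The cells of generation \<open>j\<close> are cubes of side \<open>t0 / 1000^j\<close>. The number \<open>\<theta>\<close> is a common rate for
  the geometric gains from smoothness (\<open>\<theta>_fine\<close>) and from decay (\<open>\<theta>_coarse\<close>). The number \<open>r\<close> says how
  many generations apart a cube must be before the distance to its boundary matters.\<close>

locale lattice_kernel = kernel_measure E m \<alpha> \<beta> K1 K2 C0 rB S y0 \<mu> H + nested_partitions \<mu> P
  for E :: "(real^'n) set" and m \<alpha> \<beta> K1 K2 C0 rB S y0 \<mu> H P +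
  fixes t0 \<theta> \<gamma> :: real and r :: nat
  assumes t0: "t0 > 0" and \<theta>: "0 < \<theta>" "\<theta> < 1" and \<gamma>: "\<gamma> < 1"
    and \<theta>_fine: "(1 / 1000) powr \<beta> \<le> \<theta>"
    and \<theta>_coarse: "(1 / 1000) powr ((1 - \<gamma>) * (\<alpha> / 2)) \<le> \<theta>"
    and cell_diam: "\<And>z z' j. z \<in> B \<Longrightarrow> z' \<in> P j z \<Longrightarrow> z' \<in> E \<and> dist z z' \<le> 16 * (t0 / 1000 ^ j)"
    and cell_top: "\<And>z. z \<in> B \<Longrightarrow> B \<subseteq> P 0 z"
begin

definition scale :: "nat \<Rightarrow> real" where "scale j = t0 / 1000 ^ j"

lemma scale_pos: "scale j > 0" unfolding scale_def using t0 by simp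

lemma scale_ratio: "i \<le> j \<Longrightarrow> scale j / scale i = (1 / 1000) ^ (j - i)"
  unfolding scale_def using t0 by (simp add: power_diff field_simps)

text \<open>Implied by goodness of the cube of generation \<open>i\<close> at \<open>y\<close>: the point is far from the boundary of
  every cube that contains it and is at least \<open>r\<close> generations larger.\<close>

definition well_inside :: "nat \<Rightarrow> real^'n \<Rightarrow> bool" where
  "well_inside i y \<longleftrightarrow> (\<forall>j. Suc j + r \<le> i \<longrightarrow> (\<forall>z \<in> E - P (Suc j) y.
     scale i powr \<gamma> * scale (Suc j) powr (1 - \<gamma>) \<le> dist y z))"

definition smear :: "nat \<Rightarrow> (real^'n \<Rightarrow> complex) \<Rightarrow> real^'n \<Rightarrow> ennreal" where
  "smear i g y = (\<integral>\<^sup>+ z. ennreal (poisson (scale i) y z) * ennreal (cmod (g z)) \<partial>\<mu>)"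

definition gap :: "nat \<Rightarrow> nat \<Rightarrow> nat" where "gap i j = (i - j) + (j - i)"

definition majorant :: "nat \<Rightarrow> nat \<Rightarrow> (real^'n \<Rightarrow> complex) \<Rightarrow> real^'n \<Rightarrow> ennreal" where
  "majorant n i f y = (\<Sum>j\<le>n. ennreal (\<theta> ^ gap i j) *
     (smear i (mdiff n j f) y + ennreal (cmod (mdiff n j f y))))"

lemma smear_measurable [measurable]:
  assumes [measurable]: "g \<in> borel_measurable \<mu>"
  shows "smear i g \<in> borel_measurable \<mu>"
proof -
  have [measurable]: "(\<lambda>(y, z). poisson (scale i) y z) \<in> borel_measurable (\<mu> \<Otimes>\<^sub>M \<mu>)"
    using poisson_kernel_measurable measurable_cong_sets[OF sets_pair_measure_cong[OF sets_\<mu> sets_\<mu>] refl]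
    by blast
  show ?thesis unfolding smear_def[abs_def] by measurable
qed

text \<open>For \<open>j = i\<close> the size of the kernel suffices. For finer cubes the mean value zero of the
  difference makes it possible to subtract the kernel frozen at one point of each cube.\<close>

lemma fine_estimate:
  assumes f: "square_integrable \<mu> f" and "i \<le> j"
    and x: "x \<in> cone E y" "scale i \<le> infdist x E" "infdist x E < 1000 * scale i"
  shows "ennreal (cmod (T (mdiff n j f) x) * infdist x E powr \<alpha>) \<le>
    ennreal ((K_size + K_smooth) * \<theta> ^ (j - i)) * smear i (mdiff n j f) y"
proof -
  let ?D = "mdiff n j f" and ?d = "infdist x E powr \<alpha>"
  define K where "K = (K_size + K_smooth) * \<theta> ^ (j - i)"
  have K0: "K \<ge> 0" unfolding K_def using K_size_pos K_smooth_pos \<theta> by simp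
  have D: "square_integrable \<mu> ?D" by (rule mdiff_square_integrable[OF f])
  have Di: "integrable \<mu> ?D" by (rule integrable_of_square_integrable[OF D])
  have xE: "x \<in> - E" using x(1) unfolding cone_def by simp
  have s: "ennreal K * smear i ?D y = (\<integral>\<^sup>+ z. ennreal (K * poisson (scale i) y z * cmod (?D z)) \<partial>\<mu>)"
  proof -
    have [measurable]: "?D \<in> borel_measurable \<mu>" using Di by auto
    have "(\<lambda>z. poisson (scale i) y z) \<in> borel_measurable \<mu>"
      using poisson_kernel_section_measurable measurable_cong_sets[OF sets_\<mu> refl] by blast
    then have "(\<lambda>z. ennreal (poisson (scale i) y z) * ennreal (cmod (?D z))) \<in> borel_measurable \<mu>"
      by measurable
    then show ?thesis unfolding smear_def using K0
      by (simp add: nn_integral_cmult[symmetric] ennreal_mult mult.assoc poisson_kernel_nonneg)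
  qed
  show ?thesis
  proof (cases "i = j")
    case True
    have "ennreal (cmod (T ?D x) * ?d) \<le> (\<integral>\<^sup>+ z. ennreal (K * poisson (scale i) y z * cmod (?D z)) \<partial>\<mu>)"
    proof (rule T_norm_le[OF xE Di], intro AE_I2 impI)
      fix z assume z: "z \<in> E"
      have "cmod (S x z) * ?d \<le> K_size * poisson_kernel m \<alpha> (scale i) y z"
        unfolding K_size_def using kernel_size_bound[OF kernel x(1) z scale_pos x(2) _ m \<alpha> K1] x(3) by simp
      also have "\<dots> \<le> K * poisson (scale i) y z"
        using K_size_pos K_smooth_pos True poisson_split_le[OF scale_pos] poisson_kernel_nonneg
        by (intro mult_mono) (auto simp: K_def)
      finally have "cmod (S x z) * ?d * cmod (?D z) \<le> K * poisson (scale i) y z * cmod (?D z)"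
        by (rule mult_right_mono) simp
      then show "cmod (S x z * ?D z) * ?d \<le> K * poisson (scale i) y z * cmod (?D z)"
        by (simp add: norm_mult mult_ac)
    qed simp
    then show ?thesis using s unfolding K_def by simp
  next
    case False
    then have ij: "i < j" using assms by simp
    \<comment> \<open>The cell of a point of the ball lies in \<open>E\<close>, so its chosen point is one where the kernel
      satisfies its bounds; the complement of the ball is null.\<close>
    define h where "h z = S x (SOME z'. z' \<in> P j z)" for z
    have h: "cell_const j h" unfolding cell_const_def h_def using cell_eq by metis
    note h0 = integral_cell_const_mult_eq_0[OF h Di integral_cell_mdiff[OF f]]
    have Deq: "T ?D x = (LINT z|\<mu>. indicator E z *\<^sub>R S x z * ?D z - h z * ?D z)"
      unfolding T_eq using h0 kernel_times_integrable[OF xE Di] by simp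
    have bnd: "(cmod (indicator E z *\<^sub>R S x z * ?D z - h z * ?D z)) * ?d \<le>
        K * poisson (scale i) y z * cmod (?D z)" if "z \<in> B" for z
    proof -
      have zE: "z \<in> E" using that B_subset by auto
      define c where "c = (SOME z'. z' \<in> P j z)"
      have "c \<in> P j z" unfolding c_def using cell_mem someI by metis
      then have c: "c \<in> E" "dist z c \<le> 16 * scale j"
        using cell_diam[OF that] unfolding scale_def by auto
      have r1: "scale j / scale i = (1 / 1000) ^ (j - i)" using scale_ratio ij by simp
      have "(1 / 1000 :: real) ^ (j - i) \<le> (1 / 1000) ^ 1" using ij by (intro power_decreasing) auto
      then have "scale j / scale i \<le> 1 / 1000" unfolding r1 by simp
      then have "1000 * scale j \<le> scale i" using scale_pos[of i] by (simp add: field_simps)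
      then have "cmod (S x z - S x c) * ?d \<le> K_smooth * (scale j / scale i) powr \<beta> * poisson_kernel m \<alpha> (scale i) y z"
        unfolding K_smooth_def
        using kernel_smoothness_bound[OF kernel x(1) zE c(1) scale_pos x(2) _ m \<alpha> \<beta> K2 c(2)] x(3) by simp
      also have "\<dots> \<le> K * poisson (scale i) y z"
        unfolding K_def
      proof (intro mult_mono poisson_split_le scale_pos poisson_kernel_nonneg)
        have "(scale j / scale i) powr \<beta> = ((1 / 1000) powr \<beta>) ^ (j - i)"
          unfolding r1 by (simp add: powr_realpow[symmetric] powr_powr powr_power mult.commute)
        also have "\<dots> \<le> \<theta> ^ (j - i)" using \<theta>_fine by (intro power_mono) auto
        finally show "(scale j / scale i) powr \<beta> \<le> \<theta> ^ (j - i)" .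
      qed (use K_size_pos K_smooth_pos \<theta> in auto)
      finally have "cmod (S x z - S x c) * ?d * cmod (?D z) \<le> K * poisson (scale i) y z * cmod (?D z)"
        by (rule mult_right_mono) simp
      moreover have "indicator E z *\<^sub>R S x z * ?D z - h z * ?D z = (S x z - S x c) * ?D z"
        using zE unfolding h_def c_def by (simp add: left_diff_distrib)
      ultimately show ?thesis by (simp add: norm_mult mult_ac)
    qed
    let ?u = "\<lambda>z. indicator E z *\<^sub>R S x z * ?D z - h z * ?D z"
    have ui: "integrable \<mu> ?u"
      using h0(1) kernel_times_integrable[OF xE Di] by simp
    have "ennreal (cmod (T ?D x) * ?d) = ennreal (cmod (LINT z|\<mu>. ?u z)) * ennreal ?d"
      unfolding Deq by (simp add: ennreal_mult)
    also have "\<dots> \<le> (\<integral>\<^sup>+ z. ennreal (cmod (?u z)) \<partial>\<mu>) * ennreal ?d"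
      by (intro mult_right_mono integral_norm_bound_ennreal ui) simp
    also have "\<dots> = (\<integral>\<^sup>+ z. ennreal (cmod (?u z) * ?d) \<partial>\<mu>)"
    proof -
      have "(\<lambda>z. ennreal (cmod (?u z))) \<in> borel_measurable \<mu>" using ui by auto
      then show ?thesis by (simp only: nn_integral_multc[symmetric] ennreal_mult norm_ge_zero powr_ge_zero)
    qed
    also have "\<dots> \<le> (\<integral>\<^sup>+ z. ennreal (K * poisson (scale i) y z * cmod (?D z)) \<partial>\<mu>)"
      using AE_ball bnd by (intro nn_integral_mono_AE) (elim AE_mp, intro AE_I2 impI ennreal_leI)
    finally show ?thesis using s unfolding K_def by simp
  qed
qed

text \<open>If the cube is larger by at least \<open>r\<close> generations, the ratio is at most
  \<open>(scale i / scale (Suc j))^(1 - \<gamma>)\<close>. If it is not, there is no gain, and the constant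
  \<open>\<theta>^(-Suc r)\<close> hides the loss.\<close>

lemma coarse_decay:
  assumes "j < i" and w: "well_inside i y" and z: "z \<in> E - P (Suc j) y"
  shows "(scale i / (scale i + dist y z)) powr (\<alpha> / 2) \<le> \<theta> ^ (i - j) / \<theta> ^ Suc r"
proof (cases "Suc j + r \<le> i")
  case True
  let ?k = "i - Suc j"
  define \<rho> where "\<rho> = scale i powr \<gamma> * scale (Suc j) powr (1 - \<gamma>)"
  have \<rho>: "\<rho> > 0" "\<rho> \<le> dist y z"
    using w True z scale_pos[of i] scale_pos[of "Suc j"] unfolding well_inside_def \<rho>_def by auto
  have "scale i / (scale i + dist y z) \<le> scale i / \<rho>"
    using \<rho> scale_pos[of i] by (intro divide_left_mono) (auto intro!: mult_pos_pos add_pos_pos)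
  also have "\<dots> = (scale i / scale (Suc j)) powr (1 - \<gamma>)"
    unfolding \<rho>_def using scale_pos[of i] scale_pos[of "Suc j"]
    by (simp add: powr_divide powr_diff field_simps)
  finally have "(scale i / (scale i + dist y z)) powr (\<alpha> / 2) \<le>
      ((scale i / scale (Suc j)) powr (1 - \<gamma>)) powr (\<alpha> / 2)"
    using \<alpha> scale_pos[of i] by (intro powr_mono2) (auto intro!: divide_nonneg_nonneg)
  also have "\<dots> = ((1 / 1000) ^ ?k) powr ((1 - \<gamma>) * (\<alpha> / 2))"
    using scale_ratio[of "Suc j" i] \<open>j < i\<close> by (simp add: powr_powr)
  also have "\<dots> = ((1 / 1000) powr ((1 - \<gamma>) * (\<alpha> / 2))) ^ ?k"
    by (simp add: powr_realpow[symmetric] powr_powr powr_power mult_ac)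
  also have "\<dots> \<le> \<theta> ^ ?k" using \<theta>_coarse by (intro power_mono) auto
  also have "\<dots> \<le> \<theta> ^ ?k / \<theta> ^ r"
    using \<theta> by (simp add: field_simps mult_left_le power_le_one)
  also have "\<dots> = \<theta> ^ (i - j) / \<theta> ^ Suc r"
    using \<open>j < i\<close> \<theta> by (simp add: Suc_diff_Suc[symmetric])
  finally show ?thesis .
next
  case False
  have "(scale i / (scale i + dist y z)) powr (\<alpha> / 2) \<le> 1"
    using \<alpha> scale_pos[of i] by (intro powr_le1) (auto simp: add_pos_nonneg)
  also have "\<theta> ^ Suc r \<le> \<theta> ^ (i - j)" using False \<theta> by (intro power_decreasing) auto
  then have "1 \<le> \<theta> ^ (i - j) / \<theta> ^ Suc r" using \<theta> by (simp add: field_simps)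
  finally show ?thesis .
qed

text \<open>The difference is constant on the cube of generation \<open>Suc j\<close> that contains \<open>y\<close>, so only points
  outside of this cube contribute, and these are far from \<open>y\<close>.\<close>

lemma coarse_estimate:
  assumes f: "square_integrable \<mu> f" and "j < i" "i \<le> n" and w: "well_inside i y" and y: "y \<in> B - H"
    and x: "x \<in> cone E y" "scale i \<le> infdist x E" "infdist x E < 1000 * scale i"
  shows "ennreal (cmod (T (\<lambda>z. mdiff n j f z - mdiff n j f y) x) * infdist x E powr \<alpha>) \<le>
    ennreal (K_size * (1 + poisson_mass) * \<theta> ^ (i - j) / \<theta> ^ Suc r) *
      (smear i (mdiff n j f) y + ennreal (cmod (mdiff n j f y)))"
proof -
  let ?D = "mdiff n j f" and ?d = "infdist x E powr \<alpha>"
  let ?p = "\<lambda>z. poisson (scale i) y z"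
  define K where "K = K_size * (\<theta> ^ (i - j) / \<theta> ^ Suc r)"
  have K0: "K \<ge> 0" unfolding K_def using K_size_pos \<theta> by simp
  have D: "square_integrable \<mu> ?D" by (rule mdiff_square_integrable[OF f])
  have Di: "integrable \<mu> ?D" by (rule integrable_of_square_integrable[OF D])
  have gi: "integrable \<mu> (\<lambda>z. ?D z - ?D y)" using Di by simp
  have xE: "x \<in> - E" using x(1) unfolding cone_def by simp
  have [measurable]: "?D \<in> borel_measurable \<mu>" using Di by auto
  have p [measurable]: "(\<lambda>z. ?p z) \<in> borel_measurable \<mu>"
    using poisson_kernel_section_measurable measurable_cong_sets[OF sets_\<mu> refl] by blast
  have "ennreal (cmod (T (\<lambda>z. ?D z - ?D y) x) * ?d) \<le>
      (\<integral>\<^sup>+ z. ennreal (K * ?p z * cmod (?D z - ?D y)) \<partial>\<mu>)"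
  proof (rule T_norm_le[OF xE gi], intro AE_I2 impI)
    fix z assume z: "z \<in> E"
    show "cmod (S x z * (?D z - ?D y)) * ?d \<le> K * ?p z * cmod (?D z - ?D y)"
    proof (cases "z \<in> P (Suc j) y")
      case True
      then have "?D z = ?D y"
        using cell_const_mdiff[of j n f] assms(2,3) unfolding cell_const_def by auto
      then show ?thesis by simp
    next
      case False
      have "cmod (S x z) * ?d \<le> K_size * poisson_kernel m \<alpha> (scale i) y z"
        unfolding K_size_def using kernel_size_bound[OF kernel x(1) z scale_pos x(2) _ m \<alpha> K1] x(3) by simp
      also have "\<dots> = K_size * ((scale i / (scale i + dist y z)) powr (\<alpha> / 2) * ?p z)"
        by (simp add: poisson_split[OF scale_pos])
      also have "\<dots> \<le> K_size * ((\<theta> ^ (i - j) / \<theta> ^ Suc r) * ?p z)"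
        using coarse_decay[OF assms(2) w] z False K_size_pos poisson_kernel_nonneg
        by (intro mult_left_mono mult_right_mono) auto
      finally have "cmod (S x z) * ?d * cmod (?D z - ?D y) \<le> K_size * ((\<theta> ^ (i - j) / \<theta> ^ Suc r) * ?p z) * cmod (?D z - ?D y)"
        by (rule mult_right_mono) simp
      then show ?thesis unfolding K_def by (simp add: norm_mult mult_ac)
    qed
  qed simp
  also have "\<dots> \<le> (\<integral>\<^sup>+ z. ennreal K * (ennreal (?p z) * ennreal (cmod (?D z)) +
      ennreal (?p z) * ennreal (cmod (?D y))) \<partial>\<mu>)"
  proof (rule nn_integral_mono)
    fix z
    have "ennreal (K * ?p z * cmod (?D z - ?D y)) \<le> ennreal (K * (?p z * cmod (?D z) + ?p z * cmod (?D y)))"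
      using K0 poisson_kernel_nonneg[of m "\<alpha> / 2" "scale i" y z] norm_triangle_ineq4[of "?D z" "?D y"]
      by (intro ennreal_leI) (simp add: mult.assoc distrib_left[symmetric] mult_left_mono del: mult_le_cancel_left)
    also have "\<dots> = ennreal K * (ennreal (?p z) * ennreal (cmod (?D z)) + ennreal (?p z) * ennreal (cmod (?D y)))"
      using K0 poisson_kernel_nonneg[of m "\<alpha> / 2" "scale i" y z]
      by (simp add: ennreal_mult)
    finally show "ennreal (K * ?p z * cmod (?D z - ?D y)) \<le> \<dots>" .
  qed
  also have "\<dots> = ennreal K * (smear i ?D y + (\<integral>\<^sup>+ z. ennreal (?p z) \<partial>\<mu>) * ennreal (cmod (?D y)))"
    unfolding smear_def
    by (subst nn_integral_cmult, measurable, subst nn_integral_add, measurable, subst nn_integral_multc, measurable)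
  also have "\<dots> \<le> ennreal K * (smear i ?D y + ennreal poisson_mass * ennreal (cmod (?D y)))"
    using poisson_integral_le[of y "scale i"] y B_subset scale_pos
    by (intro mult_left_mono add_left_mono mult_right_mono) auto
  also have "\<dots> \<le> ennreal K * (ennreal (1 + poisson_mass) * (smear i ?D y + ennreal (cmod (?D y))))"
  proof -
    have "1 * smear i ?D y \<le> ennreal (1 + poisson_mass) * smear i ?D y"
      using poisson_mass_nonneg by (intro mult_right_mono) (auto simp: ennreal_plus[OF zero_le_one])
    then have "smear i ?D y \<le> ennreal (1 + poisson_mass) * smear i ?D y" by simp
    moreover have "ennreal poisson_mass * ennreal (cmod (?D y)) \<le> ennreal (1 + poisson_mass) * ennreal (cmod (?D y))"
      by (intro mult_right_mono ennreal_leI) auto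
    ultimately show ?thesis by (intro mult_left_mono) (auto simp: distrib_left intro!: add_mono)
  qed
  also have "\<dots> = ennreal (K_size * (1 + poisson_mass) * \<theta> ^ (i - j) / \<theta> ^ Suc r) * (smear i ?D y + ennreal (cmod (?D y)))"
  proof -
    have "K * (1 + poisson_mass) = K_size * (1 + poisson_mass) * \<theta> ^ (i - j) / \<theta> ^ Suc r" unfolding K_def by simp
    then have "ennreal K * ennreal (1 + poisson_mass) = ennreal (K_size * (1 + poisson_mass) * \<theta> ^ (i - j) / \<theta> ^ Suc r)"
      using K0 poisson_mass_nonneg by (simp only: ennreal_mult[symmetric] add_nonneg_nonneg zero_le_one)
    then show ?thesis by (simp only: mult.assoc[symmetric])
  qed
  finally show ?thesis .
qed

definition K_point :: real where "K_point = (K_size + K_smooth) * (1 + poisson_mass) / \<theta> ^ Suc r"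

lemma K_point_pos: "K_point > 0"
  unfolding K_point_def using K_size_pos K_smooth_pos poisson_mass_nonneg \<theta> by auto

text \<open>The mean of \<open>f\<close> over the top cell cancels because this cell contains the whole ball. The
  differences that are coarser than level \<open>i\<close> make up \<open>avg i f y\<close>, so each of them appears with its
  value at \<open>y\<close> subtracted.\<close>

lemma pointwise_estimate:
  assumes f: "square_integrable \<mu> f" and "i \<le> n" and w: "well_inside i y" and y: "y \<in> B - H"
    and x: "x \<in> cone E y" "scale i \<le> infdist x E" "infdist x E < 1000 * scale i"
  shows "ennreal (cmod (T f x - avg i f y * T (\<lambda>_. 1) x) * infdist x E powr \<alpha>) \<le>
    ennreal K_point * majorant n i f y"
proof -
  let ?d = "infdist x E powr \<alpha>"
  define D where "D j = mdiff n j f" for j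
  define G where "G j z = D j z - (if j < i then D j y else 0)" for j z
  have fi: "integrable \<mu> f" by (rule integrable_of_square_integrable[OF f])
  have Gi: "integrable \<mu> (G j)" for j
    unfolding G_def D_def
    using integrable_of_square_integrable[OF mdiff_square_integrable[OF f], of n j] by simp
  have xE: "x \<in> - E" using x(1) unfolding cone_def by simp
  have eq: "f z - avg i f y = (\<Sum>j\<le>n. G j z)" if "z \<in> B" for z
  proof -
    have "z \<in> P 0 y" using cell_top[of y] y that by auto
    then have a: "avg 0 f z = avg 0 f y" using cell_const_avg[of 0 f] unfolding cell_const_def by blast
    have "(\<Sum>j\<le>n. if j < i then D j y else 0) = (\<Sum>j<i. D j y)"
      using \<open>i \<le> n\<close> by (subst sum.If_cases) (auto intro!: sum.cong)
    then have "(\<Sum>j\<le>n. G j z) = (\<Sum>j\<le>n. D j z) - (\<Sum>j<i. D j y)"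
      unfolding G_def by (simp add: sum_subtractf)
    moreover have "f z = avg 0 f z + (\<Sum>j\<le>n. D j z)"
      using avg_plus_mdiff[of 0 n f z] by (simp add: D_def atMost_atLeast0)
    moreover have "avg i f y = avg 0 f y + (\<Sum>j<i. D j y)"
      unfolding D_def by (rule avg_eq_sum_mdiff[OF \<open>i \<le> n\<close>])
    ultimately show ?thesis using a by simp
  qed
  have "T f x - avg i f y * T (\<lambda>_. 1) x = T (\<lambda>z. f z - avg i f y) x"
    using T_diff[OF xE fi, of "\<lambda>_. avg i f y"] T_const[of "avg i f y" x] by simp
  also have "\<dots> = T (\<lambda>z. \<Sum>j\<le>n. G j z) x"
    using fi Gi eq AE_ball by (intro T_cong_AE xE) (auto elim!: eventually_mono)
  also have "\<dots> = (\<Sum>j\<le>n. T (G j) x)" by (rule T_sum[OF xE Gi])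
  finally have "cmod (T f x - avg i f y * T (\<lambda>_. 1) x) * ?d \<le> (\<Sum>j\<le>n. cmod (T (G j) x) * ?d)"
    by (simp add: sum_distrib_right[symmetric] mult_right_mono norm_sum)
  then have "ennreal (cmod (T f x - avg i f y * T (\<lambda>_. 1) x) * ?d) \<le> (\<Sum>j\<le>n. ennreal (cmod (T (G j) x) * ?d))"
    by (subst sum_ennreal) (auto intro!: ennreal_leI)
  also have "\<dots> \<le> (\<Sum>j\<le>n. ennreal K_point * (ennreal (\<theta> ^ gap i j) * (smear i (D j) y + ennreal (cmod (D j y)))))"
  proof (rule sum_mono)
    fix j
    let ?N = "smear i (D j) y + ennreal (cmod (D j y))"
    have p: "\<theta> ^ gap i j \<ge> 0" using \<theta> by simp
    have "ennreal (cmod (T (G j) x) * ?d) \<le> ennreal (K_point * \<theta> ^ gap i j) * ?N"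
    proof (cases "j < i")
      case True
      then have "G j = (\<lambda>z. D j z - D j y)" unfolding G_def by auto
      then have "ennreal (cmod (T (G j) x) * ?d) \<le> ennreal (K_size * (1 + poisson_mass) * \<theta> ^ (i - j) / \<theta> ^ Suc r) * ?N"
        using coarse_estimate[OF f True \<open>i \<le> n\<close> w y x] unfolding D_def by simp
      also have "K_size * (1 + poisson_mass) * \<theta> ^ (i - j) / \<theta> ^ Suc r \<le> K_point * \<theta> ^ gap i j"
        unfolding K_point_def gap_def using True K_smooth_pos poisson_mass_nonneg \<theta>
        by (simp add: divide_right_mono mult_right_mono)
      finally show ?thesis by (simp add: mult_right_mono ennreal_leI)
    next
      case False
      then have "G j = D j" unfolding G_def by auto
      then have "ennreal (cmod (T (G j) x) * ?d) \<le> ennreal ((K_size + K_smooth) * \<theta> ^ (j - i)) * smear i (D j) y"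
        using fine_estimate[OF f _ x, of j n] False unfolding D_def by simp
      also have "\<dots> \<le> ennreal (K_point * \<theta> ^ gap i j) * ?N"
      proof (rule mult_mono[OF ennreal_leI])
        have t: "0 < \<theta> ^ Suc r" "\<theta> ^ Suc r \<le> 1" using \<theta> by (auto intro: power_le_one simp del: power_Suc)
        have "1 * \<theta> ^ Suc r \<le> 1 + poisson_mass" using t poisson_mass_nonneg by linarith
        then have "1 \<le> (1 + poisson_mass) / \<theta> ^ Suc r" using t by (subst le_divide_eq_1_pos) auto
        then have "(K_size + K_smooth) * 1 \<le> (K_size + K_smooth) * ((1 + poisson_mass) / \<theta> ^ Suc r)"
          using K_size_pos K_smooth_pos by (intro mult_left_mono) auto
        then have "K_size + K_smooth \<le> K_point" unfolding K_point_def by simp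
        then show "(K_size + K_smooth) * \<theta> ^ (j - i) \<le> K_point * \<theta> ^ gap i j"
          using False \<theta> by (simp add: gap_def mult_right_mono)
      qed auto
      finally show ?thesis .
    qed
    also have "\<dots> = ennreal K_point * (ennreal (\<theta> ^ gap i j) * ?N)"
      using K_point_pos p by (simp add: ennreal_mult mult.assoc)
    finally show "ennreal (cmod (T (G j) x) * ?d) \<le> ennreal K_point * (ennreal (\<theta> ^ gap i j) * ?N)" .
  qed
  also have "\<dots> = ennreal K_point * majorant n i f y"
    unfolding majorant_def D_def by (simp add: sum_distrib_left)
  finally show ?thesis .
qed

lemma sum_gap_le: "(\<Sum>j\<le>n. \<theta> ^ gap i j) \<le> 2 / (1 - \<theta>)"
proof -
  have "(\<Sum>j\<le>n. \<theta> ^ gap i j) \<le> (\<Sum>j\<in>{..i} \<union> {i..n}. \<theta> ^ gap i j)"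
    using \<theta> by (intro sum_mono2) auto
  also have "\<dots> \<le> (\<Sum>j\<in>{..i}. \<theta> ^ gap i j) + (\<Sum>j\<in>{i..n}. \<theta> ^ gap i j)"
    using \<theta> by (subst sum_Un) (auto intro!: sum_nonneg)
  also have "(\<Sum>j\<in>{..i}. \<theta> ^ gap i j) = (\<Sum>k\<in>{..i}. \<theta> ^ k)"
    by (rule sum.reindex_bij_witness[of _ "\<lambda>k. i - k" "\<lambda>j. i - j"]) (auto simp: gap_def)
  also have "(\<Sum>j\<in>{i..n}. \<theta> ^ gap i j) = (\<Sum>k\<in>(\<lambda>j. j - i) ` {i..n}. \<theta> ^ k)"
    by (subst sum.reindex) (auto simp: gap_def inj_on_def intro!: sum.cong)
  also have "(\<Sum>k\<in>{..i}. \<theta> ^ k) \<le> (\<Sum>k. \<theta> ^ k)"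
    using \<theta> by (intro sum_le_suminf summable_geometric) auto
  also have "(\<Sum>k\<in>(\<lambda>j. j - i) ` {i..n}. \<theta> ^ k) \<le> (\<Sum>k. \<theta> ^ k)"
    using \<theta> by (intro sum_le_suminf summable_geometric) auto
  also have "(\<Sum>k. \<theta> ^ k) = 1 / (1 - \<theta>)" using \<theta> by (intro suminf_geometric) auto
  finally show ?thesis by simp
qed

lemma gap_commute: "gap i j = gap j i" unfolding gap_def by simp

lemma nn_square_integrable:
  assumes "square_integrable \<mu> (f :: _ \<Rightarrow> complex)"
  shows "energy f = ennreal (LINT z|\<mu>. (cmod (f z))\<^sup>2)"
  using assms unfolding square_integrable_def
  by (simp add: ennreal_power nn_integral_eq_integral)

text \<open>Schur's test, with growth at \<open>y\<close> for the rows and \<open>poisson_integral_adjoint_le\<close> for the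
  columns.\<close>

lemma smear_energy:
  assumes g [measurable]: "g \<in> borel_measurable \<mu>"
  shows "(\<integral>\<^sup>+ y\<in>B - H. (smear i g y + ennreal (cmod (g y)))\<^sup>2 \<partial>\<mu>) \<le>
    ennreal (2 * (poisson_mass * (poisson_mass * 2 powr m) + 1)) * energy g"
proof -
  let ?I = "energy g"
  have BH [measurable]: "B - H \<in> sets \<mu>" by measurable
  note [measurable] = smear_measurable[OF g, of i]
  have 1: "(\<lambda>y. (smear i g y)\<^sup>2 * indicator (B - H) y) \<in> borel_measurable \<mu>" by measurable
  have 2: "(\<lambda>y. (ennreal (cmod (g y)))\<^sup>2) \<in> borel_measurable \<mu>" by measurable
  have "(\<integral>\<^sup>+ y\<in>B - H. (smear i g y + ennreal (cmod (g y)))\<^sup>2 \<partial>\<mu>) \<le>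
      (\<integral>\<^sup>+ y. 2 * ((smear i g y)\<^sup>2 * indicator (B - H) y) + 2 * (ennreal (cmod (g y)))\<^sup>2 \<partial>\<mu>)"
    by (intro nn_integral_mono) (auto simp: indicator_def intro: power2_add_le_ennreal)
  also have "\<dots> = 2 * (\<integral>\<^sup>+ y\<in>B - H. (smear i g y)\<^sup>2 \<partial>\<mu>) + 2 * ?I"
    using 1 2 by (subst nn_integral_add) (auto simp: nn_integral_cmult)
  also have "(\<integral>\<^sup>+ y\<in>B - H. (smear i g y)\<^sup>2 \<partial>\<mu>) \<le> ennreal poisson_mass * ennreal (poisson_mass * 2 powr m) * ?I"
    unfolding smear_def
  proof (rule schur_test[where w = "\<lambda>y z. poisson (scale i) y z" and g = "\<lambda>z. ennreal (cmod (g z))"])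
    show "sigma_finite_measure \<mu>" ..
    show "(\<lambda>(y, z). poisson_kernel m (\<alpha> / 2) (scale i) y z) \<in> borel_measurable (\<mu> \<Otimes>\<^sub>M \<mu>)"
      using poisson_kernel_measurable measurable_cong_sets[OF sets_pair_measure_cong[OF sets_\<mu> sets_\<mu>] refl]
      by blast
  qed (use BH poisson_integral_le poisson_integral_adjoint_le scale_pos poisson_kernel_nonneg B_subset in auto)
  also have "2 * (ennreal poisson_mass * ennreal (poisson_mass * 2 powr m) * ?I) + 2 * ?I =
      ennreal (2 * (poisson_mass * (poisson_mass * 2 powr m) + 1)) * ?I"
    using poisson_mass_nonneg by (simp add: ennreal_mult distrib_right distrib_left mult.assoc)
  finally show ?thesis by (simp add: add_mono mult_left_mono)
qed

definition K_energy :: real where "K_energy = (2 / (1 - \<theta>))\<^sup>2 * (2 * (poisson_mass * (poisson_mass * 2 powr m) + 1))"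

lemma K_energy_nonneg: "K_energy \<ge> 0" unfolding K_energy_def using poisson_mass_nonneg by simp

lemma majorant_measurable [measurable]:
  assumes f: "square_integrable \<mu> f"
  shows "majorant n i f \<in> borel_measurable \<mu>"
proof -
  have [measurable]: "mdiff n j f \<in> borel_measurable \<mu>" for j
    using mdiff_square_integrable[OF f] unfolding square_integrable_def by blast
  show ?thesis unfolding majorant_def[abs_def] by measurable
qed

text \<open>The Cauchy--Schwarz inequality in \<open>j\<close> against the weights \<open>\<theta>^gap\<close> and summation in \<open>i\<close> each
  cost the factor \<open>2 / (1 - \<theta>)\<close>; what is left is the orthogonality of the differences.\<close>

lemma majorant_energy:
  assumes f: "square_integrable \<mu> f"
  shows "(\<Sum>i\<le>n. \<integral>\<^sup>+ y\<in>B - H. (majorant n i f y)\<^sup>2 \<partial>\<mu>) \<le>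
    ennreal K_energy * energy f"
proof -
  define s where "s = 2 / (1 - \<theta>)"
  have s: "s \<ge> 0" unfolding s_def using \<theta> by simp
  define q where "q = 2 * (poisson_mass * (poisson_mass * 2 powr m) + 1)"
  have q: "q \<ge> 0" unfolding q_def using poisson_mass_nonneg by simp
  define I where "I j = (\<integral>\<^sup>+ z. (ennreal (cmod (mdiff n j f z)))\<^sup>2 \<partial>\<mu>)" for j
  have p: "\<theta> ^ k \<ge> 0" for k using \<theta> by simp
  have D [measurable]: "mdiff n j f \<in> borel_measurable \<mu>" for j
    using mdiff_square_integrable[OF f] unfolding square_integrable_def by blast
  have BH [measurable]: "B - H \<in> sets \<mu>" by measurable
  let ?g = "\<lambda>i j. ennreal (\<theta> ^ gap i j)"
  have sum: "(\<Sum>j\<le>n. ?g i j) \<le> ennreal s" for i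
    using sum_gap_le[of i n] p unfolding s_def by (subst sum_ennreal) (auto intro!: ennreal_leI)
  have "(\<integral>\<^sup>+ y\<in>B - H. (majorant n i f y)\<^sup>2 \<partial>\<mu>) \<le> ennreal (s * q) * (\<Sum>j\<le>n. ?g i j * I j)" for i
  proof -
    let ?a = "\<lambda>j y. (smear i (mdiff n j f) y + ennreal (cmod (mdiff n j f y)))\<^sup>2 * indicator (B - H) y"
    have a: "?a j \<in> borel_measurable \<mu>" for j by measurable
    have "(\<integral>\<^sup>+ y\<in>B - H. (majorant n i f y)\<^sup>2 \<partial>\<mu>) \<le> (\<integral>\<^sup>+ y. ennreal s * (\<Sum>j\<le>n. ?g i j * ?a j y) \<partial>\<mu>)"
    proof (rule nn_integral_mono)
      fix y
      have "(majorant n i f y)\<^sup>2 \<le> (\<Sum>j\<le>n. ?g i j) *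
          (\<Sum>j\<le>n. ?g i j * (smear i (mdiff n j f) y + ennreal (cmod (mdiff n j f y)))\<^sup>2)"
        unfolding majorant_def using p by (intro Cauchy_Schwarz_sum_ennreal) auto
      also have "\<dots> \<le> ennreal s * (\<Sum>j\<le>n. ?g i j * (smear i (mdiff n j f) y + ennreal (cmod (mdiff n j f y)))\<^sup>2)"
        by (intro mult_right_mono sum) auto
      finally show "(majorant n i f y)\<^sup>2 * indicator (B - H) y \<le> ennreal s * (\<Sum>j\<le>n. ?g i j * ?a j y)"
        by (cases "y \<in> B - H") auto
    qed
    also have "\<dots> = ennreal s * (\<Sum>j\<le>n. ?g i j * (\<integral>\<^sup>+ y. ?a j y \<partial>\<mu>))"
      using a by (simp add: nn_integral_cmult nn_integral_sum borel_measurable_sum)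
    also have "\<dots> \<le> ennreal s * (\<Sum>j\<le>n. ?g i j * (ennreal q * I j))"
      unfolding q_def I_def by (intro mult_left_mono sum_mono smear_energy D) auto
    also have "\<dots> = ennreal (s * q) * (\<Sum>j\<le>n. ?g i j * I j)"
      using s q by (simp add: ennreal_mult sum_distrib_left mult_ac)
    finally show ?thesis .
  qed
  then have "(\<Sum>i\<le>n. \<integral>\<^sup>+ y\<in>B - H. (majorant n i f y)\<^sup>2 \<partial>\<mu>) \<le>
      (\<Sum>i\<le>n. ennreal (s * q) * (\<Sum>j\<le>n. ?g i j * I j))"
    by (intro sum_mono)
  also have "\<dots> = ennreal (s * q) * (\<Sum>j\<le>n. (\<Sum>i\<le>n. ?g j i) * I j)"
    unfolding sum_distrib_left[symmetric] sum_distrib_right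
    by (subst sum.swap) (simp add: gap_commute)
  also have "\<dots> \<le> ennreal (s * q) * (\<Sum>j\<le>n. ennreal s * I j)"
    by (intro mult_left_mono sum_mono mult_right_mono sum) auto
  also have "\<dots> = ennreal K_energy * (\<Sum>j\<le>n. I j)"
  proof -
    have "K_energy = s * q * s" unfolding K_energy_def s_def q_def by (simp add: power2_eq_square)
    then show ?thesis using s q by (simp add: ennreal_mult sum_distrib_left mult.assoc)
  qed
  also have "(\<Sum>j\<le>n. I j) \<le> energy f"
    unfolding I_def nn_square_integrable[OF f] nn_square_integrable[OF mdiff_square_integrable[OF f]]
    using sum_mdiff_energy[OF f, of n] by (subst sum_ennreal) (auto intro!: ennreal_leI)
  finally show ?thesis by (simp add: mult_left_mono)
qed

section \<open>The part of the square function at good points\<close>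

abbreviation slab :: "nat \<Rightarrow> real set" where "slab i \<equiv> {scale i..<1000 * scale i}"

text \<open>Accretivity turns the comparison for \<open>b\<close> into a bound for \<open>T 1\<close>, which is then inserted into
  the comparison for \<open>f\<close>.\<close>

lemma slab_estimate:
  assumes f: "square_integrable \<mu> f" and b: "square_integrable \<mu> b" and "i \<le> n"
    and w: "well_inside i y" and y: "y \<in> B - H" and c: "c > 0" "c \<le> cmod (avg i b y)"
    and p: "p = ennreal (avg_max n (\<lambda>z. cmod (f z)) y / c)"
  shows "sq (slab i) f y \<le> 2 * p\<^sup>2 * (sq (slab i) b y + ennreal (2 * cone_mass * K_point\<^sup>2) * (majorant n i b y)\<^sup>2) +
      ennreal (4 * cone_mass * K_point\<^sup>2) * (majorant n i f y)\<^sup>2"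
proof -
  let ?M = "avg_max n (\<lambda>z. cmod (f z)) y"
  let ?N = "\<lambda>f. majorant n i f y"
  define q where "q = ennreal K_point * (p * ?N b + ?N f)"
  have fi: "integrable \<mu> f" by (rule integrable_of_square_integrable[OF f])
  have M: "cmod (avg i f y) \<le> ?M"
    using norm_avg_le[OF fi, of i y] avg_le_avg_max[OF \<open>i \<le> n\<close>, of "\<lambda>z. cmod (f z)" y] by linarith
  have bm: "b \<in> borel_measurable \<mu>" using b unfolding square_integrable_def by blast
  have "sq (slab i) f y \<le> 2 * p\<^sup>2 * sq (slab i) b y + 2 * q\<^sup>2 * ennreal cone_mass"
  proof (rule sq_slab_comparison[OF scale_pos bm])
    fix x assume x: "x \<in> cone E y" "scale i \<le> infdist x E" "infdist x E < 1000 * scale i"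
    let ?d = "infdist x E powr \<alpha>"
    let ?eb = "cmod (T b x - avg i b y * T (\<lambda>_. 1) x) * ?d"
    let ?ef = "cmod (T f x - avg i f y * T (\<lambda>_. 1) x) * ?d"
    let ?t = "cmod (T (\<lambda>_. 1) x)"
    have "c * ?t \<le> cmod (avg i b y * T (\<lambda>_. 1) x)" using c by (simp add: norm_mult mult_right_mono)
    also have "\<dots> \<le> cmod (T b x) + cmod (T b x - avg i b y * T (\<lambda>_. 1) x)"
      by (smt (verit) norm_minus_commute norm_triangle_sub)
    finally have t: "c * ?t \<le> \<dots>" .
    have "cmod (T f x) \<le> cmod (avg i f y) * ?t + cmod (T f x - avg i f y * T (\<lambda>_. 1) x)"
      by (metis norm_mult norm_triangle_sub)
    also have "cmod (avg i f y) * ?t \<le> ?M * ?t" using M by (rule mult_right_mono) simp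
    also have "?M * ?t = ?M / c * (c * ?t)" using c by simp
    also have "\<dots> \<le> ?M / c * (cmod (T b x) + cmod (T b x - avg i b y * T (\<lambda>_. 1) x))"
      using t c order_trans[OF norm_ge_zero M] by (intro mult_left_mono) auto
    finally have "cmod (T f x) \<le> ?M / c * (cmod (T b x) + cmod (T b x - avg i b y * T (\<lambda>_. 1) x)) +
        cmod (T f x - avg i f y * T (\<lambda>_. 1) x)"
      by simp
    then have "cmod (T f x) * ?d \<le> (?M / c * (cmod (T b x) + cmod (T b x - avg i b y * T (\<lambda>_. 1) x)) +
        cmod (T f x - avg i f y * T (\<lambda>_. 1) x)) * ?d"
      by (rule mult_right_mono) simp
    then have "cmod (T f x) * ?d \<le> ?M / c * (cmod (T b x) * ?d + ?eb) + ?ef"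
      by (simp add: algebra_simps)
    then have "ennreal (cmod (T f x) * ?d) \<le> ennreal (?M / c * (cmod (T b x) * ?d + ?eb) + ?ef)"
      by (rule ennreal_leI)
    also have "\<dots> = p * (ennreal (cmod (T b x) * ?d) + ennreal ?eb) + ennreal ?ef"
    proof -
      have "?M / c \<ge> 0" using c M by (auto intro!: divide_nonneg_pos order_trans[OF norm_ge_zero M])
      moreover have "0 \<le> cmod (T b x) * ?d" "0 \<le> ?eb" "0 \<le> ?ef" by simp_all
      ultimately show ?thesis unfolding p
        by (simp only: ennreal_plus ennreal_mult add_nonneg_nonneg mult_nonneg_nonneg)
    qed
    also have "\<dots> \<le> p * (ennreal (cmod (T b x) * ?d) + ennreal K_point * ?N b) + ennreal K_point * ?N f"
      by (intro add_mono mult_left_mono pointwise_estimate assms x order_refl) auto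
    also have "\<dots> = p * ennreal (cmod (T b x) * ?d) + q"
      unfolding q_def by (simp add: distrib_left mult_ac add_ac)
    finally show "ennreal (cmod (T f x) * ?d) \<le> p * ennreal (cmod (T b x) * ?d) + q" .
  qed
  also have "q\<^sup>2 \<le> (ennreal K_point)\<^sup>2 * (2 * (p * ?N b)\<^sup>2 + 2 * (?N f)\<^sup>2)"
    unfolding q_def power_mult_distrib[of "ennreal K_point"] by (intro mult_left_mono power2_add_le_ennreal) auto
  also have "2 * p\<^sup>2 * sq (slab i) b y + 2 * ((ennreal K_point)\<^sup>2 * (2 * (p * ?N b)\<^sup>2 + 2 * (?N f)\<^sup>2)) * ennreal cone_mass =
      2 * p\<^sup>2 * (sq (slab i) b y + ennreal (2 * cone_mass * K_point\<^sup>2) * (?N b)\<^sup>2) + ennreal (4 * cone_mass * K_point\<^sup>2) * (?N f)\<^sup>2"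
  proof -
    have 1: "ennreal (2 * cone_mass * K_point\<^sup>2) = 2 * ennreal cone_mass * (ennreal K_point)\<^sup>2"
      "ennreal (4 * cone_mass * K_point\<^sup>2) = 4 * ennreal cone_mass * (ennreal K_point)\<^sup>2"
      using cone_mass_nonneg K_point_pos by (simp_all add: ennreal_mult ennreal_power)
    have 4: "(4::ennreal) = 2 * 2" by simp
    show ?thesis unfolding 1 4 by (simp only: distrib_left distrib_right power_mult_distrib mult_ac add_ac)
  qed
  finally show ?thesis by (simp add: add_mono mult_left_mono mult_right_mono)
qed

text \<open>The factor 8 is the product of 2, from the square of a sum, and of 4, from Doob's inequality;
  \<open>l\<close> and \<open>l'\<close> are the levels that bound the square function and the majorant of \<open>b\<close>.\<close>

definition K_paraproduct :: "real \<Rightarrow> real \<Rightarrow> real \<Rightarrow> real" where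
  "K_paraproduct c l l' = 8 / c\<^sup>2 * (l + 2 * cone_mass * K_point\<^sup>2 * l') + 4 * cone_mass * K_point\<^sup>2 * K_energy"

text \<open>The terms that contain averages of \<open>f\<close> are bounded by the maximal function times sums that
  involve only \<open>b\<close>. These sums are bounded at every point of \<open>F\<close>, so that Doob's inequality applies.\<close>

lemma good_part_estimate:
  assumes f: "square_integrable \<mu> f" and b: "square_integrable \<mu> b" and c: "c > 0" and l: "l \<ge> 0" "l' \<ge> 0"
    and F: "F \<subseteq> B - H" "F \<in> sets \<mu>"
    and acc: "\<And>y i. y \<in> F \<Longrightarrow> i \<le> n \<Longrightarrow> c \<le> cmod (avg i b y)"
    and sb: "\<And>y. y \<in> F \<Longrightarrow> (\<Sum>i=1..n. sq (slab i) b y) \<le> ennreal l"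
    and Nb: "\<And>y. y \<in> F \<Longrightarrow> (\<Sum>i\<le>n. (majorant n i b y)\<^sup>2) \<le> ennreal l'"
    and W: "\<And>y i. y \<in> F \<Longrightarrow> y \<in> W i \<Longrightarrow> i \<le> n \<Longrightarrow> well_inside i y"
  shows "(\<integral>\<^sup>+ y\<in>F. (\<Sum>i=1..n. sq (slab i) f y * indicator (W i) y) \<partial>\<mu>) \<le>
    ennreal (K_paraproduct c l l') * energy f"
proof -
  let ?I = "energy f"
  define Mx where "Mx y = avg_max n (\<lambda>z. cmod (f z)) y" for y
  define p where "p y = ennreal (Mx y / c)" for y
  define a where "a = l + 2 * cone_mass * K_point\<^sup>2 * l'"
  have a: "a \<ge> 0" unfolding a_def using l cone_mass_nonneg by simp
  define e where "e = 4 * cone_mass * K_point\<^sup>2"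
  have e: "e \<ge> 0" unfolding e_def using cone_mass_nonneg by simp
  have nn: "Mx y \<ge> 0" for y
    using norm_avg_le[OF integrable_of_square_integrable[OF f], of 0 y]
      avg_le_avg_max[of 0 n "\<lambda>z. cmod (f z)" y] unfolding Mx_def
    by (meson norm_ge_zero order_trans zero_le)
  have Mx: "square_integrable \<mu> Mx"
    unfolding Mx_def by (rule cell_const_square_integrable[OF cell_const_avg_max])
  have Mm: "Mx \<in> borel_measurable \<mu>" using Mx unfolding square_integrable_def by blast
  then have pm: "p \<in> borel_measurable \<mu>" unfolding p_def by measurable
  have BH [measurable]: "B - H \<in> sets \<mu>" by measurable
  note [measurable] = majorant_measurable[OF f]
  have pt: "(\<Sum>i=1..n. sq (slab i) f y * indicator (W i) y) \<le>
      2 * (p y)\<^sup>2 * ennreal a + ennreal e * (\<Sum>i\<le>n. (majorant n i f y)\<^sup>2)" if y: "y \<in> F" for y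
  proof -
    have "(\<Sum>i=1..n. sq (slab i) f y * indicator (W i) y) \<le>
        (\<Sum>i=1..n. 2 * (p y)\<^sup>2 * (sq (slab i) b y + ennreal (2 * cone_mass * K_point\<^sup>2) * (majorant n i b y)\<^sup>2) +
          ennreal e * (majorant n i f y)\<^sup>2)"
    proof (rule sum_mono)
      fix i assume i: "i \<in> {1..n}"
      show "sq (slab i) f y * indicator (W i) y \<le>
          2 * (p y)\<^sup>2 * (sq (slab i) b y + ennreal (2 * cone_mass * K_point\<^sup>2) * (majorant n i b y)\<^sup>2) +
          ennreal e * (majorant n i f y)\<^sup>2"
        unfolding e_def
        using slab_estimate[OF f b _ W[OF y] _ c acc[OF y], of i n "p y"] i F y
        by (auto simp: indicator_def p_def Mx_def)
    qed
    also have "\<dots> = 2 * (p y)\<^sup>2 * ((\<Sum>i=1..n. sq (slab i) b y) +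
        ennreal (2 * cone_mass * K_point\<^sup>2) * (\<Sum>i=1..n. (majorant n i b y)\<^sup>2)) +
        ennreal e * (\<Sum>i=1..n. (majorant n i f y)\<^sup>2)"
      by (simp add: sum.distrib sum_distrib_left distrib_left)
    also have "\<dots> \<le> 2 * (p y)\<^sup>2 * (ennreal l + ennreal (2 * cone_mass * K_point\<^sup>2) * ennreal l') +
        ennreal e * (\<Sum>i\<le>n. (majorant n i f y)\<^sup>2)"
    proof -
      have "(\<Sum>i=1..n. (majorant n i f y)\<^sup>2) \<le> (\<Sum>i\<le>n. (majorant n i f y)\<^sup>2)" for f
        by (intro sum_mono2) auto
      then show ?thesis using sb[OF y] Nb[OF y]
        by (intro add_mono mult_left_mono) (auto intro: order_trans)
    qed
    also have "ennreal l + ennreal (2 * cone_mass * K_point\<^sup>2) * ennreal l' = ennreal a"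
      unfolding a_def using l cone_mass_nonneg by (simp add: ennreal_mult)
    finally show ?thesis .
  qed
  have m1: "(\<lambda>y. (p y)\<^sup>2) \<in> borel_measurable \<mu>" using pm by measurable
  have m2: "(\<lambda>y. (majorant n i f y)\<^sup>2 * indicator (B - H) y) \<in> borel_measurable \<mu>" for i by measurable
  have "(\<integral>\<^sup>+ y\<in>F. (\<Sum>i=1..n. sq (slab i) f y * indicator (W i) y) \<partial>\<mu>) \<le>
      (\<integral>\<^sup>+ y. (2 * ennreal a) * (p y)\<^sup>2 + ennreal e * (\<Sum>i\<le>n. (majorant n i f y)\<^sup>2 * indicator (B - H) y) \<partial>\<mu>)"
    using pt F by (intro nn_integral_mono) (auto simp: indicator_def mult_ac)
  also have "\<dots> = (2 * ennreal a) * (\<integral>\<^sup>+ y. (p y)\<^sup>2 \<partial>\<mu>) +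
      ennreal e * (\<Sum>i\<le>n. \<integral>\<^sup>+ y\<in>B - H. (majorant n i f y)\<^sup>2 \<partial>\<mu>)"
  proof -
    have m3: "(\<lambda>y. \<Sum>i\<le>n. (majorant n i f y)\<^sup>2 * indicator (B - H) y) \<in> borel_measurable \<mu>"
      using m2 by (rule borel_measurable_sum)
    have m4: "(\<lambda>y. 2 * ennreal a * (p y)\<^sup>2) \<in> borel_measurable \<mu>"
      using m1 by (rule borel_measurable_times_ennreal[OF borel_measurable_const])
    have m5: "(\<lambda>y. ennreal e * (\<Sum>i\<le>n. (majorant n i f y)\<^sup>2 * indicator (B - H) y)) \<in> borel_measurable \<mu>"
      using m3 by (rule borel_measurable_times_ennreal[OF borel_measurable_const])
    show ?thesis
      unfolding nn_integral_add[OF m4 m5] nn_integral_cmult[OF m1] nn_integral_cmult[OF m3]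
      by (subst nn_integral_sum[OF m2]) simp
  qed
  also have "\<dots> \<le> (2 * ennreal a) * (ennreal (4 / c\<^sup>2) * ?I) + ennreal e * (ennreal K_energy * ?I)"
  proof (intro add_mono mult_left_mono majorant_energy f)
    have "(\<integral>\<^sup>+ y. (p y)\<^sup>2 \<partial>\<mu>) = (\<integral>\<^sup>+ y. ennreal ((Mx y)\<^sup>2 / c\<^sup>2) \<partial>\<mu>)"
      unfolding p_def using nn c by (simp add: ennreal_power power_divide)
    also have "\<dots> = ennreal ((LINT y|\<mu>. (Mx y)\<^sup>2) / c\<^sup>2)"
      using Mx unfolding square_integrable_def by (subst nn_integral_eq_integral) auto
    also have "\<dots> \<le> ennreal (4 * (LINT y|\<mu>. (cmod (f y))\<^sup>2) / c\<^sup>2)"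
      using doob_avg_max[OF square_integrable_norm[OF f], of n] unfolding Mx_def
      by (intro ennreal_leI divide_right_mono) auto
    also have "\<dots> = ennreal (4 / c\<^sup>2) * ?I"
      unfolding nn_square_integrable[OF f] by (simp add: ennreal_mult[symmetric])
    finally show "(\<integral>\<^sup>+ y. (p y)\<^sup>2 \<partial>\<mu>) \<le> ennreal (4 / c\<^sup>2) * ?I" .
  qed auto
  also have "\<dots> = ennreal (K_paraproduct c l l') * ?I"
  proof -
    have "K_paraproduct c l l' = 2 * a * (4 / c\<^sup>2) + e * K_energy" unfolding K_paraproduct_def a_def e_def by simp
    moreover have "ennreal (2 * a * (4 / c\<^sup>2) + e * K_energy) = 2 * ennreal a * ennreal (4 / c\<^sup>2) + ennreal e * ennreal K_energy"
      using a e K_energy_nonneg by (simp add: ennreal_mult del: times_divide_eq_right)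
    ultimately show ?thesis by (simp only: distrib_right mult.assoc)
  qed
  finally show ?thesis .
qed

end

section \<open>Geometry of the random cubes\<close>

text \<open>An infinite bounded set would accumulate, and two of its points near the limit would be closer
  than \<open>r\<close>.\<close>

lemma finite_separated_Int_bounded:
  fixes X :: "'a::heine_borel set"
  assumes "separated r X" "r > 0" "bounded C"
  shows "finite (X \<inter> C)"
proof (rule ccontr)
  assume inf: "infinite (X \<inter> C)"
  have "compact (closure C)" using assms(3) by simp
  then obtain p where "p islimpt (X \<inter> C)"
    using inf closure_subset[of C] unfolding compact_eq_Bolzano_Weierstrass by (meson inf_le2 order_trans)
  then have "infinite (X \<inter> C \<inter> ball p (r / 2))"
    using \<open>r > 0\<close> unfolding islimpt_eq_infinite_ball by simp
  then obtain u v where uv: "u \<in> X \<inter> C \<inter> ball p (r / 2)" "v \<in> X \<inter> C \<inter> ball p (r / 2)" "u \<noteq> v"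
    by (metis finite.emptyI finite_insert finite_subset insertI1 subsetI)
  then have "dist u v < r"
    using dist_triangle_half_r[of p u r v] by (auto simp: dist_commute)
  then show False using uv assms(1) unfolding separated_def by fastforce
qed

locale euclidean_dyadic_family = random_dyadic_family E y0 rB k0 \<gamma> L M Cbad \<eta> r0 X z Q
  for E :: "(real^'n) set" and y0 rB k0 \<gamma> L M Cbad \<eta> r0 X z Q +
  assumes rB: "rB > 0"
begin

abbreviation (input) side :: "int \<Rightarrow> real" where "side k \<equiv> \<delta>\<^sub>D powi k"

lemma side_pos: "side k > 0" unfolding dyadic_ratio_def by simp

lemma side_le: "k \<le> l \<Longrightarrow> side l \<le> side k"
  unfolding dyadic_ratio_def by (intro power_int_decreasing) auto

lemma side_Suc: "k < l \<Longrightarrow> 1000 * side l \<le> side k"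
proof -
  assume "k < l"
  then have "side l \<le> side (k + 1)" by (intro side_le) simp
  also have "side (k + 1) = side k / 1000"
    by (subst power_int_add) (auto simp: dyadic_ratio_def)
  finally show ?thesis by simp
qed

lemma side_shift: "side (k0 + int j) = side k0 / 1000 ^ j"
  by (subst power_int_add) (auto simp: dyadic_ratio_def power_one_over)

lemma separated_X: "separated (side k) (X k)"
proof (cases "k = 0 \<or> k > 0")
  case True
  then show ?thesis
    using X_0(2) X_finer(2)[of "k - 1"] unfolding maximal_separated_in_def by auto
next
  case False
  then show ?thesis using X_coarser(1)[of "k + 1"] unfolding maximal_separated_in_def by simp
qed

lemma y0_X: "y0 \<in> X k"
proof (cases "k \<ge> 0")
  case True
  then show ?thesis
    by (induction k rule: int_ge_induct) (use X_0 X_finer(1) in auto)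
next
  case False
  then show ?thesis using X_coarser(2)[of "k + 1"] by simp
qed

lemma countable_X: "countable (X k)"
proof -
  have "X k = (\<Union>i::nat. X k \<inter> ball 0 (real i))"
    by (auto simp: reals_Archimedean2)
  moreover have "countable (\<Union>i::nat. X k \<inter> ball 0 (real i))"
    by (intro countable_UN[OF countableI_type] countable_finite finite_separated_Int_bounded[OF separated_X side_pos bounded_ball])
  ultimately show ?thesis by simp
qed

lemma reference_point_in_cube: "\<omega> \<in> parameter_space L M \<Longrightarrow> x \<in> X k \<Longrightarrow> x \<in> Q \<omega> k x"
proof -
  assume a: "\<omega> \<in> parameter_space L M" "x \<in> X k"
  have "x \<in> E"
  proof (cases "k \<le> 0")
    case True
    then have "X k \<subseteq> E"
    proof (induction k rule: int_le_induct)
      case base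
      then show ?case using X_0 unfolding maximal_separated_in_def by auto
    next
      case (step i)
      then show ?case using X_coarser(1)[of i] unfolding maximal_separated_in_def by auto
    qed
    then show ?thesis using a by auto
  next
    case False
    then show ?thesis using X_finer(2)[of "k - 1"] a unfolding maximal_separated_in_def by auto
  qed
  then show ?thesis using ball_x[OF a] side_pos[of k] unfolding ball_in_def by auto
qed

text \<open>The reference point of the cube of generation \<open>k\<close> that contains \<open>y\<close>; unspecified for \<open>y\<close>
  outside \<open>E\<close>.\<close>

definition index :: "parameter \<Rightarrow> int \<Rightarrow> real^'n \<Rightarrow> real^'n" where
  "index \<omega> k y = (SOME x. x \<in> X k \<and> y \<in> Q \<omega> k x)"

abbreviation cube_at :: "parameter \<Rightarrow> int \<Rightarrow> real^'n \<Rightarrow> (real^'n) set" where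
  "cube_at \<omega> k y \<equiv> Q \<omega> k (index \<omega> k y)"

abbreviation top_cube :: "parameter \<Rightarrow> (real^'n) set" where
  "top_cube \<omega> \<equiv> Q \<omega> k0 y0"

context
  fixes \<omega> assumes \<omega>: "\<omega> \<in> parameter_space L M"
begin

lemma index:
  assumes "y \<in> E" shows "index \<omega> k y \<in> X k" "y \<in> cube_at \<omega> k y"
proof -
  have "\<exists>x. x \<in> X k \<and> y \<in> Q \<omega> k x" using cover[OF \<omega>, of k] assms by auto
  then show "index \<omega> k y \<in> X k" "y \<in> cube_at \<omega> k y"
    unfolding index_def by (metis (mono_tags, lifting) someI_ex)+
qed

lemma cube_unique:
  "x \<in> X k \<Longrightarrow> x' \<in> X k \<Longrightarrow> y \<in> Q \<omega> k x \<Longrightarrow> y \<in> Q \<omega> k x' \<Longrightarrow> x = x'"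
  using disjoint[OF \<omega>, of k] unfolding disjoint_family_on_def by blast

lemma index_unique: "x \<in> X k \<Longrightarrow> y \<in> Q \<omega> k x \<Longrightarrow> index \<omega> k y = x"
  using cube_unique index[of y k] Q_subset[OF \<omega>] by blast

lemma in_lattice: "x \<in> X k \<Longrightarrow> (k, Q \<omega> k x) \<in> lattice X Q \<omega>"
  unfolding lattice_def by auto

text \<open>The nesting property alone leaves open that a cube of finer generation contains a coarser one.
  If it were not contained in the coarser cube, it would contain two cubes of the coarser
  generation, and hence two reference points that are farther apart than its diameter.\<close>

lemma finer_cube_subset:
  assumes "k \<le> l" "x \<in> X k" "x' \<in> X l" and y: "y \<in> Q \<omega> l x'" "y \<in> Q \<omega> k x"
  shows "Q \<omega> l x' \<subseteq> Q \<omega> k x"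
proof (cases "k = l")
  case True
  then show ?thesis using cube_unique[of x k x' y] assms by auto
next
  case False
  then have kl: "1000 * side l \<le> side k" using side_Suc assms(1) by simp
  show ?thesis
  proof
    fix p assume p: "p \<in> Q \<omega> l x'"
    then have pE: "p \<in> E" using Q_subset[OF \<omega> assms(3)] by auto
    let ?x = "index \<omega> k p"
    show "p \<in> Q \<omega> k x"
    proof (rule ccontr)
      assume np: "p \<notin> Q \<omega> k x"
      have x: "?x \<in> X k" "p \<in> Q \<omega> k ?x" using index[OF pE] by auto
      then have ne: "?x \<noteq> x" using np by auto
      have d: "Q \<omega> k ?x \<inter> Q \<omega> k x = {}" using cube_unique x(1) assms(2) ne by blast
      have "Q \<omega> k x \<subseteq> Q \<omega> l x'"
        using nested[OF \<omega> in_lattice[OF assms(2)] in_lattice[OF assms(3)]] y p np by auto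
      moreover have "Q \<omega> k ?x \<subseteq> Q \<omega> l x'"
        using nested[OF \<omega> in_lattice[OF x(1)] in_lattice[OF assms(3)]] x y p d by auto
      ultimately have "x \<in> Q \<omega> l x'" "?x \<in> Q \<omega> l x'"
        using reference_point_in_cube[OF \<omega>] x(1) assms(2) by auto
      then have "x \<in> ball x' (8 * side l)" "?x \<in> ball x' (8 * side l)"
        using ball_x[OF \<omega> assms(3)] unfolding ball_in_def by auto
      then have "dist ?x x < 16 * side l"
        using dist_triangle2[of ?x x x'] by (auto simp: dist_commute)
      moreover have "side k \<le> dist ?x x"
        using separated_X[of k] x(1) assms(2) ne unfolding separated_def by auto
      ultimately show False using kl side_pos[of l] by simp
    qed
  qed
qed

lemma ball_subset_top: "cball_in E y0 rB \<subseteq> top_cube \<omega>"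
  using ball_x[OF \<omega> y0_X, of k0] k0(1) unfolding cball_in_def ball_in_def by auto

text \<open>The complement of the top cube is one cell, at every level, so that the cells partition the
  whole space. It is a null set.\<close>

definition part :: "nat \<Rightarrow> real^'n \<Rightarrow> (real^'n) set" where
  "part j y = (if y \<in> top_cube \<omega> then cube_at \<omega> (k0 + int j) y else - top_cube \<omega>)"

lemma top_E: "top_cube \<omega> \<subseteq> E" using Q_subset[OF \<omega> y0_X] .

lemma part_subset_top:
  assumes "y \<in> top_cube \<omega>" shows "part j y \<subseteq> top_cube \<omega>"
proof -
  have "y \<in> E" using assms top_E by auto
  then show ?thesis
    using assms finer_cube_subset[OF _ y0_X index(1) index(2) assms, of "k0 + int j"]
    unfolding part_def by simp
qed

lemma part_mem: "y \<in> part j y"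
  unfolding part_def using index[of y] top_E by auto

lemma part_eq: assumes "y' \<in> part j y" shows "part j y' = part j y"
proof (cases "y \<in> top_cube \<omega>")
  case True
  then have "y' \<in> top_cube \<omega>" using part_subset_top assms by auto
  moreover have "index \<omega> (k0 + int j) y' = index \<omega> (k0 + int j) y"
    using assms True top_E index(1)[of y] unfolding part_def by (intro index_unique) auto
  ultimately show ?thesis using True unfolding part_def by simp
next
  case False then show ?thesis using assms unfolding part_def by auto
qed

lemma part_borel: "part j y \<in> sets borel"
  unfolding part_def using index[of y "k0 + int j"] top_E Q_borel[OF \<omega>] y0_X by auto

lemma part_finite: "finite (range (part j))"
proof -
  let ?k = "k0 + int j"
  have "bounded (top_cube \<omega>)"
    using ball_x[OF \<omega> y0_X, of k0] bounded_subset[OF bounded_ball] unfolding ball_in_def by blast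
  then have fin: "finite (X ?k \<inter> top_cube \<omega>)"
    by (rule finite_separated_Int_bounded[OF separated_X side_pos])
  have "range (part j) \<subseteq> insert (- top_cube \<omega>) (Q \<omega> ?k ` (X ?k \<inter> top_cube \<omega>))"
  proof
    fix R assume "R \<in> range (part j)"
    then obtain y where R: "R = part j y" by auto
    show "R \<in> insert (- top_cube \<omega>) (Q \<omega> ?k ` (X ?k \<inter> top_cube \<omega>))"
    proof (cases "y \<in> top_cube \<omega>")
      case True
      then have i: "index \<omega> ?k y \<in> X ?k" using index(1) top_E by auto
      then have "index \<omega> ?k y \<in> part j y" using reference_point_in_cube[OF \<omega>] True unfolding part_def by auto
      then have "index \<omega> ?k y \<in> top_cube \<omega>" using part_subset_top[OF True] by auto
      then show ?thesis using i True unfolding R part_def by auto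
    qed (simp add: R part_def)
  qed
  then show ?thesis using fin finite_subset by blast
qed

lemma part_Suc: "part (Suc j) y \<subseteq> part j y"
proof (cases "y \<in> top_cube \<omega>")
  case True
  then have "y \<in> E" using top_E by auto
  then show ?thesis
    using True finer_cube_subset[OF _ index(1)[of y "k0 + int j"] index(1)[of y "k0 + int (Suc j)"]
      index(2) index(2)] unfolding part_def by simp
qed (simp add: part_def)

lemma part_diam:
  assumes "y \<in> cball_in E y0 rB" "y' \<in> part j y"
  shows "y' \<in> E \<and> dist y y' \<le> 16 * (side k0 / 1000 ^ j)"
proof -
  let ?k = "k0 + int j"
  have t: "y \<in> top_cube \<omega>" using assms(1) ball_subset_top by auto
  then have yE: "y \<in> E" using top_E by auto
  let ?x = "index \<omega> ?k y"
  have "y' \<in> Q \<omega> ?k ?x" "y \<in> Q \<omega> ?k ?x" using assms(2) t index(2)[OF yE] unfolding part_def by auto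
  then have b: "y' \<in> ball_in E ?x (8 * side ?k)" "y \<in> ball_in E ?x (8 * side ?k)"
    using ball_x[OF \<omega> index(1)[OF yE]] by auto
  then have "dist y y' \<le> 16 * side ?k"
    using dist_triangle2[of y y' ?x] unfolding ball_in_def by (auto simp: dist_commute)
  then show ?thesis using b side_shift[of j] unfolding ball_in_def by auto
qed

lemma part_top: "y \<in> cball_in E y0 rB \<Longrightarrow> cball_in E y0 rB \<subseteq> part 0 y"
  unfolding part_def using ball_subset_top index_unique[OF y0_X, of y k0] by auto

lemma lattice_of_ball_part:
  assumes "y \<in> top_cube \<omega>"
  shows "(k0 + int j, part j y) \<in> lattice_of_ball X Q k0 y0 \<omega>"
  using assms part_subset_top[OF assms, of j] in_lattice[OF index(1), of y "k0 + int j"] top_E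
  unfolding lattice_of_ball_def part_def by auto

lemma nonaccretive_union_borel:
  "(\<Union>R\<in>maximal_cubes (nonaccretive_cubes \<mu> b c (lattice_of_ball X Q k0 y0 \<omega>)). snd R) \<in> sets borel"
proof -
  let ?N = "maximal_cubes (nonaccretive_cubes \<mu> b c (lattice_of_ball X Q k0 y0 \<omega>))"
  have "lattice X Q \<omega> = (\<Union>k. (\<lambda>x. (k, Q \<omega> k x)) ` X k)"
    unfolding lattice_def by auto
  then have "countable (lattice X Q \<omega>)"
    using countable_X by simp
  moreover have N: "?N \<subseteq> lattice X Q \<omega>"
    unfolding maximal_cubes_def nonaccretive_cubes_def lattice_of_ball_def by auto
  ultimately have "countable ?N" by (rule countable_subset[rotated])
  moreover have "snd R \<in> sets borel" if "R \<in> ?N" for R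
    using that N Q_borel[OF \<omega>] unfolding lattice_def by auto
  ultimately show ?thesis by (intro sets.countable_UN'') auto
qed

text \<open>Among the nonaccretive cubes that contain \<open>y\<close>, one of smallest generation is maximal.\<close>

lemma accretive_outside:
  assumes y: "y \<in> top_cube \<omega>"
    and out: "y \<notin> (\<Union>R\<in>maximal_cubes (nonaccretive_cubes \<mu> b c (lattice_of_ball X Q k0 y0 \<omega>)). snd R)"
  shows "c * measure \<mu> (part j y) \<le> cmod (LINT y:part j y|\<mu>. b y)"
proof (rule ccontr)
  let ?D = "nonaccretive_cubes \<mu> b c (lattice_of_ball X Q k0 y0 \<omega>)"
  assume "\<not> ?thesis"
  then have R0: "(k0 + int j, part j y) \<in> ?D"
    using lattice_of_ball_part[OF y] unfolding nonaccretive_cubes_def by auto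
  have D: "\<exists>x\<in>X (fst R). snd R = Q \<omega> (fst R) x" "fst R \<ge> k0" if "R \<in> ?D" for R
    using that unfolding nonaccretive_cubes_def lattice_of_ball_def lattice_def by auto
  define C where "C = {R \<in> ?D. y \<in> snd R}"
  have "(k0 + int j, part j y) \<in> C" unfolding C_def using R0 part_mem by simp
  then obtain R where R: "R \<in> C" "\<And>R'. R' \<in> C \<Longrightarrow> nat (fst R - k0) \<le> nat (fst R' - k0)"
    using ex_has_least_nat[of "\<lambda>R. R \<in> C" _ "\<lambda>R. nat (fst R - k0)"] by blast
  have "R \<in> maximal_cubes ?D"
    unfolding maximal_cubes_def
  proof (intro CollectI conjI ballI impI)
    show "R \<in> ?D" using R unfolding C_def by auto
    fix R' assume R': "R' \<in> ?D" "snd R \<subseteq> snd R' \<and> fst R' \<le> fst R"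
    then have C': "R' \<in> C" using R unfolding C_def by auto
    have "fst R' = fst R" using R(2)[OF C'] R' D(2)[OF R'(1)] D(2)[of R] R(1) unfolding C_def by auto
    moreover obtain x where x: "x \<in> X (fst R)" "snd R = Q \<omega> (fst R) x"
      using D(1)[of R] R(1) unfolding C_def by auto
    moreover obtain x' where x': "x' \<in> X (fst R')" "snd R' = Q \<omega> (fst R') x'"
      using D(1)[of R'] C' unfolding C_def by auto
    moreover have "y \<in> snd R" "y \<in> snd R'" using R(1) C' unfolding C_def by auto
    ultimately have "x = x'" using cube_unique[of x "fst R" x' y] by auto
    then show "R' = R" using x x' \<open>fst R' = fst R\<close> by (simp add: prod_eq_iff)
  qed
  then show False using out R(1) unfolding C_def by auto
qed

end

text \<open>The cube \<open>R\<close> meets the cell of \<open>y\<close>, so goodness can only be due to the distance of \<open>R\<close> to the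
  complement of that cell.\<close>

lemma good_cube_distance:
  assumes \<omega>: "\<omega> \<in> parameter_space L M" and y: "y \<in> R" "y \<in> top_cube \<omega>"
    and good: "good_cube E \<gamma> r (lattice_of_ball X Q k0 y0 \<omega>) (k0 + int i, R)"
    and j: "Suc j + r \<le> i" and u: "u \<in> E - part \<omega> (Suc j) y"
  shows "(side k0 / 1000 ^ i) powr \<gamma> * (side k0 / 1000 ^ Suc j) powr (1 - \<gamma>) \<le> dist y u"
proof -
  let ?Q = "(k0 + int (Suc j), part \<omega> (Suc j) y)"
  let ?\<rho> = "side (k0 + int i) powr \<gamma> * side (k0 + int (Suc j)) powr (1 - \<gamma>)"
  have p: "?\<rho> > 0" using side_pos[of "k0 + int i"] side_pos[of "k0 + int (Suc j)"]
    by (intro mult_pos_pos) (metis less_irrefl powr_gt_zero)+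
  have "\<delta>\<^sub>D powi (- int r) * side (k0 + int i) = side (k0 + int i - int r)"
    by (subst power_int_add[symmetric]) (auto simp: dyadic_ratio_def)
  also have "\<dots> \<le> side (k0 + int (Suc j))" using j by (intro side_le) auto
  finally have "side_length ?Q \<ge> \<delta>\<^sub>D powi (- int r) * side_length (k0 + int i, R)"
    unfolding side_length_def by simp
  then have "ereal ?\<rho> \<le> max (set_distance R (part \<omega> (Suc j) y)) (set_distance R (E - part \<omega> (Suc j) y))"
    using good lattice_of_ball_part[OF \<omega> y(2), of "Suc j"] unfolding good_cube_def side_length_def by fastforce
  moreover have "set_distance R (part \<omega> (Suc j) y) \<le> 0"
    unfolding set_distance_def using y(1) part_mem[OF \<omega>, of y "Suc j"]
    by (intro INF_lower2[of y] INF_lower2[of y]) auto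
  ultimately have "ereal ?\<rho> \<le> set_distance R (E - part \<omega> (Suc j) y)"
    using p by (auto simp: max_def split: if_splits) (meson ereal_less(2) leD order_trans)
  also have "\<dots> \<le> ereal (dist y u)"
    unfolding set_distance_def using y(1) u by (intro INF_lower2[of y] INF_lower2[of u]) auto
  finally show ?thesis unfolding side_shift by simp
qed

end

section \<open>Averaging over the lattices\<close>

text \<open>The hypotheses of the theorem, with the growth condition restated at points outside \<open>H\<close> and
  the norm of \<open>b\<close> as an almost everywhere bound.\<close>

locale local_Tb =
  kernel_measure E m \<alpha> \<beta> K1 K2 C0 rB S y0 \<mu> H +
  euclidean_dyadic_family E y0 rB k0 \<gamma> L M Cbad \<eta> r0 X z Q
  for E :: "(real^'n) set" and m \<alpha> \<beta> K1 K2 C0 rB S y0 \<mu> H k0 \<gamma> L M Cbad \<eta> r0 X z Q +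
  fixes b :: "real^'n \<Rightarrow> complex" and bnorm c s \<delta>0 C1 :: real
  assumes \<gamma>: "0 < \<gamma>" "\<gamma> < 1" and M: "M \<ge> 1" and Cbad: "Cbad > 0" and \<eta>: "\<eta> > 0"
    and b_measurable: "b \<in> borel_measurable \<mu>" and b_bound: "AE x in \<mu>. cmod (b x) \<le> bnorm"
    and bnorm: "bnorm \<ge> 0" and c: "c > 0" and s: "s > 0" and \<delta>0: "0 < \<delta>0" "\<delta>0 < 1" and C1: "C1 > 0"
    and exceptional: "\<And>\<omega>. \<omega> \<in> parameter_space L M \<Longrightarrow>
      measure \<mu> ((\<Union>R\<in>maximal_cubes (nonaccretive_cubes \<mu> b c (lattice_of_ball X Q k0 y0 \<omega>)). snd R) \<union> H)
        \<le> \<delta>0 * measure \<mu> (cball_in E y0 rB)"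
    and weak_type: "\<And>t. t > 0 \<Longrightarrow> ennreal (t powr s) *
      emeasure \<mu> {y \<in> cball_in E y0 rB - H. C_op E \<alpha> S \<mu> b y > ennreal t} \<le> ennreal C1 * emeasure \<mu> (cball_in E y0 rB)"
begin

text \<open>The measure \<open>(1 - \<delta>0) \<mu>(B) = 6 \<kappa> \<mu>(B)\<close> that the hypotheses leave is spent in portions of
  \<open>\<kappa> \<mu>(B)\<close>: two on the points where the square function or the majorant of \<open>b\<close> is large, one on
  the points that few lattices keep, and one in the passage to the limit. This leaves
  \<open>2 \<kappa> \<mu>(B) = (1 - \<delta>0) / 3 * \<mu>(B)\<close>.\<close>

definition \<kappa> :: real where "\<kappa> = (1 - \<delta>0) / 6"

lemma \<kappa>_pos: "\<kappa> > 0" unfolding \<kappa>_def using \<delta>0 by simp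

definition \<theta> :: real where
  "\<theta> = max ((1 / 1000) powr \<beta>) ((1 / 1000) powr ((1 - \<gamma>) * (\<alpha> / 2)))"

text \<open>So large that the bad probability is at most \<open>\<kappa> / 2\<close>, half of the probability with which the
  points of the final set are kept; this is what makes absorption possible.\<close>

definition depth :: nat where
  "depth = (SOME r. r \<ge> 1 \<and> r \<ge> r0 \<and> Cbad * \<delta>\<^sub>D powr (\<gamma> * real r * \<eta>) \<le> \<kappa> / 2)"

lemma depth: "depth \<ge> 1" "depth \<ge> r0" "Cbad * \<delta>\<^sub>D powr (\<gamma> * real depth * \<eta>) \<le> \<kappa> / 2"
proof -
  define q where "q = \<delta>\<^sub>D powr (\<gamma> * \<eta>)"
  have q: "0 < q" "q < 1"
    unfolding q_def dyadic_ratio_def using \<gamma> \<eta> powr_less_mono'[of "1/1000" 0 "\<gamma> * \<eta>"] by auto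
  have p: "\<delta>\<^sub>D powr (\<gamma> * real r * \<eta>) = q ^ r" for r
    unfolding q_def by (simp add: powr_realpow[symmetric] powr_powr powr_power mult_ac dyadic_ratio_def)
  obtain N where N: "q ^ N < \<kappa> / 2 / Cbad"
    using real_arch_pow_inv[of "\<kappa> / 2 / Cbad" q] q \<kappa>_pos Cbad by auto
  define r where "r = max N (max 1 r0)"
  have "q ^ r \<le> q ^ N" unfolding r_def using q by (intro power_decreasing) auto
  then have "Cbad * q ^ r \<le> Cbad * (\<kappa> / 2 / Cbad)" using N Cbad by (intro mult_left_mono) auto
  then have "Cbad * q ^ r \<le> \<kappa> / 2" using Cbad by simp
  then have "\<exists>r. r \<ge> 1 \<and> r \<ge> r0 \<and> Cbad * \<delta>\<^sub>D powr (\<gamma> * real r * \<eta>) \<le> \<kappa> / 2"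
    unfolding p by (intro exI[of _ r]) (auto simp: r_def)
  from someI_ex[OF this]
  show "depth \<ge> 1" "depth \<ge> r0" "Cbad * \<delta>\<^sub>D powr (\<gamma> * real depth * \<eta>) \<le> \<kappa> / 2"
    unfolding depth_def by auto
qed

abbreviation (input) t0 :: real where "t0 \<equiv> \<delta>\<^sub>D powi k0"
abbreviation (input) t :: "nat \<Rightarrow> real" where "t i \<equiv> t0 / 1000 ^ i"

lemma lattice_kernel_part:
  assumes "\<omega> \<in> parameter_space L M"
  shows "lattice_kernel E m \<alpha> \<beta> K1 K2 C0 rB S y0 \<mu> H (part \<omega>) t0 \<theta> \<gamma>"
proof (intro lattice_kernel.intro)
  show "kernel_measure E m \<alpha> \<beta> K1 K2 C0 rB S y0 \<mu> H" by unfold_locales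
  show "nested_partitions \<mu> (part \<omega>)"
    using part_mem[OF assms] part_eq[OF assms] part_borel[OF assms] part_finite[OF assms] part_Suc[OF assms]
    by unfold_locales (auto simp: space_\<mu> sets_\<mu>)
  have "(1 / 1000) powr x < (1::real)" if "x > 0" for x :: real
    using powr_less_mono'[of "1/1000" 0 x] that by simp
  then have "0 < \<theta>" "\<theta> < 1" unfolding \<theta>_def using \<beta> \<alpha> \<gamma> by (auto simp: less_max_iff_disj)
  then show "lattice_kernel_axioms E \<alpha> \<beta> rB y0 (part \<omega>) t0 \<theta> \<gamma>"
    using part_diam[OF assms] part_top[OF assms] side_pos[of k0] \<gamma>
    by unfold_locales (auto simp: \<theta>_def)
qed

text \<open>The levels beyond which, by the weak type hypothesis and by Chebyshev's inequality, the
  square function and the squared majorants of \<open>b\<close> occupy at most \<open>\<kappa> \<mu>(B)\<close> each. Adding 1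
  in the second one makes it positive even if \<open>b\<close> vanishes.\<close>

definition square_level :: real where "square_level = (C1 / \<kappa>) powr (1 / s)"

definition majorant_level :: real where
  "majorant_level = (lattice_kernel.K_energy m \<alpha> C0 \<theta> * bnorm\<^sup>2 + 1) / \<kappa>"

definition K_lattice :: real where
  "K_lattice = lattice_kernel.K_paraproduct TYPE('n) m \<alpha> \<beta> K1 K2 C0 \<theta> depth c (square_level\<^sup>2) majorant_level"

lemma b_square_integrable: "square_integrable \<mu> b"
  unfolding square_integrable_def
proof
  show "integrable \<mu> (\<lambda>x. (cmod (b x))\<^sup>2)"
    using b_bound b_measurable
    by (intro integrable_const_bound[of _ "bnorm\<^sup>2"]) (auto elim!: eventually_mono intro: power_mono)
qed (rule b_measurable)

lemma b_energy: "energy b \<le> ennreal (bnorm\<^sup>2 * measure \<mu> B)"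
proof -
  have Bm: "B \<in> sets \<mu>" by measurable
  have "AE x in \<mu>. (ennreal (cmod (b x)))\<^sup>2 \<le> ennreal (bnorm\<^sup>2) * indicator B x"
    using b_bound AE_ball
  proof eventually_elim
    case (elim x)
    then have "(cmod (b x))\<^sup>2 \<le> bnorm\<^sup>2" by (intro power_mono) auto
    then show ?case using elim by (auto simp: ennreal_power intro!: ennreal_leI)
  qed
  then have "energy b \<le> (\<integral>\<^sup>+ x. ennreal (bnorm\<^sup>2) * indicator B x \<partial>\<mu>)"
    by (rule nn_integral_mono_AE)
  also have "\<dots> = ennreal (bnorm\<^sup>2) * emeasure \<mu> B" by (rule nn_integral_cmult_indicator[OF Bm])
  finally show ?thesis by (simp add: emeasure_eq_measure ennreal_mult)
qed

text \<open>The outcome for one lattice: on a large set \<open>F\<close> the square function is bounded on \<open>L\<^sup>2\<close>, as long as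
  generation \<open>i\<close> is only counted at points of good cubes. The sets \<open>W i\<close> are arbitrary because the
  cubes \<open>R\<close> belong to another, fixed lattice.\<close>

definition controls :: "nat \<Rightarrow> parameter \<Rightarrow> (real^'n) set \<Rightarrow> bool" where
  "controls n \<omega> F \<longleftrightarrow> F \<in> sets \<mu> \<and> F \<subseteq> B - H \<and> 4 * \<kappa> * measure \<mu> B \<le> measure \<mu> F \<and>
    (\<forall>f W. square_integrable \<mu> f \<longrightarrow>
      (\<forall>i y. y \<in> W i \<longrightarrow> (\<exists>R. y \<in> R \<and>
        good_cube E \<gamma> depth (lattice_of_ball X Q k0 y0 \<omega>) (k0 + int i, R))) \<longrightarrow>
      (\<integral>\<^sup>+ y\<in>F. (\<Sum>i=1..n. sq {t i..<1000 * t i} f y * indicator (W i) y) \<partial>\<mu>) \<le>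
        ennreal K_lattice * energy f)"

text \<open>Discarded are the points of \<open>H\<close> and of nonaccretive cubes, the points where the square function or
  the majorant of \<open>b\<close> is large, and the null cells, on which the accretivity condition says nothing.\<close>

lemma good_points:
  assumes \<omega>: "\<omega> \<in> parameter_space L M"
  shows "\<exists>F. controls n \<omega> F"
proof -
  interpret LK: lattice_kernel E m \<alpha> \<beta> K1 K2 C0 rB S y0 \<mu> H "part \<omega>" t0 \<theta> \<gamma> depth
    by (rule lattice_kernel_part[OF \<omega>])
  let ?T = "\<Union>R\<in>maximal_cubes (nonaccretive_cubes \<mu> b c (lattice_of_ball X Q k0 y0 \<omega>)). snd R"
  note bs = b_square_integrable
  note [measurable] = LK.majorant_measurable[OF bs] b_measurable
  define N where "N y = (\<Sum>i\<le>n. (LK.majorant n i b y)\<^sup>2)" for y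
  have N [measurable]: "N \<in> borel_measurable \<mu>" unfolding N_def by measurable
  define Bad1 where "Bad1 = {y \<in> B - H. C_op E \<alpha> S \<mu> b y > ennreal square_level}"
  define Bad2 where "Bad2 = {y \<in> B - H. N y > ennreal majorant_level}"
  define Z where "Z = (\<Union>i\<in>{..n}. \<Union>R\<in>{R \<in> range (part \<omega> i). measure \<mu> R = 0}. R)"
  define F where "F = B - H - ?T - Bad1 - Bad2 - Z"
  have square_level: "square_level > 0" unfolding square_level_def using C1 \<kappa>_pos by simp
  have K_energy: "LK.K_energy \<ge> 0" by (rule LK.K_energy_nonneg)
  have majorant_level: "majorant_level > 0" unfolding majorant_level_def using K_energy \<kappa>_pos by (simp add: add_nonneg_pos)
  have BH: "B - H \<in> sets \<mu>" by measurable
  have T: "?T \<in> sets \<mu>" unfolding sets_\<mu> by (rule nonaccretive_union_borel[OF \<omega>])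
  have Bad1_eq: "Bad1 = {y \<in> space \<mu>. sq UNIV b y > ennreal (square_level\<^sup>2)} \<inter> (B - H)"
    unfolding Bad1_def C_op_eq space_\<mu> using ennsqrt_le_iff[of square_level] square_level by (auto simp: not_le[symmetric])
  have Bad1: "Bad1 \<in> sets \<mu>" unfolding Bad1_eq using BH by measurable
  have "Bad2 = {y \<in> space \<mu>. N y > ennreal majorant_level} \<inter> (B - H)"
    unfolding Bad2_def space_\<mu> by auto
  moreover have "{y \<in> space \<mu>. N y > ennreal majorant_level} \<in> sets \<mu>" by measurable
  ultimately have Bad2: "Bad2 \<in> sets \<mu>" using BH by simp
  have Z: "Z \<in> null_sets \<mu>"
    unfolding Z_def using part_finite[OF \<omega>] part_borel[OF \<omega>]
    by (intro null_sets_UN' countable_finite) (auto simp: null_sets_def sets_\<mu> emeasure_eq_measure)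
  have Fm: "F \<in> sets \<mu>" unfolding F_def using BH T Bad1 Bad2 Z by auto
  have m1: "measure \<mu> Bad1 \<le> \<kappa> * measure \<mu> B"
  proof -
    have "square_level powr s = C1 / \<kappa>" unfolding square_level_def using s C1 \<kappa>_pos by (simp add: powr_powr)
    moreover have "ennreal (square_level powr s * measure \<mu> Bad1) \<le> ennreal (C1 * measure \<mu> B)"
      using weak_type[OF square_level] C1 unfolding Bad1_def by (simp add: emeasure_eq_measure ennreal_mult)
    ultimately have "C1 / \<kappa> * measure \<mu> Bad1 \<le> C1 * measure \<mu> B" using C1 by simp
    then show ?thesis using C1 \<kappa>_pos by (simp add: field_simps)
  qed
  have m2: "measure \<mu> Bad2 \<le> \<kappa> * measure \<mu> B"
  proof -
    have "ennreal majorant_level * emeasure \<mu> Bad2 = (\<integral>\<^sup>+ y. ennreal majorant_level * indicator Bad2 y \<partial>\<mu>)"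
      using Bad2 by (rule nn_integral_cmult_indicator[symmetric])
    also have "\<dots> \<le> (\<integral>\<^sup>+ y. (\<Sum>i\<le>n. (LK.majorant n i b y)\<^sup>2 * indicator (B - H) y) \<partial>\<mu>)"
      unfolding Bad2_def N_def by (intro nn_integral_mono) (auto simp: indicator_def)
    also have "\<dots> = (\<Sum>i\<le>n. \<integral>\<^sup>+ y\<in>B - H. (LK.majorant n i b y)\<^sup>2 \<partial>\<mu>)"
    proof (rule nn_integral_sum)
      fix i
      show "(\<lambda>y. (LK.majorant n i b y)\<^sup>2 * indicator (B - H) y) \<in> borel_measurable \<mu>"
        using BH LK.majorant_measurable[OF bs] by measurable
    qed
    also have "\<dots> \<le> ennreal LK.K_energy * energy b"
      by (rule LK.majorant_energy[OF bs])
    also have "\<dots> \<le> ennreal LK.K_energy * ennreal (bnorm\<^sup>2 * measure \<mu> B)"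
      by (intro mult_left_mono b_energy) auto
    finally have "ennreal (majorant_level * measure \<mu> Bad2) \<le> ennreal (LK.K_energy * bnorm\<^sup>2 * measure \<mu> B)"
      using K_energy majorant_level by (simp add: emeasure_eq_measure ennreal_mult mult.assoc)
    then have "majorant_level * measure \<mu> Bad2 \<le> LK.K_energy * bnorm\<^sup>2 * measure \<mu> B"
      using K_energy by (subst (asm) ennreal_le_iff) auto
    also have "\<dots> \<le> (LK.K_energy * bnorm\<^sup>2 + 1) * measure \<mu> B" by (intro mult_right_mono) auto
    also have "\<dots> = majorant_level * (\<kappa> * measure \<mu> B)" unfolding majorant_level_def using \<kappa>_pos by simp
    finally show ?thesis using majorant_level by simp
  qed
  have big: "4 * \<kappa> * measure \<mu> B \<le> measure \<mu> F"
  proof -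
    have "B \<subseteq> F \<union> ((?T \<union> H) \<union> (Bad1 \<union> (Bad2 \<union> Z)))" unfolding F_def by auto
    then have "measure \<mu> B \<le> measure \<mu> (F \<union> ((?T \<union> H) \<union> (Bad1 \<union> (Bad2 \<union> Z))))"
      using Fm T Bad1 Bad2 Z by (intro finite_measure_mono) (auto simp: sets_\<mu>)
    also have "\<dots> \<le> measure \<mu> F + (measure \<mu> (?T \<union> H) + (measure \<mu> Bad1 + (measure \<mu> Bad2 + measure \<mu> Z)))"
      using Fm T Bad1 Bad2 Z
      by (intro order_trans[OF measure_Un_le] add_mono order_refl) (auto simp: sets_\<mu>)
    also have "\<dots> \<le> measure \<mu> F + (\<delta>0 * measure \<mu> B + (\<kappa> * measure \<mu> B + (\<kappa> * measure \<mu> B + 0)))"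
      using exceptional[OF \<omega>] m1 m2 Z by (intro add_mono order_refl) (auto simp: measure_eq_0_null_sets)
    also have "\<dots> = measure \<mu> F + measure \<mu> B - 4 * \<kappa> * measure \<mu> B"
      unfolding \<kappa>_def by (simp add: field_simps)
    finally show ?thesis by simp
  qed
  have FB: "F \<subseteq> B - H" unfolding F_def by auto
  have est: "(\<integral>\<^sup>+ y\<in>F. (\<Sum>i=1..n. sq {t i..<1000 * t i} f y * indicator (W i) y) \<partial>\<mu>) \<le>
        ennreal K_lattice * energy f"
    if fs: "square_integrable \<mu> f"
      and W: "\<And>i y. y \<in> W i \<Longrightarrow> \<exists>R. y \<in> R \<and>
        good_cube E \<gamma> depth (lattice_of_ball X Q k0 y0 \<omega>) (k0 + int i, R)" for f W
  proof -
    have top: "y \<in> top_cube \<omega>" if "y \<in> F" for y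
      using that FB ball_subset_top[OF \<omega>] by auto
    have "(\<integral>\<^sup>+ y\<in>F. (\<Sum>i=1..n. sq (LK.slab i) f y * indicator (W i) y) \<partial>\<mu>) \<le>
        ennreal K_lattice * energy f"
      unfolding K_lattice_def
    proof (rule LK.good_part_estimate[OF fs bs c _ _ FB Fm])
      show "0 \<le> square_level\<^sup>2" "0 \<le> majorant_level" using majorant_level by auto
      fix y assume y: "y \<in> F"
      show "c \<le> cmod (LK.avg i b y)" if "i \<le> n" for i
      proof -
        have "y \<notin> ?T" using y unfolding F_def by auto
        from accretive_outside[OF \<omega> top[OF y] this, of i]
        have a: "c * measure \<mu> (part \<omega> i y) \<le> cmod (LINT x:part \<omega> i y|\<mu>. b x)" .
        have "measure \<mu> (part \<omega> i y) \<noteq> 0"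
        proof
          assume "measure \<mu> (part \<omega> i y) = 0"
          then have "y \<in> Z" unfolding Z_def using that part_mem[OF \<omega>, of y i] by auto
          then show False using y unfolding F_def by auto
        qed
        then have "measure \<mu> (part \<omega> i y) > 0" by (simp add: zero_less_measure_iff)
        then show ?thesis using a unfolding LK.avg_def by (simp add: field_simps)
      qed
      have "y \<notin> Bad1" "y \<notin> Bad2" "y \<in> B - H" using y unfolding F_def by auto
      then have 1: "sq UNIV b y \<le> ennreal (square_level\<^sup>2)" and 2: "N y \<le> ennreal majorant_level"
        unfolding Bad1_eq Bad2_def by (auto simp: space_\<mu> not_less)
      show "(\<Sum>i\<le>n. (LK.majorant n i b y)\<^sup>2) \<le> ennreal majorant_level" using 2 unfolding N_def .
      show "(\<Sum>i=1..n. sq (LK.slab i) b y) \<le> ennreal (square_level\<^sup>2)"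
        unfolding LK.scale_def sum_slabs[OF b_measurable side_pos]
        using 1 sq_mono_set[of _ UNIV] by (auto intro: order_trans)
      show "LK.well_inside i y" if yW: "y \<in> W i" "i \<le> n" for i
        unfolding LK.well_inside_def LK.scale_def
      proof (intro allI impI ballI)
        fix j u assume j: "Suc j + depth \<le> i" and u: "u \<in> E - part \<omega> (Suc j) y"
        obtain R where "y \<in> R" "good_cube E \<gamma> depth (lattice_of_ball X Q k0 y0 \<omega>) (k0 + int i, R)"
          using W[OF yW(1)] by blast
        from good_cube_distance[OF \<omega> this(1) top[OF y] this(2) j u]
        show "(t0 / 1000 ^ i) powr \<gamma> * (t0 / 1000 ^ Suc j) powr (1 - \<gamma>) \<le> dist y u" .
      qed
    qed
    then show ?thesis unfolding LK.scale_def .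
  qed
  show ?thesis
    unfolding controls_def by (intro exI[of _ F] conjI Fm FB big allI impI, rule est) simp_all
qed

text \<open>An arbitrary fixed lattice; its cubes are the ones that are tested for goodness.\<close>

definition \<omega>0 :: parameter where "\<omega>0 = (\<lambda>_. (0, 1))"

lemma \<omega>0: "\<omega>0 \<in> parameter_space L M"
  unfolding \<omega>0_def parameter_space_def alphabet_def using M by auto

lemma K_lattice_nonneg: "K_lattice \<ge> 0"
proof -
  interpret LK: lattice_kernel E m \<alpha> \<beta> K1 K2 C0 rB S y0 \<mu> H "part \<omega>0" t0 \<theta> \<gamma> depth
    by (rule lattice_kernel_part[OF \<omega>0])
  have "majorant_level \<ge> 0" unfolding majorant_level_def using LK.K_energy_nonneg \<kappa>_pos by simp
  then show ?thesis
    unfolding K_lattice_def LK.K_paraproduct_def using LK.K_energy_nonneg cone_mass_nonneg by simp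
qed

lemma resampled_support:
  "finite (set_pmf (resampled L M k0 k1 \<omega>0))" "set_pmf (resampled L M k0 k1 \<omega>0) \<subseteq> parameter_space L M"
proof -
  have a: "finite (alphabet L M)" "alphabet L M \<noteq> {}" unfolding alphabet_def using M by auto
  have s: "set_pmf (resampled L M k0 k1 \<omega>0) = (\<lambda>\<tau> j. if j \<in> {k0..k1} then \<tau> j else \<omega>0 j) `
      PiE_dflt {k0..k1} undefined (\<lambda>_. alphabet L M)"
    unfolding resampled_def using a by (simp add: set_Pi_pmf comp_def)
  show "finite (set_pmf (resampled L M k0 k1 \<omega>0))"
    unfolding s using a by (intro finite_imageI finite_PiE_dflt) auto
  show "set_pmf (resampled L M k0 k1 \<omega>0) \<subseteq> parameter_space L M"
    unfolding s using \<omega>0 by (auto simp: parameter_space_def PiE_dflt_def)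
qed

definition good_region :: "parameter \<Rightarrow> nat \<Rightarrow> (real^'n) set" where
  "good_region \<omega> i = {y \<in> E. good_cube E \<gamma> depth (lattice_of_ball X Q k0 y0 \<omega>)
     (k0 + int i, cube_at \<omega>0 (k0 + int i) y)}"

lemma good_region_borel: "good_region \<omega> i \<in> sets borel"
proof -
  let ?k = "k0 + int i" and ?D = "lattice_of_ball X Q k0 y0 \<omega>"
  have "good_region \<omega> i = (\<Union>x\<in>{x \<in> X ?k. good_cube E \<gamma> depth ?D (?k, Q \<omega>0 ?k x)}. Q \<omega>0 ?k x)"
  proof
    show "good_region \<omega> i \<subseteq> (\<Union>x\<in>{x \<in> X ?k. good_cube E \<gamma> depth ?D (?k, Q \<omega>0 ?k x)}. Q \<omega>0 ?k x)"
      unfolding good_region_def using index[OF \<omega>0] by blast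
    show "(\<Union>x\<in>{x \<in> X ?k. good_cube E \<gamma> depth ?D (?k, Q \<omega>0 ?k x)}. Q \<omega>0 ?k x) \<subseteq> good_region \<omega> i"
    proof
      fix y assume "y \<in> (\<Union>x\<in>{x \<in> X ?k. good_cube E \<gamma> depth ?D (?k, Q \<omega>0 ?k x)}. Q \<omega>0 ?k x)"
      then obtain x where x: "x \<in> X ?k" "good_cube E \<gamma> depth ?D (?k, Q \<omega>0 ?k x)" "y \<in> Q \<omega>0 ?k x" by blast
      then have "y \<in> E" using Q_subset[OF \<omega>0 x(1)] by blast
      then show "y \<in> good_region \<omega> i"
        unfolding good_region_def using x(2) index_unique[OF \<omega>0 x(1,3)] by simp
    qed
  qed
  also have "\<dots> \<in> sets borel"
    using countable_X[of ?k] Q_borel[OF \<omega>0]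
    by (intro sets.countable_UN'' countable_subset[OF _ countable_X[of ?k]]) auto
  finally show ?thesis .
qed

text \<open>The points of one cube of the fixed lattice are good or bad together, and so the hypothesis on
  the probability of bad cubes applies to each point.\<close>

lemma bad_probability:
  assumes "depth \<le> n" "i \<le> n" "y \<in> E"
  defines "p \<equiv> resampled L M k0 (k0 + int n) \<omega>0"
  shows "(\<Sum>\<omega>\<in>set_pmf p. pmf p \<omega> * indicator (- good_region \<omega> i) y) \<le> \<kappa> / 2"
proof -
  let ?R = "(k0 + int i, cube_at \<omega>0 (k0 + int i) y)"
  let ?A = "{\<omega>. \<not> good_cube E \<gamma> depth (lattice_of_ball X Q k0 y0 \<omega>) ?R}"
  have fin: "finite (set_pmf p)" unfolding p_def by (rule resampled_support(1))
  have "(\<Sum>\<omega>\<in>set_pmf p. pmf p \<omega> * indicator (- good_region \<omega> i) y) =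
      (\<Sum>\<omega>\<in>set_pmf p. if \<omega> \<in> ?A then pmf p \<omega> else 0)"
    using assms(3) by (intro sum.cong) (auto simp: good_region_def indicator_def)
  also have "\<dots> = (\<Sum>\<omega>\<in>?A \<inter> set_pmf p. pmf p \<omega>)"
    using fin by (subst sum.inter_restrict[symmetric]) (auto simp: Int_commute)
  also have "\<dots> = measure_pmf.prob p (?A \<inter> set_pmf p)"
    using fin by (intro measure_measure_pmf_finite[symmetric]) auto
  also have "\<dots> = measure_pmf.prob p ?A" by (rule measure_Int_set_pmf)
  also have "\<dots> \<le> Cbad * \<delta>\<^sub>D powr (\<gamma> * real depth * \<eta>)"
    unfolding p_def
  proof (rule bad_prob[OF depth(1,2) \<omega>0])
    show "k0 + int depth \<le> k0 + int n" using assms by simp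
    show "?R \<in> lattice X Q \<omega>0" by (rule in_lattice[OF \<omega>0 index(1)[OF \<omega>0 assms(3)]])
    show "side (k0 + int n) \<le> side_length ?R"
      unfolding side_length_def using assms by (simp add: side_le)
  qed
  also have "\<dots> \<le> \<kappa> / 2" by (rule depth(3))
  finally show ?thesis .
qed

lemma slab_energy_finite:
  assumes f: "integrable \<mu> f" and G: "G \<in> sets \<mu>"
  shows "(\<integral>\<^sup>+ y\<in>G. (\<Sum>i=1..n. sq {t i..<1000 * t i} f y) \<partial>\<mu>) < \<top>"
proof -
  let ?a = "\<lambda>i. ennreal (2 * cone_mass * (K1 * t i powr - m)\<^sup>2) * (\<integral>\<^sup>+ z. ennreal (cmod (f z)) \<partial>\<mu>)\<^sup>2"
  have I: "(\<integral>\<^sup>+ z. ennreal (cmod (f z)) \<partial>\<mu>) < \<top>"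
    using f by (simp add: integrable_iff_bounded)
  have a: "?a i < \<top>" for i
    using I by (simp add: ennreal_mult_less_top power_less_top_ennreal)
  have "(\<integral>\<^sup>+ y\<in>G. (\<Sum>i=1..n. sq {t i..<1000 * t i} f y) \<partial>\<mu>) \<le> (\<integral>\<^sup>+ y. (\<Sum>i=1..n. ?a i) * indicator G y \<partial>\<mu>)"
    using side_pos[of k0] f by (intro nn_integral_mono mult_right_mono sum_mono sq_slab_crude) auto
  also have "\<dots> = (\<Sum>i=1..n. ?a i) * emeasure \<mu> G" using G by (rule nn_integral_cmult_indicator)
  also have "\<dots> < \<top>"
    using a by (intro ennreal_mult_less_top[THEN iffD2]) (auto simp: emeasure_eq_measure ennreal_sum_less_top)
  finally show ?thesis .
qed

text \<open>Let \<open>g y\<close> be the probability that \<open>y\<close> is kept, and \<open>G\<close> the set where it is at least \<open>\<kappa>\<close>. For the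
  truncated square function, with integral \<open>x\<close> over \<open>G\<close>, the product \<open>\<kappa> * x\<close> is at most the
  expectation of its integral over the kept points. The good part of this expectation is
  controlled by \<open>good_points\<close>. The bad part is at most \<open>\<kappa> / 2 * x\<close>, because the square function
  does not depend on the random lattice.\<close>

lemma good_set:
  assumes n: "depth \<le> n"
  shows "\<exists>G. G \<in> sets \<mu> \<and> G \<subseteq> B - H \<and> 3 * \<kappa> * measure \<mu> B \<le> measure \<mu> G \<and>
    (\<forall>f. square_integrable \<mu> f \<longrightarrow>
      (\<integral>\<^sup>+ y\<in>G. sq {t n..<t0} f y \<partial>\<mu>) \<le> ennreal (2 * K_lattice / \<kappa>) * energy f)"
proof -
  define p where "p = resampled L M k0 (k0 + int n) \<omega>0"
  let ?\<Omega> = "set_pmf p"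
  have fin: "finite ?\<Omega>" and sub: "?\<Omega> \<subseteq> parameter_space L M"
    unfolding p_def by (rule resampled_support)+
  have "\<exists>F. controls n \<omega> F" if "\<omega> \<in> ?\<Omega>" for \<omega>
    using that sub by (intro good_points) auto
  then obtain F where F: "\<And>\<omega>. \<omega> \<in> ?\<Omega> \<Longrightarrow> controls n \<omega> (F \<omega>)" by metis
  then have Fm: "\<And>\<omega>. \<omega> \<in> ?\<Omega> \<Longrightarrow> F \<omega> \<in> sets \<mu>" and FB: "\<And>\<omega>. \<omega> \<in> ?\<Omega> \<Longrightarrow> F \<omega> \<subseteq> B - H"
    and Fbig: "\<And>\<omega>. \<omega> \<in> ?\<Omega> \<Longrightarrow> 4 * \<kappa> * measure \<mu> B \<le> measure \<mu> (F \<omega>)"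
    unfolding controls_def by blast+
  have w1: "(\<Sum>\<omega>\<in>?\<Omega>. pmf p \<omega>) = 1" using fin by (intro sum_pmf_eq_1) auto
  define g where "g y = (\<Sum>\<omega>\<in>?\<Omega>. pmf p \<omega> * indicator (F \<omega>) y)" for y
  have gm [measurable]: "g \<in> borel_measurable \<mu>"
    unfolding g_def using Fm by (intro borel_measurable_sum borel_measurable_times) auto
  have g1: "g y \<le> 1" for y
    unfolding w1[symmetric] g_def by (intro sum_mono) (auto simp: indicator_def)
  have BH [measurable]: "B - H \<in> sets \<mu>" and Bm [measurable]: "B \<in> sets \<mu>" by measurable
  define G where "G = {y \<in> B - H. \<kappa> \<le> g y}"
  have "G = {y \<in> space \<mu>. \<kappa> \<le> g y} \<inter> (B - H)" unfolding G_def space_\<mu> by auto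
  moreover have "{y \<in> space \<mu>. \<kappa> \<le> g y} \<in> sets \<mu>" by measurable
  ultimately have Gm: "G \<in> sets \<mu>" using BH by simp
  have GB: "G \<subseteq> B - H" unfolding G_def by auto
  have big: "3 * \<kappa> * measure \<mu> B \<le> measure \<mu> G"
  proof -
    have "4 * \<kappa> * measure \<mu> B = (\<Sum>\<omega>\<in>?\<Omega>. pmf p \<omega> * (4 * \<kappa> * measure \<mu> B))"
      unfolding sum_distrib_right[symmetric] w1 by simp
    also have "\<dots> \<le> (\<Sum>\<omega>\<in>?\<Omega>. pmf p \<omega> * measure \<mu> (F \<omega>))"
      using Fbig by (intro sum_mono mult_left_mono) auto
    also have "\<dots> = (LINT y|\<mu>. g y)"
      unfolding g_def using Fm
      by (subst Bochner_Integration.integral_sum) (auto simp: emeasure_eq_measure space_\<mu>)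
    also have "\<dots> \<le> (LINT y|\<mu>. indicator G y + \<kappa> * indicator B y)"
    proof (rule integral_mono)
      show "integrable \<mu> g"
        unfolding g_def using Fm by (intro Bochner_Integration.integrable_sum) (auto simp: emeasure_eq_measure)
      show "integrable \<mu> (\<lambda>y. indicator G y + \<kappa> * indicator B y)"
        using Gm Bm by (auto simp: emeasure_eq_measure)
      fix y
      have "g y = 0" if "y \<notin> B - H"
        unfolding g_def using that FB by (intro sum.neutral) (auto simp: indicator_def)
      then show "g y \<le> indicator G y + \<kappa> * indicator B y"
        using g1[of y] \<kappa>_pos unfolding G_def by (cases "y \<in> B - H") (auto simp: indicator_def)
    qed
    also have "\<dots> = measure \<mu> G + \<kappa> * measure \<mu> B"
      using Gm Bm by (simp add: emeasure_eq_measure space_\<mu>)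
    finally show ?thesis by simp
  qed
  have est: "(\<integral>\<^sup>+ y\<in>G. sq {t n..<t0} f y \<partial>\<mu>) \<le> ennreal (2 * K_lattice / \<kappa>) * energy f"
    if fs: "square_integrable \<mu> f" for f
  proof -
    have f: "f \<in> borel_measurable \<mu>" "integrable \<mu> (\<lambda>x. (cmod (f x))\<^sup>2)"
      using fs unfolding square_integrable_def by auto
    define J where "J i = sq {t i..<1000 * t i} f" for i
    have Jm [measurable]: "J i \<in> borel_measurable \<mu>" for i unfolding J_def using f(1) by measurable
    define x where "x = (\<integral>\<^sup>+ y\<in>G. (\<Sum>i=1..n. J i y) \<partial>\<mu>)"
    have xfin: "x < \<top>" unfolding x_def J_def
      by (rule slab_energy_finite[OF integrable_of_square_integrable Gm]) (rule fs)
    let ?w = "\<lambda>\<omega>. ennreal (pmf p \<omega>)"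
    have Wm: "good_region \<omega> i \<in> sets \<mu>" for \<omega> i using good_region_borel sets_\<mu> by simp
    define a where "a \<omega> y = (\<Sum>i=1..n. J i y * indicator (good_region \<omega> i) y) * indicator (F \<omega>) y" for \<omega> y
    define d where "d \<omega> y = (\<Sum>i=1..n. J i y * indicator (- good_region \<omega> i) y) * indicator G y" for \<omega> y
    have am: "a \<omega> \<in> borel_measurable \<mu>" if "\<omega> \<in> ?\<Omega>" for \<omega>
      unfolding a_def using Wm[of \<omega>] Fm[OF that] by measurable
    have dm: "d \<omega> \<in> borel_measurable \<mu>" for \<omega>
      unfolding d_def using Wm[of \<omega>] Gm by measurable
    have Sm: "(\<lambda>y. (\<Sum>i=1..n. J i y) * indicator G y) \<in> borel_measurable \<mu>" using Gm by measurable
    have "ennreal \<kappa> * x = (\<integral>\<^sup>+ y. ennreal \<kappa> * ((\<Sum>i=1..n. J i y) * indicator G y) \<partial>\<mu>)"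
      unfolding x_def by (rule nn_integral_cmult[symmetric, OF Sm])
    also have "\<dots> \<le> (\<integral>\<^sup>+ y. (\<Sum>\<omega>\<in>?\<Omega>. ?w \<omega> * (a \<omega> y + d \<omega> y)) \<partial>\<mu>)"
    proof (rule nn_integral_mono)
      fix y
      show "ennreal \<kappa> * ((\<Sum>i=1..n. J i y) * indicator G y) \<le> (\<Sum>\<omega>\<in>?\<Omega>. ?w \<omega> * (a \<omega> y + d \<omega> y))"
      proof (cases "y \<in> G")
        case True
        then have "ennreal \<kappa> \<le> ennreal (g y)" unfolding G_def by (auto intro: ennreal_leI)
        also have "\<dots> = (\<Sum>\<omega>\<in>?\<Omega>. ?w \<omega> * indicator (F \<omega>) y)"
          unfolding g_def by (subst sum_ennreal[symmetric]) (auto simp: ennreal_mult ennreal_indicator)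
        finally have "ennreal \<kappa> * (\<Sum>i=1..n. J i y) \<le> (\<Sum>\<omega>\<in>?\<Omega>. ?w \<omega> * indicator (F \<omega>) y) * (\<Sum>i=1..n. J i y)"
          by (rule mult_right_mono) simp
        also have "\<dots> = (\<Sum>\<omega>\<in>?\<Omega>. ?w \<omega> * (indicator (F \<omega>) y * (\<Sum>i=1..n. J i y)))"
          by (simp add: sum_distrib_right mult.assoc)
        also have "\<dots> \<le> (\<Sum>\<omega>\<in>?\<Omega>. ?w \<omega> * (a \<omega> y + d \<omega> y))"
        proof (intro sum_mono mult_left_mono)
          fix \<omega>
          have "(\<Sum>i=1..n. J i y) = (\<Sum>i=1..n. J i y * indicator (good_region \<omega> i) y) +
              (\<Sum>i=1..n. J i y * indicator (- good_region \<omega> i) y)"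
            unfolding sum.distrib[symmetric] by (intro sum.cong) (auto simp: indicator_def)
          then show "indicator (F \<omega>) y * (\<Sum>i=1..n. J i y) \<le> a \<omega> y + d \<omega> y"
            using True unfolding a_def d_def by (auto simp: indicator_def)
        qed simp
        finally show ?thesis using True by simp
      qed simp
    qed
    also have "\<dots> = (\<Sum>\<omega>\<in>?\<Omega>. ?w \<omega> * (\<integral>\<^sup>+ y. a \<omega> y \<partial>\<mu>)) + (\<integral>\<^sup>+ y. (\<Sum>\<omega>\<in>?\<Omega>. ?w \<omega> * d \<omega> y) \<partial>\<mu>)"
    proof -
      have 1: "(\<lambda>y. \<Sum>\<omega>\<in>?\<Omega>. ?w \<omega> * a \<omega> y) \<in> borel_measurable \<mu>"
        using am by (intro borel_measurable_sum borel_measurable_times_ennreal) auto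
      have 2: "(\<lambda>y. \<Sum>\<omega>\<in>?\<Omega>. ?w \<omega> * d \<omega> y) \<in> borel_measurable \<mu>"
        using dm by (intro borel_measurable_sum borel_measurable_times_ennreal) auto
      have "(\<integral>\<^sup>+ y. (\<Sum>\<omega>\<in>?\<Omega>. ?w \<omega> * a \<omega> y) \<partial>\<mu>) = (\<Sum>\<omega>\<in>?\<Omega>. ?w \<omega> * (\<integral>\<^sup>+ y. a \<omega> y \<partial>\<mu>))"
        using am by (subst nn_integral_sum) (auto simp: nn_integral_cmult intro!: borel_measurable_times_ennreal)
      then show ?thesis
        unfolding distrib_left sum.distrib by (subst nn_integral_add[OF 1 2]) simp
    qed
    also have "(\<Sum>\<omega>\<in>?\<Omega>. ?w \<omega> * (\<integral>\<^sup>+ y. a \<omega> y \<partial>\<mu>)) \<le> (\<Sum>\<omega>\<in>?\<Omega>. ?w \<omega> * (ennreal K_lattice * energy f))"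
    proof (intro sum_mono mult_left_mono)
      fix \<omega> assume "\<omega> \<in> ?\<Omega>"
      then have c: "controls n \<omega> (F \<omega>)" by (rule F)
      have "\<exists>R. y \<in> R \<and> good_cube E \<gamma> depth (lattice_of_ball X Q k0 y0 \<omega>) (k0 + int i, R)"
        if "y \<in> good_region \<omega> i" for i y
        using that unfolding good_region_def using index(2)[OF \<omega>0] by blast
      then show "(\<integral>\<^sup>+ y. a \<omega> y \<partial>\<mu>) \<le> ennreal K_lattice * energy f"
        unfolding a_def J_def using c fs unfolding controls_def by blast
    qed simp
    also have "(\<Sum>\<omega>\<in>?\<Omega>. ?w \<omega> * (ennreal K_lattice * energy f)) = ennreal K_lattice * energy f"
      unfolding sum_distrib_right[symmetric] using w1 by (simp add: sum_ennreal)
    also have "(\<integral>\<^sup>+ y. (\<Sum>\<omega>\<in>?\<Omega>. ?w \<omega> * d \<omega> y) \<partial>\<mu>) \<le> (\<integral>\<^sup>+ y. ennreal (\<kappa> / 2) * ((\<Sum>i=1..n. J i y) * indicator G y) \<partial>\<mu>)"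
    proof (rule nn_integral_mono)
      fix y
      show "(\<Sum>\<omega>\<in>?\<Omega>. ?w \<omega> * d \<omega> y) \<le> ennreal (\<kappa> / 2) * ((\<Sum>i=1..n. J i y) * indicator G y)"
      proof (cases "y \<in> G")
        case True
        then have yE: "y \<in> E" using GB B_subset by auto
        have "(\<Sum>\<omega>\<in>?\<Omega>. ?w \<omega> * d \<omega> y) = (\<Sum>i=1..n. J i y * (\<Sum>\<omega>\<in>?\<Omega>. ?w \<omega> * indicator (- good_region \<omega> i) y))"
          unfolding d_def indicator_simps(1)[OF True] mult_1_right sum_distrib_left
          by (subst sum.swap) (simp only: mult.left_commute)
        also have "\<dots> \<le> (\<Sum>i=1..n. J i y * ennreal (\<kappa> / 2))"
        proof (intro sum_mono mult_left_mono)
          fix i assume i: "i \<in> {1..n}"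
          have "(\<Sum>\<omega>\<in>?\<Omega>. ?w \<omega> * indicator (- good_region \<omega> i) y) =
              ennreal (\<Sum>\<omega>\<in>?\<Omega>. pmf p \<omega> * indicator (- good_region \<omega> i) y)"
            by (subst sum_ennreal[symmetric]) (auto simp: ennreal_mult ennreal_indicator)
          also have "\<dots> \<le> ennreal (\<kappa> / 2)"
            using bad_probability[OF n _ yE, of i] i unfolding p_def by (intro ennreal_leI) auto
          finally show "(\<Sum>\<omega>\<in>?\<Omega>. ?w \<omega> * indicator (- good_region \<omega> i) y) \<le> ennreal (\<kappa> / 2)" .
        qed simp
        also have "\<dots> = ennreal (\<kappa> / 2) * (\<Sum>i=1..n. J i y)"
          unfolding sum_distrib_right[symmetric] by (rule mult.commute)
        finally show ?thesis using True by simp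
      qed (simp add: d_def)
    qed
    also have "\<dots> = ennreal (\<kappa> / 2) * x"
      unfolding x_def by (rule nn_integral_cmult[OF Sm])
    finally have absorb: "ennreal \<kappa> * x \<le> ennreal K_lattice * energy f + ennreal (\<kappa> / 2) * x"
      by (simp add: add_mono)
    obtain I where I: "energy f = ennreal I" "I \<ge> 0"
      using f nn_integral_eq_integral[OF f(2)] by (simp add: ennreal_power)
    obtain x' where x': "x = ennreal x'" "x' \<ge> 0" using xfin by (cases x) auto
    \<comment> \<open>Subtracting \<open>\<kappa> / 2 * x\<close> is legitimate because \<open>x\<close> is finite.\<close>
    have "ennreal (\<kappa> * x') \<le> ennreal (K_lattice * I + \<kappa> / 2 * x')"
    proof -
      have "ennreal (\<kappa> * x') = ennreal \<kappa> * ennreal x'" using x'(2) \<kappa>_pos by (intro ennreal_mult) auto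
      moreover have "ennreal (K_lattice * I + \<kappa> / 2 * x') = ennreal K_lattice * ennreal I + ennreal (\<kappa> / 2) * ennreal x'"
        using I(2) x'(2) K_lattice_nonneg \<kappa>_pos by (simp only: ennreal_plus[OF mult_nonneg_nonneg mult_nonneg_nonneg] ennreal_mult divide_nonneg_nonneg order_less_imp_le zero_le_numeral)
      ultimately show ?thesis using absorb unfolding I(1) x'(1) by simp
    qed
    then have "\<kappa> * x' \<le> K_lattice * I + \<kappa> / 2 * x'"
      using I x' K_lattice_nonneg \<kappa>_pos by (subst (asm) ennreal_le_iff) (auto intro!: add_nonneg_nonneg)
    then have "x' \<le> 2 * K_lattice / \<kappa> * I" using \<kappa>_pos by (simp add: field_simps)
    then have "x \<le> ennreal (2 * K_lattice / \<kappa>) * energy f"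
      unfolding x' I(1) using I(2) K_lattice_nonneg \<kappa>_pos by (subst ennreal_mult[symmetric]) (auto intro!: ennreal_leI)
    then show ?thesis
      unfolding x_def J_def sum_slabs[OF f(1) side_pos] .
  qed
  show ?thesis by (intro exI[of _ G] conjI Gm GB big allI impI est)
qed

section \<open>The big piece\<close>

definition K_final :: real where "K_final = (2 * K_lattice / \<kappa> + K_large) / \<kappa>"

text \<open>The sets from \<open>good_set\<close> work for the square function truncated at height \<open>t n\<close> and depend on \<open>n\<close>.
  Their weak limit \<open>q\<close> works for the full square function, with weight \<open>q\<close>, and \<open>1 \<le> q / \<kappa>\<close> on the set
  \<open>G'\<close> where \<open>q\<close> is at least \<open>\<kappa>\<close>.\<close>

lemma big_piece:
  obtains G where "G \<in> sets borel" "G \<subseteq> B" "2 * \<kappa> * measure \<mu> B \<le> measure \<mu> G"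
    "\<And>f. square_integrable \<mu> f \<Longrightarrow> (\<integral>\<^sup>+ y\<in>G. sq UNIV f y \<partial>\<mu>) \<le> ennreal K_final * energy f"
proof -
  define I where "I = {f :: real^'n \<Rightarrow> complex. square_integrable \<mu> f}"
  define \<Phi> where "\<Phi> k G \<longleftrightarrow> G \<in> sets \<mu> \<and> G \<subseteq> B - H \<and> 3 * \<kappa> * measure \<mu> B \<le> measure \<mu> G \<and>
      (\<forall>f. square_integrable \<mu> f \<longrightarrow>
        (\<integral>\<^sup>+ y\<in>G. sq {t (depth + k)..<t0} f y \<partial>\<mu>) \<le> ennreal (2 * K_lattice / \<kappa>) * energy f)" for k G
  have "\<exists>G. \<Phi> k G" for k
    unfolding \<Phi>_def by (rule good_set) simp
  then obtain G where \<Phi>: "\<And>k. \<Phi> k (G k)" by metis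
  then have G: "G k \<in> sets \<mu>" "G k \<subseteq> B - H" "3 * \<kappa> * measure \<mu> B \<le> measure \<mu> (G k)" for k
    unfolding \<Phi>_def by blast+
  have est_G: "(\<integral>\<^sup>+ y\<in>G k. sq {t (depth + k)..<t0} f y \<partial>\<mu>) \<le> ennreal (2 * K_lattice / \<kappa>) * energy f"
    if "square_integrable \<mu> f" for k f
    using \<Phi>[of k] that unfolding \<Phi>_def by blast
  define h where "h f k = sq {t depth / 1000 ^ k..} f" for f k
  have te: "t depth / 1000 ^ k = t (depth + k)" for k by (simp add: power_add)
  have tp: "t i > 0" for i using side_pos[of k0] by simp
  have hm: "h f k \<in> borel_measurable \<mu>" if "f \<in> I" for f k
    using that unfolding h_def I_def by (intro sq_measurable) (auto dest: square_integrable_borel)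
  have hS: "h f k y \<le> h f (Suc k) y" if "f \<in> I" for f k y
    using that sq_SUP(2)[OF square_integrable_borel tp, of f depth k y] unfolding h_def I_def by simp
  have hK: "(\<integral>\<^sup>+ y\<in>G k. h f k y \<partial>\<mu>) \<le> ennreal (2 * K_lattice / \<kappa> + K_large) * energy f" if f: "f \<in> I" for f k
  proof -
    have fs: "square_integrable \<mu> f" using f unfolding I_def by simp
    note fm = square_integrable_borel[OF fs] and fi = integrable_of_square_integrable[OF fs]
    note Gk = G(1,2)[of k]
    have le: "t (depth + k) \<le> t0" using side_pos[of k0] by (simp add: field_simps)
    have "h f k y = sq {t (depth + k)..<t0} f y + sq {t0..} f y" for y
    proof -
      have "sq ({t (depth + k)..<t0} \<union> {t0..}) f y = sq {t (depth + k)..<t0} f y + sq {t0..} f y"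
        using fm by (intro sq_Un) auto
      moreover have "{t (depth + k)..<t0} \<union> {t0..} = {t (depth + k)..}" using le by auto
      ultimately show ?thesis unfolding h_def te by simp
    qed
    then have "(\<integral>\<^sup>+ y\<in>G k. h f k y \<partial>\<mu>) = (\<integral>\<^sup>+ y. sq {t (depth + k)..<t0} f y * indicator (G k) y +
        sq {t0..} f y * indicator (G k) y \<partial>\<mu>)"
      by (simp add: distrib_right)
    also have "\<dots> = (\<integral>\<^sup>+ y\<in>G k. sq {t (depth + k)..<t0} f y \<partial>\<mu>) + (\<integral>\<^sup>+ y\<in>G k. sq {t0..} f y \<partial>\<mu>)"
    proof (rule nn_integral_add)
      have "sq J f \<in> borel_measurable \<mu>" if "J \<in> sets borel" for J
        using fm that by (rule sq_measurable)
      then show "(\<lambda>y. sq {t (depth + k)..<t0} f y * indicator (G k) y) \<in> borel_measurable \<mu>"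
        "(\<lambda>y. sq {t0..} f y * indicator (G k) y) \<in> borel_measurable \<mu>"
        using Gk(1) by (auto intro!: borel_measurable_times_ennreal)
    qed
    also have "\<dots> \<le> ennreal (2 * K_lattice / \<kappa>) * energy f + ennreal K_large * energy f"
    proof (rule add_mono)
      show "(\<integral>\<^sup>+ y\<in>G k. sq {t (depth + k)..<t0} f y \<partial>\<mu>) \<le> ennreal (2 * K_lattice / \<kappa>) * energy f"
        by (rule est_G[OF fs])
      have "(\<integral>\<^sup>+ y\<in>G k. sq {t0..} f y \<partial>\<mu>) \<le> (\<integral>\<^sup>+ y\<in>B - H. sq {t0..} f y \<partial>\<mu>)"
        using Gk(2) by (intro nn_integral_mono mult_left_mono) (auto simp: indicator_def)
      also have "\<dots> \<le> ennreal K_large * energy f"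
        using k0(1) side_pos[of k0] by (intro large_scales_energy fm fi) auto
      finally show "(\<integral>\<^sup>+ y\<in>G k. sq {t0..} f y \<partial>\<mu>) \<le> ennreal K_large * energy f" .
    qed
    also have "\<dots> = ennreal (2 * K_lattice / \<kappa> + K_large) * energy f"
      using K_lattice_nonneg \<kappa>_pos K_large_nonneg by (simp add: distrib_right)
    finally show ?thesis .
  qed
  obtain q where q: "q \<in> borel_measurable \<mu>" "\<And>x. 0 \<le> q x" "\<And>x. q x \<le> 1"
      "3 * \<kappa> * measure \<mu> B \<le> (LINT x|\<mu>. q x)"
      "\<And>f. f \<in> I \<Longrightarrow> (\<integral>\<^sup>+ x. ennreal (q x) * (SUP n. h f n x) \<partial>\<mu>) \<le> ennreal (2 * K_lattice / \<kappa> + K_large) * energy f"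
    using weak_limit_of_sets[of \<mu> G "3 * \<kappa> * measure \<mu> B" I h
      "\<lambda>f. ennreal (2 * K_lattice / \<kappa> + K_large) * energy f", OF finite_\<mu> G(1) G(3) hm hS hK] by blast
  note [measurable] = q(1)
  define G' where "G' = {y \<in> B. \<kappa> \<le> q y}"
  have Bm [measurable]: "B \<in> sets \<mu>" by measurable
  have "G' = {y \<in> space \<mu>. \<kappa> \<le> q y} \<inter> B" unfolding G'_def space_\<mu> by auto
  moreover have "{y \<in> space \<mu>. \<kappa> \<le> q y} \<in> sets \<mu>" by measurable
  ultimately have G'm: "G' \<in> sets \<mu>" using Bm by simp
  have big: "2 * \<kappa> * measure \<mu> B \<le> measure \<mu> G'"
  proof -
    have "(LINT x|\<mu>. q x) \<le> (LINT y|\<mu>. indicator G' y + \<kappa> * indicator B y)"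
    proof (rule integral_mono_AE)
      show "integrable \<mu> q" using q by (intro integrable_const_bound[of _ 1]) auto
      show "integrable \<mu> (\<lambda>y. indicator G' y + \<kappa> * indicator B y)"
        using G'm Bm by (auto simp: emeasure_eq_measure)
      show "AE y in \<mu>. q y \<le> indicator G' y + \<kappa> * indicator B y"
        using AE_ball
      proof eventually_elim
        case (elim y)
        then show ?case using q(3)[of y] \<kappa>_pos unfolding G'_def by (auto simp: indicator_def)
      qed
    qed
    also have "\<dots> = measure \<mu> G' + \<kappa> * measure \<mu> B"
      using G'm Bm by (simp add: emeasure_eq_measure space_\<mu>)
    finally show ?thesis using q(4) by simp
  qed
  have est: "(\<integral>\<^sup>+ y\<in>G'. sq UNIV f y \<partial>\<mu>) \<le> ennreal K_final * energy f"
    if fs: "square_integrable \<mu> f" for f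
  proof -
    note fm = square_integrable_borel[OF fs]
    have f: "f \<in> I" using fs unfolding I_def by simp
    have sup: "(SUP n. h f n y) = sq UNIV f y" for y
      unfolding h_def using sq_SUP(1)[OF fm tp, of y depth] by simp
    have m: "(\<lambda>y. ennreal (q y) * sq UNIV f y) \<in> borel_measurable \<mu>"
      using sq_measurable[OF fm, of UNIV] q(1) by (intro borel_measurable_times_ennreal) auto
    have "(\<integral>\<^sup>+ y\<in>G'. sq UNIV f y \<partial>\<mu>) \<le> (\<integral>\<^sup>+ y. ennreal (1 / \<kappa>) * (ennreal (q y) * sq UNIV f y) \<partial>\<mu>)"
    proof (rule nn_integral_mono)
      fix y
      show "sq UNIV f y * indicator G' y \<le> ennreal (1 / \<kappa>) * (ennreal (q y) * sq UNIV f y)"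
      proof (cases "y \<in> G'")
        case True
        then have "1 \<le> 1 / \<kappa> * q y" unfolding G'_def using \<kappa>_pos by (simp add: field_simps)
        then have "ennreal 1 \<le> ennreal (1 / \<kappa> * q y)" by (rule ennreal_leI)
        then have "ennreal 1 * sq UNIV f y \<le> ennreal (1 / \<kappa> * q y) * sq UNIV f y" by (rule mult_right_mono) simp
        also have "ennreal (1 / \<kappa> * q y) = ennreal (1 / \<kappa>) * ennreal (q y)"
          using \<kappa>_pos q(2) by (intro ennreal_mult) auto
        finally show ?thesis using True by (simp add: mult.assoc)
      qed simp
    qed
    also have "\<dots> = ennreal (1 / \<kappa>) * (\<integral>\<^sup>+ y. ennreal (q y) * sq UNIV f y \<partial>\<mu>)"
      by (rule nn_integral_cmult[OF m])
    also have "\<dots> \<le> ennreal (1 / \<kappa>) * (ennreal (2 * K_lattice / \<kappa> + K_large) * energy f)"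
      using q(5)[OF f] unfolding sup by (intro mult_left_mono) auto
    also have "\<dots> = ennreal K_final * energy f"
    proof -
      have "2 * K_lattice / \<kappa> + K_large \<ge> 0" using K_lattice_nonneg \<kappa>_pos K_large_nonneg by simp
      then have "ennreal (1 / \<kappa>) * ennreal (2 * K_lattice / \<kappa> + K_large) = ennreal (1 / \<kappa> * (2 * K_lattice / \<kappa> + K_large))"
        using \<kappa>_pos by (intro ennreal_mult[symmetric]) auto
      then show ?thesis unfolding K_final_def by (simp add: mult.assoc[symmetric])
    qed
    finally show ?thesis .
  qed
  show thesis by (rule that[OF _ _ big est]) (use G'm in \<open>auto simp: sets_\<mu> G'_def\<close>)
qed

end

text \<open>The constant of \<open>big_piece\<close> is defined from the admissible parameters alone, so it can be chosen before
  the set, the kernel, the measure and the lattices.\<close>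

theorem theorem6p1:
  fixes m \<alpha> \<beta> K1 K2 bnorm c_acc s \<delta>0 C0 C1 Cbad \<eta> :: real
    and L M r0 :: nat
  assumes "m > 0" "0 < \<alpha>" "\<alpha> \<le> 1" "0 < \<beta>" "\<beta> \<le> 1" "K1 > 0" "K2 > 0"
    and "bnorm \<ge> 0" "c_acc > 0" "s > 0" "0 < \<delta>0" "\<delta>0 < 1" "C0 > 0" "C1 > 0"
    and "M \<ge> 1" "Cbad > 0" "0 < \<eta>" "\<eta> \<le> 1"
  shows "\<exists>C>0. \<forall>(E :: (real^'n) set) S y0 rB \<mu> k0 X z Q b H.
    closed E \<and> square_function_kernel E m \<alpha> \<beta> K1 K2 S \<and>
    y0 \<in> E \<and> rB > 0 \<and>
    finite_measure \<mu> \<and> sets \<mu> = sets borel \<and> measure_support \<mu> \<subseteq> cball_in E y0 rB \<and>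
    random_dyadic_family E y0 rB k0 (\<alpha> / (2 * (m + \<alpha>))) L M Cbad \<eta> r0 X z Q \<and>
    b \<in> borel_measurable \<mu> \<and> Linf_norm \<mu> b = ennreal bnorm \<and>
    H \<in> sets borel \<and>
    (\<forall>\<omega>\<in>parameter_space L M.
       measure \<mu>
         ((\<Union>R\<in>maximal_cubes (nonaccretive_cubes \<mu> b c_acc (lattice_of_ball X Q k0 y0 \<omega>)). snd R) \<union> H)
       \<le> \<delta>0 * measure \<mu> (cball_in E y0 rB)) \<and>
    (\<forall>y\<in>E. \<forall>r>0. measure \<mu> (cball_in E y r) \<ge> C0 * r powr m \<longrightarrow> cball_in E y r \<subseteq> H) \<and>
    (SUP t\<in>{0<..}. ennreal (t powr s) *
        emeasure \<mu> {y \<in> cball_in E y0 rB - H. C_op E \<alpha> S \<mu> b y > ennreal t})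
      \<le> ennreal C1 * emeasure \<mu> (cball_in E y0 rB)
    \<longrightarrow>
    (\<exists>G. G \<in> sets borel \<and> G \<subseteq> cball_in E y0 rB \<and>
       measure \<mu> G \<ge> (1 - \<delta>0) / 3 * measure \<mu> (cball_in E y0 rB) \<and>
       (\<forall>f. in_L2 \<mu> f \<longrightarrow>
          L2_norm \<mu> (\<lambda>y. indicator G y * C_op E \<alpha> S \<mu> f y)
            \<le> ennreal C * L2_norm \<mu> (\<lambda>y. ennreal (cmod (f y)))))"
proof -
  let ?\<gamma> = "\<alpha> / (2 * (m + \<alpha>))"
  define K where "K = local_Tb.K_final TYPE('n) m \<alpha> \<beta> K1 K2 C0 ?\<gamma> Cbad \<eta> r0 bnorm c_acc s \<delta>0 C1"
  define C where "C = max 1 (sqrt K)"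
  have C: "C > 0" "K \<le> C\<^sup>2"
  proof -
    show "C > 0" unfolding C_def by simp
    show "K \<le> C\<^sup>2"
    proof (cases "K \<ge> 0")
      case True
      then have "(sqrt K)\<^sup>2 \<le> C\<^sup>2" unfolding C_def by (intro power_mono) auto
      then show ?thesis using True by simp
    qed (use zero_le_power2[of C] in linarith)
  qed
  show ?thesis
  proof (intro exI[of _ C] conjI allI impI C(1), elim conjE)
    fix E :: "(real^'n) set" and S y0 rB \<mu> k0 X z Q b H
    assume E: "closed E" and S: "square_function_kernel E m \<alpha> \<beta> K1 K2 S" and y0: "y0 \<in> E" and rB: "rB > 0"
      and \<mu>: "finite_measure \<mu>" "sets \<mu> = sets borel" and supp: "measure_support \<mu> \<subseteq> cball_in E y0 rB"
      and D: "random_dyadic_family E y0 rB k0 ?\<gamma> L M Cbad \<eta> r0 X z Q"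
      and b: "b \<in> borel_measurable \<mu>" "Linf_norm \<mu> b = ennreal bnorm" and H: "H \<in> sets borel"
      and exc: "\<forall>\<omega>\<in>parameter_space L M.
       measure \<mu>
         ((\<Union>R\<in>maximal_cubes (nonaccretive_cubes \<mu> b c_acc (lattice_of_ball X Q k0 y0 \<omega>)). snd R) \<union> H)
       \<le> \<delta>0 * measure \<mu> (cball_in E y0 rB)"
      and gr: "\<forall>y\<in>E. \<forall>r>0. measure \<mu> (cball_in E y r) \<ge> C0 * r powr m \<longrightarrow> cball_in E y r \<subseteq> H"
      and wk: "(SUP t\<in>{0<..}. ennreal (t powr s) *
        emeasure \<mu> {y \<in> cball_in E y0 rB - H. C_op E \<alpha> S \<mu> b y > ennreal t})
      \<le> ennreal C1 * emeasure \<mu> (cball_in E y0 rB)"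
    interpret finite_measure \<mu> by (rule \<mu>(1))
    have AE: "AE x in \<mu>. x \<in> cball_in E y0 rB"
      using AE_in_measure_support[OF \<mu>(2)] supp by (auto elim!: eventually_mono)
    have growth: "measure \<mu> (cball y r) \<le> C0 * r powr m" if "y \<in> E - H" "r > 0" for y r
    proof -
      have "measure \<mu> (cball y r) = measure \<mu> (cball_in E y r)"
      proof (rule measure_eq_AE)
        show "AE x in \<mu>. x \<in> cball y r \<longleftrightarrow> x \<in> cball_in E y r"
          using AE by eventually_elim (auto simp: cball_in_def)
      qed (use E \<mu>(2) in \<open>auto simp: cball_in_def\<close>)
      moreover have "y \<in> cball_in E y r" using that unfolding cball_in_def by simp
      then have "\<not> cball_in E y r \<subseteq> H" using that by auto
      ultimately have "\<not> C0 * r powr m \<le> measure \<mu> (cball y r)" using gr that by auto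
      then show ?thesis by simp
    qed
    have bb: "AE x in \<mu>. cmod (b x) \<le> bnorm"
      using esssup_AE[of "\<lambda>y. ennreal (cmod (b y))" \<mu>] b(2) assms(8) unfolding Linf_norm_def by simp
    interpret D: random_dyadic_family E y0 rB k0 ?\<gamma> L M Cbad \<eta> r0 X z Q by (rule D)
    interpret L: local_Tb E m \<alpha> \<beta> K1 K2 C0 rB S y0 \<mu> H k0 ?\<gamma> L M Cbad \<eta> r0 X z Q b bnorm c_acc s \<delta>0 C1
    proof unfold_locales
      show "ennreal (t powr s) * emeasure \<mu> {y \<in> cball_in E y0 rB - H. C_op E \<alpha> S \<mu> b y > ennreal t} \<le>
          ennreal C1 * emeasure \<mu> (cball_in E y0 rB)" if "t > 0" for t
        using wk that by (auto simp: SUP_le_iff)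
      show "0 < ?\<gamma>" "?\<gamma> < 1" using assms(1,2) by (auto simp: field_simps)
    qed (use assms E S y0 rB \<mu> AE growth bb b H exc in auto)
    show "\<exists>G. G \<in> sets borel \<and> G \<subseteq> cball_in E y0 rB \<and>
       measure \<mu> G \<ge> (1 - \<delta>0) / 3 * measure \<mu> (cball_in E y0 rB) \<and>
       (\<forall>f. in_L2 \<mu> f \<longrightarrow>
          L2_norm \<mu> (\<lambda>y. indicator G y * C_op E \<alpha> S \<mu> f y)
            \<le> ennreal C * L2_norm \<mu> (\<lambda>y. ennreal (cmod (f y))))"
    proof (rule L.big_piece)
      fix G assume G: "G \<in> sets borel" "G \<subseteq> cball_in E y0 rB"
        "2 * L.\<kappa> * measure \<mu> (cball_in E y0 rB) \<le> measure \<mu> G"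
        "\<And>f. square_integrable \<mu> f \<Longrightarrow>
          (\<integral>\<^sup>+ y\<in>G. L.sq UNIV f y \<partial>\<mu>) \<le> ennreal L.K_final * (\<integral>\<^sup>+ x. (ennreal (cmod (f x)))\<^sup>2 \<partial>\<mu>)"
      show ?thesis
    proof (intro exI[of _ G] conjI allI impI G(1,2))
      have \<kappa>: "2 * L.\<kappa> = (1 - \<delta>0) / 3" unfolding L.\<kappa>_def by simp
      show "measure \<mu> G \<ge> (1 - \<delta>0) / 3 * measure \<mu> (cball_in E y0 rB)"
        using G(3) unfolding \<kappa> .
      fix f assume f: "in_L2 \<mu> f"
      let ?I = "\<integral>\<^sup>+ x. (ennreal (cmod (f x)))\<^sup>2 \<partial>\<mu>"
      have fm: "f \<in> borel_measurable \<mu>" using f unfolding in_L2_def by simp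
      have "?I < \<top>" using f unfolding in_L2_def L2_norm_def ennsqrt_def by (auto simp: top.not_eq_extremum split: if_splits)
      then have fs: "square_integrable \<mu> f"
        unfolding square_integrable_def using fm by (subst integrable_iff_bounded) (auto simp: ennreal_power)
      have "(\<integral>\<^sup>+ y. (indicator G y * C_op E \<alpha> S \<mu> f y)\<^sup>2 \<partial>\<mu>) = (\<integral>\<^sup>+ y\<in>G. L.sq UNIV f y \<partial>\<mu>)"
        unfolding L.C_op_eq by (intro nn_integral_cong) (auto simp: indicator_def ennsqrt_power2)
      also have "\<dots> \<le> ennreal L.K_final * ?I" by (rule G(4)[OF fs])
      also have "\<dots> \<le> ennreal (C\<^sup>2) * ?I"
        using C(2) unfolding K_def by (intro mult_right_mono ennreal_leI) auto
      finally have "L2_norm \<mu> (\<lambda>y. indicator G y * C_op E \<alpha> S \<mu> f y) \<le> ennsqrt (ennreal (C\<^sup>2) * ?I)"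
        unfolding L2_norm_def by (rule ennsqrt_mono)
      also have "\<dots> \<le> ennreal C * ennsqrt ?I" using C(1) by (intro ennsqrt_mult) simp
      finally show "L2_norm \<mu> (\<lambda>y. indicator G y * C_op E \<alpha> S \<mu> f y)
            \<le> ennreal C * L2_norm \<mu> (\<lambda>y. ennreal (cmod (f y)))"
        unfolding L2_norm_def .
    qed
    qed
  qed
qed

end
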